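(* Suppose that the topology sequence $\{\mathcal{G}(t)\}_{t\ge1}$ satisfies (A1) and (A2) with $\delta<\frac12$, that the noises satisfy (A4), and that the initial state $x(1)\in\mathbb{R}^n$ is not in consensus (its entries are not all equal). Then, for the system described in the context: (i) $\rho_2(t)=\Theta\big(\frac{1}{t^{1-2\delta}}\big)$. (ii) Unbiased mean square average-consensus will be reached with rate $E[V(x(t))]=O\big(\frac{1}{t^{1-2\delta}}\big)$ by choosing $a(t)=\frac{\alpha}{t^{1-\delta}+t^*}$, where $\alpha$ and $t^*$ are two constants satisfying $$\alpha\ge\frac{32n(n-1)^4c}{(2n-3)^2}\quad\text{and}\quad t^*\ge\lfloor2\alpha(n-1)a_{\max}\rfloor ,$$ with $\delta$ and $c$ the constants appearing in (A1).
   Context: System. There are $n$ agents with scalar states $x_i(t)$, $t=1,2,\dots$, and $x(t)=(x_1(t),\dots,x_n(t))'$. At each time $t$ the topology is a weighted digraph $\mathcal{G}(t)=(\mathcal{V},\mathcal{E}(t),\mathcal{A}(t))$ on $\mathcal{V}=\{1,\dots,n\}$; $\mathcal{N}_i(t)=\{j:(j,i)\in\mathcal{E}(t)\}$ is the neighbor set of $i$, and the edge $(j,i)$ has weight $a_{ij}^t$ (the $(i,j)$ entry of $\mathcal{A}(t)$). It is assumed throughout that $1\le a_{ij}^t\le a_{\max}$ for all $t\ge1$, $1\le i\le n$, $j\in\mathcal{N}_i(t)$, where $a_{\max}$ is a constant. The dynamics is $$x_i(t+1)=x_i(t)+a(t)\sum_{j\in\mathcal{N}_i(t)}a_{ij}^t\,[x_j(t)-x_i(t)+w_{ji}(t)],\qquad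 t\ge1,\ 1\le i\le n,$$ where $a(t)\ge0$ is the common gain (an open-loop control) and $w_{ji}(t)$ is the random noise of agent $i$ receiving information from agent $j$ at time $t$. For $x\in\mathbb{R}^n$, $x_{\rm ave}=\frac1n\sum_{i=1}^n x_i$ and $V(x)=\sum_{i=1}^n(x_i-x_{\rm ave})^2$. Mean square consensus: there is a random variable $x^*$ with $|E(x^* )|<\infty$, $\mathrm{Var}(x^* )<\infty$ and $\lim_{t\to\infty}E\|x(t)-x^*\mathbf{1}\|^2=0$ ($\mathbf 1$ is the all-ones vector, $\|\cdot\|$ the Euclidean norm). Unbiased mean square average-consensus: in addition $E(x^* )=\frac1n\sum_{i=1}^n x_i(1)$. (A1) (extensible joint-connectivity): there exist constants $\delta\ge0$ and $c\ge1$, and an infinite sequence of times $1=t_1<t_2<t_3<\cdots$ such that $t_k\le t_{k-1}+c\,t_{k-1}^{\delta}$ and the union graph $\bigcup_{t_{k-1}\le t<t_k}\mathcal{G}(t)$ is strongly connected for all $k>1$. (A2): the topology $\mathcal{G}(t)$ is balanced for all $t\ge1$, i.e. for every node $i$ the in-degree $\sum_{j\in\mathcal{N}_i(t)}a_{ij}^t$ equals the out-degree $\sum_{j:\,i\in\mathcal{N}_j(t)}a_{ji}^t$. $\mathscr{G}_{\delta,c}$ is the set of topology sequences satisfying (A1) and (A2), where $\delta,c$ are the constants appearing in (A1). The fastest convergence rate with respect to the worst topologies is $$\rho_2(t):=\inf_{a(1)\ge0,\dots,a(t-1)\ge0}\ \sup_{\{\mathcal{G}(k)\}\in\mathscr{G}_{\delta,c}}E[V(x(t))];$$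 it depends on $\delta,c$, the noises and the initial state. (A4): for any topology sequence $\{\mathcal{G}(t)\}_{t\ge1}$, the noises $\{w_{ji}(t)\}$ are zero-mean random variables satisfying: (i) $E[w_{j_1i_1}(t_1)w_{j_2i_2}(t_2)]=0$ for any $t_1\ne t_2$, $(j_1,i_1)\in\mathcal{E}(t_1)$, $(j_2,i_2)\in\mathcal{E}(t_2)$; (ii) there exist constants $0<\underline v\le\overline v$ such that for any non-empty edge set $\mathcal{E}(t)$ and real numbers $\{c_{ji}\}$, $$\underline v\sum_{(j,i)\in\mathcal{E}(t)}c_{ji}^2\le E\Big[\sum_{(j,i)\in\mathcal{E}(t)}c_{ji}w_{ji}(t)\Big]^2\le\overline v\sum_{(j,i)\in\mathcal{E}(t)}c_{ji}^2 .$$ For positive sequences, $g_1(t)=O(g_2(t))$ means there are $c_0>0$, $t_0>0$ with $g_1(t)\le c_0g_2(t)$ for all $t\ge t_0$; $g_1(t)=\Theta(g_2(t))$ means there are constants $c_2>c_1>0$ and $t_0>0$ with $c_1g_2(t)\le g_1(t)\le c_2g_2(t)$ for all $t\ge t_0$. *)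

theory Defs
  imports
    "HOL-Probability.Probability"
    "HOL-Library.Landau_Symbols"
    "Graph_Theory.Pair_Digraph"
    "Graph_Theory.Digraph_Component"
begin

text \<open>
  The agents are the elements of a finite type \<open>'n\<close>, so \<open>n = CARD('n)\<close>.
  An edge \<open>(j, i)\<close> means that \<open>i\<close> receives information from \<open>j\<close>; its weight is
  \<open>a\<^sub>i\<^sub>j = weight g $ i $ j\<close>.  Entries of the matrix at non-edges are never used.
  Self-loops are not excluded.  They do not affect balancedness or connectivity, and a
  self-loop at \<open>i\<close> only adds the term \<open>a\<^sub>i\<^sub>i w\<^sub>i\<^sub>i\<close> to the dynamics.
\<close>

record 'n wdigraph =
  edges :: "('n \<times> 'n) set"
  weight :: "real ^ 'n ^ 'n"

text \<open>Times are \<open>1, 2, \<dots>\<close>; the value of a topology sequence at \<open>0\<close> is irrelevant.\<close>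

type_synonym 'n topology = "nat \<Rightarrow> 'n wdigraph"

definition nbrs :: "('n::finite) wdigraph \<Rightarrow> 'n \<Rightarrow> 'n set" where
  "nbrs g i = {j. (j, i) \<in> edges g}"

definition weights_bounded :: "real \<Rightarrow> ('n::finite) topology \<Rightarrow> bool" where
  "weights_bounded amax G \<longleftrightarrow>
     (\<forall>t\<ge>1. \<forall>i. \<forall>j\<in>nbrs (G t) i. 1 \<le> weight (G t) $ i $ j \<and> weight (G t) $ i $ j \<le> amax)"

definition union_graph :: "('n::finite) topology \<Rightarrow> nat set \<Rightarrow> 'n pair_pre_digraph" where
  "union_graph G T = \<lparr>pverts = UNIV, parcs = (\<Union>t\<in>T. edges (G t))\<rparr>"

definition ext_joint_connected :: "real \<Rightarrow> real \<Rightarrow> ('n::finite) topology \<Rightarrow> bool" where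
  "ext_joint_connected \<delta> c G \<longleftrightarrow>
     (\<exists>\<tau>::nat \<Rightarrow> nat. \<tau> 1 = 1 \<and> strict_mono_on {1..} \<tau> \<and>
        (\<forall>k>1. real (\<tau> k) \<le> real (\<tau> (k - 1)) + c * real (\<tau> (k - 1)) powr \<delta> \<and>
               strongly_connected (with_proj (union_graph G {\<tau> (k - 1)..<\<tau> k}))))"

definition balanced :: "('n::finite) wdigraph \<Rightarrow> bool" where
  "balanced g \<longleftrightarrow>
     (\<forall>i. (\<Sum>j\<in>nbrs g i. weight g $ i $ j) = (\<Sum>j | i \<in> nbrs g j. weight g $ j $ i))"

definition topology_class :: "real \<Rightarrow> real \<Rightarrow> real \<Rightarrow> ('n::finite) topology set" where
  "topology_class amax \<delta> c =
     {G. weights_bounded amax G \<and> ext_joint_connected \<delta> c G \<and> (\<forall>t\<ge>1. balanced (G t))}"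

text \<open>
  The noise may depend on the topology sequence: \<open>w G t j i\<close> is the noise on the edge
  \<open>(j, i)\<close> at time \<open>t\<close> under the topology sequence \<open>G\<close>.
\<close>

type_synonym ('n, 'w) noise = "'n topology \<Rightarrow> nat \<Rightarrow> 'n \<Rightarrow> 'n \<Rightarrow> 'w \<Rightarrow> real"

text \<open>
  The variance bounds \<open>vlo\<close>, \<open>vhi\<close> are uniform over all topology sequences and all times.
  The integrability of the squares already follows from the lower variance bound, since the
  Bochner integral of a non-integrable function is \<open>0\<close>.
\<close>

definition admissible_noise ::
    "'w measure \<Rightarrow> real \<Rightarrow> (('n::finite), 'w) noise \<Rightarrow> bool" where
  "admissible_noise M amax w \<longleftrightarrow>
     (\<exists>vlo vhi. 0 < vlo \<and> vlo \<le> vhi \<and>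
       (\<forall>G. weights_bounded amax G \<longrightarrow>
         (\<forall>t\<ge>1. \<forall>(j, i)\<in>edges (G t).
            integrable M (w G t j i) \<and> (\<integral>\<omega>. w G t j i \<omega> \<partial>M) = 0 \<and>
            integrable M (\<lambda>\<omega>. (w G t j i \<omega>)\<^sup>2)) \<and>
         (\<forall>s\<ge>1. \<forall>t\<ge>1. s \<noteq> t \<longrightarrow>
            (\<forall>(j1, i1)\<in>edges (G s). \<forall>(j2, i2)\<in>edges (G t).
               (\<integral>\<omega>. w G s j1 i1 \<omega> * w G t j2 i2 \<omega> \<partial>M) = 0)) \<and>
         (\<forall>t\<ge>1. edges (G t) \<noteq> {} \<longrightarrow>
            (\<forall>d :: 'n \<Rightarrow> 'n \<Rightarrow> real.
               vlo * (\<Sum>(j, i)\<in>edges (G t). (d j i)\<^sup>2)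
                 \<le> (\<integral>\<omega>. (\<Sum>(j, i)\<in>edges (G t). d j i * w G t j i \<omega>)\<^sup>2 \<partial>M) \<and>
               (\<integral>\<omega>. (\<Sum>(j, i)\<in>edges (G t). d j i * w G t j i \<omega>)\<^sup>2 \<partial>M)
                 \<le> vhi * (\<Sum>(j, i)\<in>edges (G t). (d j i)\<^sup>2)))))"

text \<open>The state at time \<open>1\<close> is \<open>x1\<close>; the value at time \<open>0\<close> is a dummy.\<close>

fun state :: "(nat \<Rightarrow> real) \<Rightarrow> (('n::finite), 'w) noise \<Rightarrow> 'n topology \<Rightarrow> real ^ 'n \<Rightarrow>
    nat \<Rightarrow> 'w \<Rightarrow> real ^ 'n" where
  "state a w G x1 0 \<omega> = x1"
| "state a w G x1 (Suc 0) \<omega> = x1"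
| "state a w G x1 (Suc (Suc k)) \<omega> =
     (let t = Suc k; x = state a w G x1 t \<omega> in
      \<chi> i. x $ i + a t * (\<Sum>j\<in>nbrs (G t) i.
              weight (G t) $ i $ j * (x $ j - x $ i + w G t j i \<omega>)))"

definition ave :: "real ^ ('n::finite) \<Rightarrow> real" where
  "ave x = (\<Sum>i\<in>UNIV. x $ i) / real CARD('n)"

definition V :: "real ^ ('n::finite) \<Rightarrow> real" where
  "V x = (\<Sum>i\<in>UNIV. (x $ i - ave x)\<^sup>2)"

text \<open>
  Expectations of nonnegative quantities are taken as nonnegative integrals in
  \<open>[0, \<infinity>]\<close>, so that suprema and infima over them are always meaningful.
\<close>

definition EV :: "'w measure \<Rightarrow> (nat \<Rightarrow> 'w \<Rightarrow> real ^ ('n::finite)) \<Rightarrow> nat \<Rightarrow> ennreal" where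
  "EV M x t = (\<integral>\<^sup>+\<omega>. ennreal (V (x t \<omega>)) \<partial>M)"

definition rho2 :: "'w measure \<Rightarrow> real \<Rightarrow> real \<Rightarrow> real \<Rightarrow> (('n::finite), 'w) noise \<Rightarrow>
    real ^ 'n \<Rightarrow> nat \<Rightarrow> ennreal" where
  "rho2 M amax \<delta> c w x1 t =
     (INF a\<in>{a :: nat \<Rightarrow> real. \<forall>s\<in>{1..<t}. 0 \<le> a s}.
        SUP G\<in>topology_class amax \<delta> c. EV M (state a w G x1) t)"

definition ms_consensus_to ::
    "'w measure \<Rightarrow> (nat \<Rightarrow> 'w \<Rightarrow> real ^ ('n::finite)) \<Rightarrow> ('w \<Rightarrow> real) \<Rightarrow> bool" where
  "ms_consensus_to M x xs \<longleftrightarrow>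
     integrable M xs \<and> integrable M (\<lambda>\<omega>. (xs \<omega>)\<^sup>2) \<and>
     (\<lambda>t. \<integral>\<^sup>+\<omega>. ennreal ((norm (x t \<omega> - xs \<omega> *\<^sub>R (1 :: real ^ 'n)))\<^sup>2) \<partial>M) \<longlonglongrightarrow> 0"

definition unbiased_ms_average_consensus ::
    "'w measure \<Rightarrow> (nat \<Rightarrow> 'w \<Rightarrow> real ^ ('n::finite)) \<Rightarrow> real ^ 'n \<Rightarrow> bool" where
  "unbiased_ms_average_consensus M x x1 \<longleftrightarrow>
     (\<exists>xs. ms_consensus_to M x xs \<and> (\<integral>\<omega>. xs \<omega> \<partial>M) = ave x1)"

text \<open>
  Orders of growth for \<open>[0, \<infinity>]\<close>-valued sequences indexed by \<open>t \<ge> 1\<close>: all terms are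
  required to be finite and the resulting real sequence has the given order.
\<close>

definition finite_bigo :: "(nat \<Rightarrow> ennreal) \<Rightarrow> (nat \<Rightarrow> real) \<Rightarrow> bool" where
  "finite_bigo f g \<longleftrightarrow> (\<forall>t\<ge>1. f t < \<infinity>) \<and> (\<lambda>t. enn2real (f t)) \<in> O(g)"

definition finite_bigtheta :: "(nat \<Rightarrow> ennreal) \<Rightarrow> (nat \<Rightarrow> real) \<Rightarrow> bool" where
  "finite_bigtheta f g \<longleftrightarrow> (\<forall>t\<ge>1. f t < \<infinity>) \<and> (\<lambda>t. enn2real (f t)) \<in> \<Theta>(g)"

end

theory Submission
  imports Defs
begin

text \<open>
  Write \<open>v(t) = E V(x(t))\<close> and \<open>p = 1 - 2\<delta>\<close>.  The state at time \<open>t\<close> is orthogonal to the noise of time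
  \<open>t\<close>, so a step first moves the state along minus the Laplacian and then adds \<open>a(t)\<^sup>2\<close> times the
  mean disagreement of the received noise to \<open>v\<close> (\<open>mean_disagreement_Suc\<close>).

  Upper bound.  On balanced graphs the Laplacian step lowers \<open>V\<close> by about \<open>a(t)\<close> times the quadratic
  form \<open>\<Sum> a\<^sub>i\<^sub>j (x\<^sub>j - x\<^sub>i)\<^sup>2\<close> over the current edges (\<open>V_consensus_step\<close>).  A single graph may have few
  edges, but over a block \<open>[T, T')\<close> their union is strongly connected and the quadratic form of the
  union dominates \<open>V / n\<^sup>2\<close> (\<open>V_le_connected\<close>).  With gains at most \<open>A = \<alpha> T\<^sup>\<delta>\<^sup>-\<^sup>1\<close> and block length
  \<open>L \<le> c T\<^sup>\<delta>\<close>, the product \<open>L A\<close> has order \<open>T\<^sup>2\<^sup>\<delta>\<^sup>-\<^sup>1\<close>; it tends to \<open>0\<close> because \<open>\<delta> < 1/2\<close>, so late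
  blocks are too short for the state to move much, and all edges act as if on the state at the start
  of the block.  This gives \<open>v(T') \<le> (1 - A / (8n\<^sup>2)) v(T) + const L A\<^sup>2\<close> (\<open>block_contraction\<close>).  The
  target \<open>T\<^sup>-\<^sup>p\<close> loses at most the fraction \<open>c T\<^sup>\<delta>\<^sup>-\<^sup>1\<close> in a block; the contraction is twice that as soon
  as \<open>\<alpha> \<ge> 16 n\<^sup>2 c\<close>, and the surplus absorbs the noise, which has the same order \<open>T\<^sup>-\<^sup>p T\<^sup>\<delta>\<^sup>-\<^sup>1\<close>.  Hence
  \<open>v(t) \<le> K t\<^sup>-\<^sup>p\<close> with \<open>K\<close> independent of the topology (\<open>disagreement_rate\<close>).

  Consensus.  By balance the average of the states moves by the noise alone.  Its increments are
  orthogonal with summable second moments, hence it converges in \<open>L\<^sup>2\<close> to a variable with the initial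
  mean, and \<open>v(t) \<rightarrow> 0\<close> draws all states to it (\<open>unbiased_consensus\<close>).

  Lower bound.  The adversary knows the gains.  It cuts time into blocks of length about \<open>c T\<^sup>\<delta>\<close>, shows
  the complete graph once per block, at the time of the smallest gain \<open>b\<close>, and only self-loops
  otherwise.  The whole block injects noise of order \<open>L b\<^sup>2\<close> for a single contraction by \<open>1 - n b\<close>.
  Minimising over \<open>b\<close>, no gain can push \<open>v\<close> below a multiple of \<open>T\<^sup>-\<^sup>p\<close>
  (\<open>disagreement_lower_bound\<close>).
\<close>

section \<open>Disagreement and the deterministic part of the dynamics\<close>

lemma V_translate_le:
  fixes x :: "real ^ ('n::finite)"
  shows "V x \<le> (\<Sum>i\<in>UNIV. (x $ i - b)\<^sup>2)"
proof -
  let ?n = "real CARD('n)"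
  have s: "(\<Sum>i\<in>UNIV. x $ i) = ?n * ave x" by (simp add: ave_def)
  have "(\<Sum>i\<in>UNIV. (x $ i - b)\<^sup>2)
      = (\<Sum>i\<in>UNIV. (x $ i - ave x)\<^sup>2 + 2 * (ave x - b) * x $ i + (b\<^sup>2 - (ave x)\<^sup>2))"
    by (rule sum.cong) (auto simp: power2_eq_square algebra_simps)
  also have "\<dots> = V x + 2 * (ave x - b) * (?n * ave x) + ?n * (b\<^sup>2 - (ave x)\<^sup>2)"
    by (simp add: sum.distrib V_def flip: s sum_distrib_left)
  also have "\<dots> = V x + ?n * (ave x - b)\<^sup>2"
    by (simp add: power2_eq_square algebra_simps)
  finally show ?thesis by simp
qed

lemma sum_minus_ave: "(\<Sum>i\<in>UNIV. x $ i - ave x) = (0::real)"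
  for x :: "real ^ ('n::finite)"
  by (simp add: sum_subtractf ave_def)

lemma ave_add: "ave (x + y) = ave x + ave y"
  by (simp add: ave_def sum.distrib add_divide_distrib)

lemma ave_scaleR: "ave (c *\<^sub>R x) = c * ave x"
  by (simp add: ave_def flip: sum_distrib_left)

lemma V_scaleR: "V (c *\<^sub>R x) = c\<^sup>2 * V x"
proof -
  have "V (c *\<^sub>R x) = (\<Sum>i\<in>UNIV. c\<^sup>2 * (x $ i - ave x)\<^sup>2)"
    unfolding V_def ave_scaleR
    by (rule sum.cong) (auto simp: power2_eq_square algebra_simps)
  then show ?thesis by (simp add: V_def sum_distrib_left)
qed

lemma V_add:
  "V (x + y) = V x + 2 * (\<Sum>i\<in>UNIV. (x $ i - ave x) * y $ i) + V y"
proof -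
  have "(\<Sum>i\<in>UNIV. (x $ i - ave x) * ave y) = 0"
    by (simp only: sum_distrib_right[symmetric] sum_minus_ave)
  then have c: "(\<Sum>i\<in>UNIV. (x $ i - ave x) * (y $ i - ave y)) = (\<Sum>i\<in>UNIV. (x $ i - ave x) * y $ i)"
    by (simp add: right_diff_distrib sum_subtractf)
  have "V (x + y) = (\<Sum>i\<in>UNIV. (x $ i - ave x)\<^sup>2 + 2 * ((x $ i - ave x) * (y $ i - ave y))
      + (y $ i - ave y)\<^sup>2)"
    unfolding V_def by (rule sum.cong) (auto simp: ave_add power2_eq_square algebra_simps)
  then show ?thesis by (simp add: sum.distrib V_def c flip: sum_distrib_left)
qed

lemma V_nonneg: "0 \<le> V x"
  by (simp add: V_def sum_nonneg)

lemma V_le_norm: "V x \<le> (norm x)\<^sup>2"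
  using V_translate_le[of x 0] by (simp add: norm_vec_def L2_set_def sum_nonneg)

lemma power2_sum_le_card:
  fixes f :: "'a \<Rightarrow> real"
  shows "(\<Sum>i\<in>A. f i)\<^sup>2 \<le> real (card A) * (\<Sum>i\<in>A. (f i)\<^sup>2)"
  using Cauchy_Schwarz_ineq_sum[of "\<lambda>_. 1" f A] by simp

text \<open>\<open>drift\<close> is minus the weighted Laplacian; on balanced graphs \<open>dissipation\<close> is twice the
  quadratic form of the Laplacian.  \<open>input g u\<close> collects what each agent receives when every edge carries the value \<open>u\<close>.\<close>

definition drift :: "('n::finite) wdigraph \<Rightarrow> real ^ 'n \<Rightarrow> real ^ 'n" where
  "drift g x = (\<chi> i. \<Sum>j\<in>nbrs g i. weight g $ i $ j * (x $ j - x $ i))"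

definition input :: "('n::finite) wdigraph \<Rightarrow> ('n \<Rightarrow> 'n \<Rightarrow> real) \<Rightarrow> real ^ 'n" where
  "input g u = (\<chi> i. \<Sum>j\<in>nbrs g i. weight g $ i $ j * u j i)"

definition dissipation :: "('n::finite) wdigraph \<Rightarrow> real ^ 'n \<Rightarrow> real" where
  "dissipation g x = (\<Sum>(j, i)\<in>edges g. weight g $ i $ j * (x $ j - x $ i)\<^sup>2)"

definition weights_in :: "real \<Rightarrow> ('n::finite) wdigraph \<Rightarrow> bool" where
  "weights_in amax g \<longleftrightarrow> (\<forall>(j, i)\<in>edges g. 1 \<le> weight g $ i $ j \<and> weight g $ i $ j \<le> amax)"

lemma weights_bounded_iff: "weights_bounded amax G \<longleftrightarrow> (\<forall>t\<ge>1. weights_in amax (G t))"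
  by (auto simp: weights_bounded_def weights_in_def nbrs_def)

lemma sum_nbrs: "(\<Sum>i\<in>UNIV. \<Sum>j\<in>nbrs g i. f i j) = (\<Sum>(j, i)\<in>edges g. f i j)"
proof -
  have "(\<Sum>i\<in>UNIV. \<Sum>j\<in>nbrs g i. f i j) = (\<Sum>(i, j)\<in>(SIGMA i:UNIV. nbrs g i). f i j)"
    by (rule sum.Sigma) auto
  also have "\<dots> = (\<Sum>(j, i)\<in>edges g. f i j)"
    by (rule sum.reindex_bij_witness[of _ prod.swap prod.swap]) (auto simp: nbrs_def)
  finally show ?thesis .
qed

text \<open>The left side sums \<open>f\<close> against the in-degrees, the right side against the out-degrees.\<close>

lemma balanced_flow:
  assumes "balanced g"
  shows "(\<Sum>(j, i)\<in>edges g. weight g $ i $ j * f i) = (\<Sum>(j, i)\<in>edges g. weight g $ i $ j * f j)"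
proof -
  have "(\<Sum>(j, i)\<in>edges g. weight g $ i $ j * f i)
      = (\<Sum>i\<in>UNIV. (\<Sum>j\<in>nbrs g i. weight g $ i $ j) * f i)"
    by (simp add: sum_distrib_right flip: sum_nbrs)
  also have "\<dots> = (\<Sum>i\<in>UNIV. (\<Sum>j | i \<in> nbrs g j. weight g $ j $ i) * f i)"
    using assms by (simp add: balanced_def)
  also have "\<dots> = (\<Sum>i\<in>UNIV. \<Sum>j | i \<in> nbrs g j. weight g $ j $ i * f i)"
    by (simp add: sum_distrib_right)
  also have "\<dots> = (\<Sum>(i, j)\<in>(SIGMA i:UNIV. {j. i \<in> nbrs g j}). weight g $ j $ i * f i)"
    by (rule sum.Sigma) auto
  also have "\<dots> = (\<Sum>(j, i)\<in>edges g. weight g $ i $ j * f j)"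
    by (rule sum.cong) (auto simp: nbrs_def)
  finally show ?thesis .
qed

lemma sum_drift_eq_0:
  assumes "balanced g"
  shows "(\<Sum>i\<in>UNIV. drift g x $ i) = 0"
  using balanced_flow[OF assms, of "\<lambda>i. x $ i"]
  by (simp add: drift_def sum_nbrs right_diff_distrib sum_subtractf case_prod_unfold)

lemma ave_drift: "balanced g \<Longrightarrow> ave (drift g x) = 0"
  by (simp add: ave_def sum_drift_eq_0)

lemma dissipation_nonneg: "weights_in amax g \<Longrightarrow> 0 \<le> dissipation g x"
  unfolding dissipation_def
  by (rule sum_nonneg) (auto simp: weights_in_def intro!: mult_nonneg_nonneg)

lemma sum_all_pairs: "(\<Sum>i\<in>UNIV. \<Sum>j\<in>UNIV. (x $ j - x $ i)\<^sup>2) = 2 * real CARD('n) * V x"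
  for x :: "real ^ ('n::finite)"
proof -
  let ?y = "\<lambda>i. x $ i - ave x"
  have "(\<Sum>i\<in>UNIV. \<Sum>j\<in>UNIV. (x $ j - x $ i)\<^sup>2)
      = (\<Sum>i\<in>UNIV. \<Sum>j\<in>UNIV. (?y j)\<^sup>2 - 2 * (?y i * ?y j) + (?y i)\<^sup>2)"
    by (intro sum.cong) (auto simp: power2_eq_square algebra_simps)
  also have "\<dots> = 2 * real CARD('n) * V x - 2 * (\<Sum>i\<in>UNIV. \<Sum>j\<in>UNIV. ?y i * ?y j)"
    by (simp add: sum.distrib sum_subtractf V_def sum_distrib_left mult_ac)
  also have "(\<Sum>i\<in>UNIV. \<Sum>j\<in>UNIV. ?y i * ?y j) = 0"
    by (simp only: sum_distrib_left[symmetric] sum_minus_ave) simp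
  finally show ?thesis by simp
qed

lemma dissipation_le:
  fixes x :: "real ^ ('n::finite)"
  assumes "weights_in amax g" "0 \<le> amax"
  shows "dissipation g x \<le> 2 * real CARD('n) * amax * V x"
proof -
  have "dissipation g x \<le> (\<Sum>(j, i)\<in>edges g. amax * (x $ j - x $ i)\<^sup>2)"
    unfolding dissipation_def using assms
    by (intro sum_mono) (auto simp: weights_in_def intro!: mult_right_mono)
  also have "\<dots> \<le> (\<Sum>(j, i)\<in>UNIV. amax * (x $ j - x $ i)\<^sup>2)"
    using assms by (intro sum_mono2) auto
  also have "\<dots> = amax * (\<Sum>i\<in>UNIV. \<Sum>j\<in>UNIV. (x $ j - x $ i)\<^sup>2)"
    unfolding sum.cartesian_product UNIV_Times_UNIV sum_distrib_left
    by (rule sum.cong) (auto simp: power2_commute)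
  finally show ?thesis by (simp add: sum_all_pairs mult_ac)
qed

lemma norm_drift_le:
  fixes x :: "real ^ ('n::finite)"
  assumes "weights_in amax g" "0 \<le> amax"
  shows "(norm (drift g x))\<^sup>2 \<le> real CARD('n) * amax * dissipation g x"
proof -
  have "(norm (drift g x))\<^sup>2 = (\<Sum>i\<in>UNIV. (\<Sum>j\<in>nbrs g i. weight g $ i $ j * (x $ j - x $ i))\<^sup>2)"
    by (simp add: norm_vec_def L2_set_def sum_nonneg drift_def)
  also have "\<dots> \<le> (\<Sum>i\<in>UNIV. real CARD('n) * (\<Sum>j\<in>nbrs g i. (weight g $ i $ j * (x $ j - x $ i))\<^sup>2))"
    by (intro sum_mono order_trans[OF power2_sum_le_card] mult_right_mono sum_nonneg)
      (auto intro!: card_mono)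
  also have "\<dots> = real CARD('n) * (\<Sum>(j, i)\<in>edges g. (weight g $ i $ j * (x $ j - x $ i))\<^sup>2)"
    by (simp only: sum_distrib_left[symmetric] sum_nbrs)
  also have "\<dots> \<le> real CARD('n) * (\<Sum>(j, i)\<in>edges g. amax * (weight g $ i $ j * (x $ j - x $ i)\<^sup>2))"
  proof (intro mult_left_mono sum_mono)
    fix e assume "e \<in> edges g"
    then obtain j i where e: "e = (j, i)" "(j, i) \<in> edges g" by (cases e) auto
    then have w: "1 \<le> weight g $ i $ j" "weight g $ i $ j \<le> amax"
      using assms(1) by (auto simp: weights_in_def)
    have "weight g $ i $ j * (weight g $ i $ j * (x $ j - x $ i)\<^sup>2)
        \<le> amax * (weight g $ i $ j * (x $ j - x $ i)\<^sup>2)"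
      using w by (intro mult_right_mono) auto
    then show "(case e of (j, i) \<Rightarrow> (weight g $ i $ j * (x $ j - x $ i))\<^sup>2)
        \<le> (case e of (j, i) \<Rightarrow> amax * (weight g $ i $ j * (x $ j - x $ i)\<^sup>2))"
      by (simp add: e power_mult_distrib power2_eq_square algebra_simps)
  qed simp
  also have "\<dots> = real CARD('n) * amax * dissipation g x"
    by (simp add: dissipation_def sum_distrib_left case_prod_unfold mult_ac)
  finally show ?thesis .
qed

text \<open>Balance makes the antisymmetric part of the Laplacian invisible to the quadratic form, as
  \<open>2 y\<^sub>i (y\<^sub>j - y\<^sub>i) = y\<^sub>j\<^sup>2 - y\<^sub>i\<^sup>2 - (y\<^sub>j - y\<^sub>i)\<^sup>2\<close> and the first two terms cancel over a balanced graph.\<close>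

lemma V_consensus_step:
  fixes x :: "real ^ ('n::finite)"
  assumes w: "weights_in amax g" "0 \<le> amax" and b: "balanced g"
  shows "V (x + a *\<^sub>R drift g x) \<le> V x - a * (1 - a * real CARD('n) * amax) * dissipation g x"
proof -
  let ?y = "\<lambda>i. x $ i - ave x"
  have "2 * (\<Sum>i\<in>UNIV. ?y i * drift g x $ i)
      = (\<Sum>(j, i)\<in>edges g. 2 * (?y i * (weight g $ i $ j * (x $ j - x $ i))))"
    by (simp add: drift_def sum_distrib_left flip: sum_nbrs)
  also have "\<dots> = (\<Sum>(j, i)\<in>edges g. weight g $ i $ j * (?y j)\<^sup>2 - weight g $ i $ j * (?y i)\<^sup>2
      - weight g $ i $ j * (x $ j - x $ i)\<^sup>2)"
    by (intro sum.cong) (auto simp: power2_eq_square algebra_simps)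
  also have "\<dots> = - dissipation g x"
    using balanced_flow[OF b, of "\<lambda>i. (?y i)\<^sup>2"]
    by (simp add: sum_subtractf case_prod_unfold dissipation_def)
  finally have c: "2 * (\<Sum>i\<in>UNIV. ?y i * drift g x $ i) = - dissipation g x" .
  have "V (x + a *\<^sub>R drift g x) = V x + a * (2 * (\<Sum>i\<in>UNIV. ?y i * drift g x $ i))
      + a\<^sup>2 * V (drift g x)"
    unfolding V_add V_scaleR by (simp add: sum_distrib_left mult_ac)
  also have "a\<^sup>2 * V (drift g x) \<le> a\<^sup>2 * (real CARD('n) * amax * dissipation g x)"
    using V_le_norm[of "drift g x"] norm_drift_le[OF w, of x] by (intro mult_left_mono) auto
  finally show ?thesis
    unfolding c by (simp add: power2_eq_square algebra_simps)
qed

section \<open>Connectivity controls disagreement\<close>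

text \<open>A shortest walk visits no vertex twice, so it has fewer than \<open>n\<close> edges, all different.\<close>

lemma diff_power2_le_rtrancl:
  fixes x :: "real ^ ('n::finite)" and E :: "('n \<times> 'n) set"
  assumes "(u, v) \<in> E\<^sup>*"
  shows "(x $ v - x $ u)\<^sup>2 \<le> real CARD('n) * (\<Sum>(j, i)\<in>E. (x $ j - x $ i)\<^sup>2)"
proof -
  define l where "l = (LEAST k. (u, v) \<in> E ^^ k)"
  have ex: "\<exists>k. (u, v) \<in> E ^^ k" using assms rtrancl_imp_relpow by blast
  then have "(u, v) \<in> E ^^ l" unfolding l_def by (rule LeastI_ex)
  then obtain f where f: "f 0 = u" "f l = v" "\<And>i. i < l \<Longrightarrow> (f i, f (Suc i)) \<in> E"
    by (auto simp: relpow_fun_conv)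
  have seg: "(f i, f (i + k)) \<in> E ^^ k" if "i + k \<le> l" for i k
    unfolding relpow_fun_conv using that f(3) by (intro exI[of _ "\<lambda>m. f (i + m)"]) auto
  have ne: "f i \<noteq> f j" if "i < j" "j \<le> l" for i j
  proof
    assume eq: "f i = f j"
    have "(u, f i) \<in> E ^^ i" using seg[of 0 i] that f(1) by simp
    moreover have "(f j, v) \<in> E ^^ (l - j)" using seg[of j "l - j"] that f(2) by simp
    ultimately have "(u, v) \<in> E ^^ (i + (l - j))" unfolding relpow_add eq by blast
    then have "l \<le> i + (l - j)" unfolding l_def by (rule Least_le)
    then show False using that by simp
  qed
  have inj: "inj_on f {..l}"
    by (rule inj_onI) (metis ne atMost_iff linorder_neqE_nat)
  have "card {..l} \<le> CARD('n)"
    by (rule card_inj_on_le[OF inj]) auto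
  then have len: "real l \<le> real CARD('n)" by simp
  have "x $ v - x $ u = (\<Sum>i<l. x $ f (Suc i) - x $ f i)"
    using f(1,2) sum_lessThan_telescope[of "\<lambda>i. x $ f i" l] by simp
  then have "(x $ v - x $ u)\<^sup>2 \<le> real l * (\<Sum>i<l. (x $ f (Suc i) - x $ f i)\<^sup>2)"
    using power2_sum_le_card[of "\<lambda>i. x $ f (Suc i) - x $ f i" "{..<l}"] by simp
  also have "(\<Sum>i<l. (x $ f (Suc i) - x $ f i)\<^sup>2)
      = (\<Sum>(j, i)\<in>(\<lambda>i. (f i, f (Suc i))) ` {..<l}. (x $ j - x $ i)\<^sup>2)"
    by (subst sum.reindex) (auto intro!: inj_onI dest: inj_onD[OF inj] simp: power2_commute)
  also have "real l * \<dots> \<le> real CARD('n) * (\<Sum>(j, i)\<in>E. (x $ j - x $ i)\<^sup>2)"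
    using f(3) by (intro mult_mono len sum_mono2) (auto intro!: sum_nonneg)
  finally show ?thesis .
qed

lemma V_le_connected:
  fixes x :: "real ^ ('n::finite)" and E :: "('n \<times> 'n) set"
  assumes "\<And>u v. (u, v) \<in> E\<^sup>*"
  shows "V x \<le> (real CARD('n))\<^sup>2 * (\<Sum>(j, i)\<in>E. (x $ j - x $ i)\<^sup>2)"
proof -
  let ?n = "real CARD('n)" and ?S = "\<Sum>(j, i)\<in>E. (x $ j - x $ i)\<^sup>2"
  \<comment> \<open>any agent serves as base point\<close>
  have "V x \<le> (\<Sum>i\<in>UNIV. (x $ i - x $ undefined)\<^sup>2)" by (rule V_translate_le)
  also have "\<dots> \<le> (\<Sum>i\<in>(UNIV::'n set). ?n * ?S)"
    by (intro sum_mono diff_power2_le_rtrancl assms)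
  finally show ?thesis by (simp add: power2_eq_square)
qed

lemma union_graph_rtrancl:
  assumes "strongly_connected (with_proj (union_graph G T))"
  shows "(u, v) \<in> (\<Union>t\<in>T. edges (G t))\<^sup>*"
proof -
  have "(u, v) \<in> rtrancl_on UNIV (\<Union>t\<in>T. edges (G t))"
    using assms by (auto simp: strongly_connected_def reachable_def union_graph_def arcs_ends_def
        arc_to_ends_def)
  then show ?thesis by (rule rtrancl_on_rtranclI)
qed

section \<open>Second moments of the noisy dynamics\<close>

definition square_integrable :: "'w measure \<Rightarrow> ('w \<Rightarrow> real) \<Rightarrow> bool" where
  "square_integrable M f \<longleftrightarrow> f \<in> borel_measurable M \<and> integrable M (\<lambda>\<omega>. (f \<omega>)\<^sup>2)"

lemma square_integrable_mult:
  assumes "square_integrable M f" "square_integrable M g"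
  shows "integrable M (\<lambda>\<omega>. f \<omega> * g \<omega>)"
proof (rule Bochner_Integration.integrable_bound)
  show "integrable M (\<lambda>\<omega>. (f \<omega>)\<^sup>2 + (g \<omega>)\<^sup>2)"
    using assms by (auto simp: square_integrable_def)
  show "(\<lambda>\<omega>. f \<omega> * g \<omega>) \<in> borel_measurable M"
    using assms by (auto simp: square_integrable_def)
  have "\<bar>u * v\<bar> \<le> u\<^sup>2 + v\<^sup>2" for u v :: real
    using sum_squares_bound[of u v] sum_squares_bound[of u "- v"] by (simp add: abs_le_iff)
  then show "AE \<omega> in M. norm (f \<omega> * g \<omega>) \<le> norm ((f \<omega>)\<^sup>2 + (g \<omega>)\<^sup>2)"
    by simp
qed

lemma square_integrable_add:
  assumes "square_integrable M f" "square_integrable M g"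
  shows "square_integrable M (\<lambda>\<omega>. f \<omega> + g \<omega>)"
  using square_integrable_mult[OF assms] assms
  by (auto simp: square_integrable_def power2_sum mult.assoc)

lemma square_integrable_cmult:
  "square_integrable M f \<Longrightarrow> square_integrable M (\<lambda>\<omega>. c * f \<omega>)"
  by (auto simp: square_integrable_def power_mult_distrib)

lemma square_integrable_diff:
  "square_integrable M f \<Longrightarrow> square_integrable M g \<Longrightarrow> square_integrable M (\<lambda>\<omega>. f \<omega> - g \<omega>)"
  using square_integrable_add[of M f "\<lambda>\<omega>. - 1 * g \<omega>"] square_integrable_cmult[of M g "- 1"] by simp

lemma square_integrable_sum:
  "(\<And>i. i \<in> I \<Longrightarrow> square_integrable M (f i)) \<Longrightarrow> square_integrable M (\<lambda>\<omega>. \<Sum>i\<in>I. f i \<omega>)"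
proof (induction I rule: infinite_finite_induct)
  case (insert i I)
  then show ?case by (auto intro!: square_integrable_add)
qed (auto simp: square_integrable_def)

lemma (in finite_measure) square_integrable_const: "square_integrable M (\<lambda>_. c)"
  by (simp add: square_integrable_def)

lemma square_integrable_ave:
  assumes "\<And>i. square_integrable M (\<lambda>\<omega>. Y \<omega> $ i)"
  shows "square_integrable M (\<lambda>\<omega>. ave (Y \<omega>))"
  using square_integrable_cmult[OF square_integrable_sum[of UNIV M "\<lambda>i \<omega>. Y \<omega> $ i"], of "1 / real CARD('a)"]
    assms by (simp add: ave_def)

lemma integrable_V:
  assumes "\<And>i. square_integrable M (\<lambda>\<omega>. Y \<omega> $ i)"
  shows "integrable M (\<lambda>\<omega>. V (Y \<omega>))"
proof -
  have "square_integrable M (\<lambda>\<omega>. Y \<omega> $ i - ave (Y \<omega>))" for i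
    by (intro square_integrable_diff square_integrable_ave assms)
  then show ?thesis unfolding V_def by (auto simp: square_integrable_def)
qed

lemma integrable_norm_power2:
  fixes Y :: "'w \<Rightarrow> real ^ ('n::finite)"
  assumes "\<And>i. square_integrable M (\<lambda>\<omega>. Y \<omega> $ i)"
  shows "integrable M (\<lambda>\<omega>. (norm (Y \<omega>))\<^sup>2)"
  using assms by (simp add: norm_vec_def L2_set_def sum_nonneg square_integrable_def)

text \<open>An upper bound for the mean square of the total noise received at one time.\<close>

definition noise_power :: "nat \<Rightarrow> real \<Rightarrow> real \<Rightarrow> real" where
  "noise_power n amax vhi = vhi * (real n)\<^sup>2 * amax\<^sup>2"

text \<open>One fixed topology sequence with the second-order data of its noise.  Gain and initial state are
  unconstrained parameters, so that the hypotheses depend only on topology and noise.\<close>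

locale noisy_network = prob_space M for M :: "'w measure" +
  fixes w :: "(('n::finite), 'w) noise" and G :: "'n topology" and a :: "nat \<Rightarrow> real"
    and x1 :: "real ^ 'n" and amax vlo vhi :: real
  assumes amax: "1 \<le> amax"
    and vlo: "0 < vlo" and vhi: "0 < vhi"
    and weights: "\<And>t. 1 \<le> t \<Longrightarrow> weights_in amax (G t)"
    and noise_integrable: "\<And>t j i. 1 \<le> t \<Longrightarrow> (j, i) \<in> edges (G t) \<Longrightarrow> integrable M (w G t j i)"
    and noise_mean: "\<And>t j i. 1 \<le> t \<Longrightarrow> (j, i) \<in> edges (G t) \<Longrightarrow> (\<integral>\<omega>. w G t j i \<omega> \<partial>M) = 0"
    and noise_square: "\<And>t j i. 1 \<le> t \<Longrightarrow> (j, i) \<in> edges (G t) \<Longrightarrow> integrable M (\<lambda>\<omega>. (w G t j i \<omega>)\<^sup>2)"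
    and noise_uncorrelated: "\<And>s t j i k l. 1 \<le> s \<Longrightarrow> 1 \<le> t \<Longrightarrow> s \<noteq> t \<Longrightarrow> (j, i) \<in> edges (G s) \<Longrightarrow>
        (k, l) \<in> edges (G t) \<Longrightarrow> (\<integral>\<omega>. w G s j i \<omega> * w G t k l \<omega> \<partial>M) = 0"
    and noise_ge: "\<And>t d. 1 \<le> t \<Longrightarrow> vlo * (\<Sum>(j, i)\<in>edges (G t). (d j i)\<^sup>2)
        \<le> (\<integral>\<omega>. (\<Sum>(j, i)\<in>edges (G t). d j i * w G t j i \<omega>)\<^sup>2 \<partial>M)"
    and noise_le: "\<And>t d. 1 \<le> t \<Longrightarrow> (\<integral>\<omega>. (\<Sum>(j, i)\<in>edges (G t). d j i * w G t j i \<omega>)\<^sup>2 \<partial>M)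
        \<le> vhi * (\<Sum>(j, i)\<in>edges (G t). (d j i)\<^sup>2)"
begin

abbreviation X :: "nat \<Rightarrow> 'w \<Rightarrow> real ^ 'n" where
  "X \<equiv> state a w G x1"

definition received_noise :: "nat \<Rightarrow> 'w \<Rightarrow> real ^ 'n" where
  "received_noise t \<omega> = input (G t) (\<lambda>j i. w G t j i \<omega>)"

definition mean_disagreement :: "nat \<Rightarrow> real" where
  "mean_disagreement t = (\<integral>\<omega>. V (X t \<omega>) \<partial>M)"

definition mean_dissipation :: "nat \<Rightarrow> real" where
  "mean_dissipation t = (\<integral>\<omega>. dissipation (G t) (X t \<omega>) \<partial>M)"

lemma state_Suc:
  assumes "1 \<le> t"
  shows "X (Suc t) \<omega> = (X t \<omega> + a t *\<^sub>R drift (G t) (X t \<omega>)) + a t *\<^sub>R received_noise t \<omega>"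
proof -
  obtain k where t: "t = Suc k" using assms by (cases t) auto
  show ?thesis
    unfolding t by (simp add: vec_eq_iff drift_def input_def received_noise_def Let_def
        ring_distribs sum.distrib)
qed

text \<open>All that is used of the past: it is square integrable and orthogonal to the present and
  future noise.  This class of functions is a linear space, and the state enters it because the
  noise of one time is orthogonal to that of any other.\<close>

definition prior :: "nat \<Rightarrow> ('w \<Rightarrow> real) \<Rightarrow> bool" where
  "prior t f \<longleftrightarrow> square_integrable M f \<and>
     (\<forall>s\<ge>t. \<forall>(j, i)\<in>edges (G s). (\<integral>\<omega>. f \<omega> * w G s j i \<omega> \<partial>M) = 0)"

lemma square_integrable_noise:
  "1 \<le> t \<Longrightarrow> (j, i) \<in> edges (G t) \<Longrightarrow> square_integrable M (w G t j i)"
  using noise_integrable noise_square by (auto simp: square_integrable_def)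

lemma prior_square_integrable: "prior t f \<Longrightarrow> square_integrable M f"
  by (simp add: prior_def)

lemma prior_add:
  assumes "prior t f" "prior t g" "1 \<le> t"
  shows "prior t (\<lambda>\<omega>. f \<omega> + g \<omega>)"
  unfolding prior_def
proof (intro conjI allI impI ballI, clarify?)
  show "square_integrable M (\<lambda>\<omega>. f \<omega> + g \<omega>)"
    using assms by (auto simp: prior_def intro: square_integrable_add)
  fix s e assume s: "t \<le> s" "e \<in> edges (G s)"
  obtain j i where e: "e = (j, i)" by (cases e)
  have sq: "square_integrable M (w G s j i)"
    using s assms e by (intro square_integrable_noise) auto
  show "case e of (j, i) \<Rightarrow> (\<integral>\<omega>. (f \<omega> + g \<omega>) * w G s j i \<omega> \<partial>M) = 0"
    using assms s e square_integrable_mult[OF _ sq, of f] square_integrable_mult[OF _ sq, of g]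
    by (fastforce simp: prior_def distrib_right)
qed

lemma prior_cmult: "prior t f \<Longrightarrow> prior t (\<lambda>\<omega>. c * f \<omega>)"
  by (auto simp: prior_def square_integrable_cmult mult.assoc)

lemma prior_diff:
  "prior t f \<Longrightarrow> prior t g \<Longrightarrow> 1 \<le> t \<Longrightarrow> prior t (\<lambda>\<omega>. f \<omega> - g \<omega>)"
  using prior_add[of t f "\<lambda>\<omega>. - 1 * g \<omega>"] prior_cmult[of t g "- 1"] by simp

lemma prior_const: "1 \<le> t \<Longrightarrow> prior t (\<lambda>_. c)"
  using noise_mean by (auto simp: prior_def square_integrable_const)

lemma prior_sum:
  "(\<And>i. i \<in> I \<Longrightarrow> prior t (f i)) \<Longrightarrow> 1 \<le> t \<Longrightarrow> prior t (\<lambda>\<omega>. \<Sum>i\<in>I. f i \<omega>)"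
proof (induction I rule: infinite_finite_induct)
  case (insert i I)
  then show ?case by (auto intro!: prior_add)
qed (auto simp: prior_const)

lemma prior_mono: "prior s f \<Longrightarrow> s \<le> t \<Longrightarrow> prior t f"
  by (auto simp: prior_def)

lemma prior_ave:
  assumes "\<And>i. prior t (\<lambda>\<omega>. Y \<omega> $ i)" "1 \<le> t"
  shows "prior t (\<lambda>\<omega>. ave (Y \<omega>))"
  using prior_cmult[OF prior_sum[of UNIV t "\<lambda>i \<omega>. Y \<omega> $ i"], of "1 / real CARD('a)"] assms
  by (simp add: ave_def)

lemma prior_drift:
  assumes "\<And>i. prior t (\<lambda>\<omega>. Y \<omega> $ i)" "1 \<le> t"
  shows "prior t (\<lambda>\<omega>. drift g (Y \<omega>) $ i)"
  using assms by (auto simp: drift_def intro!: prior_sum prior_cmult prior_diff)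

lemma prior_received_noise:
  assumes "1 \<le> t"
  shows "prior (Suc t) (\<lambda>\<omega>. received_noise t \<omega> $ i)"
proof -
  have "prior (Suc t) (w G t j i)" if "j \<in> nbrs (G t) i" for j
    using that assms square_integrable_noise[of t j i] noise_uncorrelated[of t _ j i]
    by (auto simp: prior_def nbrs_def)
  then show ?thesis
    by (auto simp: received_noise_def input_def intro!: prior_sum prior_cmult)
qed

lemma prior_state:
  assumes "1 \<le> t"
  shows "prior t (\<lambda>\<omega>. X t \<omega> $ i)"
  using assms
proof (induction t arbitrary: i rule: dec_induct)
  case base
  show ?case by (simp add: prior_const)
next
  case (step t)
  have "prior (Suc t) (\<lambda>\<omega>. X t \<omega> $ i)" for i
    using prior_mono[OF step.IH] by simp
  with step.hyps show ?case
    unfolding state_Suc[OF step.hyps(1)] vector_add_component vector_scaleR_component real_scaleR_def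
    by (intro prior_add prior_cmult prior_drift prior_received_noise) auto
qed

lemma square_integrable_received_noise:
  "1 \<le> t \<Longrightarrow> square_integrable M (\<lambda>\<omega>. received_noise t \<omega> $ i)"
  by (rule prior_square_integrable[OF prior_received_noise])

lemma square_integrable_state:
  "1 \<le> t \<Longrightarrow> square_integrable M (\<lambda>\<omega>. X t \<omega> $ i)"
  by (rule prior_square_integrable[OF prior_state])

lemma prior_orthogonal:
  assumes "prior t f" "1 \<le> t"
  shows "integrable M (\<lambda>\<omega>. f \<omega> * received_noise t \<omega> $ i)"
    and "(\<integral>\<omega>. f \<omega> * received_noise t \<omega> $ i \<partial>M) = 0"
proof -
  have i: "integrable M (\<lambda>\<omega>. weight (G t) $ i $ j * (f \<omega> * w G t j i \<omega>))" if "j \<in> nbrs (G t) i" for j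
    using that assms
    by (intro integrable_mult_right square_integrable_mult prior_square_integrable[OF assms(1)]
        square_integrable_noise) (auto simp: nbrs_def)
  have eq: "f \<omega> * received_noise t \<omega> $ i
      = (\<Sum>j\<in>nbrs (G t) i. weight (G t) $ i $ j * (f \<omega> * w G t j i \<omega>))" for \<omega>
    by (simp add: received_noise_def input_def sum_distrib_left mult_ac)
  show "integrable M (\<lambda>\<omega>. f \<omega> * received_noise t \<omega> $ i)"
    unfolding eq using i by auto
  have "(\<integral>\<omega>. f \<omega> * w G t j i \<omega> \<partial>M) = 0" if "j \<in> nbrs (G t) i" for j
    using that assms by (auto simp: prior_def nbrs_def)
  then show "(\<integral>\<omega>. f \<omega> * received_noise t \<omega> $ i \<partial>M) = 0"
    unfolding eq by (subst Bochner_Integration.integral_sum[OF i]) auto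
qed

text \<open>The cross term pairs the past with the present noise, so it vanishes in the mean.\<close>

lemma expectation_V_add_noise:
  assumes Y: "\<And>i. prior t (\<lambda>\<omega>. Y \<omega> $ i)" and t: "1 \<le> t"
  shows "(\<integral>\<omega>. V (Y \<omega> + b *\<^sub>R received_noise t \<omega>) \<partial>M)
      = (\<integral>\<omega>. V (Y \<omega>) \<partial>M) + b\<^sup>2 * (\<integral>\<omega>. V (received_noise t \<omega>) \<partial>M)"
proof -
  have p: "prior t (\<lambda>\<omega>. Y \<omega> $ i - ave (Y \<omega>))" for i
    by (intro prior_diff prior_ave Y t)
  note o = prior_orthogonal[OF p t]
  have "integrable M (\<lambda>\<omega>. V (Y \<omega>))" "integrable M (\<lambda>\<omega>. V (received_noise t \<omega>))"
    by (intro integrable_V prior_square_integrable[OF Y] square_integrable_received_noise t)+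
  moreover have "V (Y \<omega> + b *\<^sub>R received_noise t \<omega>) = V (Y \<omega>)
      + 2 * b * (\<Sum>i\<in>UNIV. (Y \<omega> $ i - ave (Y \<omega>)) * received_noise t \<omega> $ i)
      + b\<^sup>2 * V (received_noise t \<omega>)" for \<omega>
    by (simp add: V_add V_scaleR sum_distrib_left mult_ac)
  ultimately show ?thesis using o by simp
qed

lemma linear_received_noise:
  "(\<Sum>i\<in>UNIV. d i * received_noise t \<omega> $ i)
    = (\<Sum>(j, i)\<in>edges (G t). (d i * weight (G t) $ i $ j) * w G t j i \<omega>)"
  by (simp add: received_noise_def input_def sum_distrib_left mult.assoc flip: sum_nbrs)

lemma noise_power_nonneg: "0 \<le> noise_power CARD('n) amax vhi"
  using vhi by (simp add: noise_power_def)

text \<open>Each edge contributes to one component only, so applying the upper variance bound to the components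
  one by one loses nothing.\<close>

lemma expectation_norm_noise_le:
  assumes t: "1 \<le> t"
  shows "(\<integral>\<omega>. (norm (received_noise t \<omega>))\<^sup>2 \<partial>M) \<le> noise_power CARD('n) amax vhi"
proof -
  let ?d = "\<lambda>k i. of_bool (i = k) :: real"
  have "(\<integral>\<omega>. (norm (received_noise t \<omega>))\<^sup>2 \<partial>M)
      = (\<Sum>k\<in>UNIV. \<integral>\<omega>. (received_noise t \<omega> $ k)\<^sup>2 \<partial>M)"
    using square_integrable_received_noise[OF t]
    by (simp add: norm_vec_def L2_set_def sum_nonneg square_integrable_def)
  also have "\<dots> \<le> (\<Sum>k\<in>UNIV. vhi * (\<Sum>(j, i)\<in>edges (G t). (?d k i * weight (G t) $ i $ j)\<^sup>2))"
  proof (rule sum_mono)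
    fix k
    have "(\<integral>\<omega>. (received_noise t \<omega> $ k)\<^sup>2 \<partial>M)
        = (\<integral>\<omega>. (\<Sum>i\<in>UNIV. ?d k i * received_noise t \<omega> $ i)\<^sup>2 \<partial>M)"
      by (simp add: of_bool_def if_distrib[of "\<lambda>x. x * _"] cong: if_cong)
    also have "\<dots> \<le> vhi * (\<Sum>(j, i)\<in>edges (G t). (?d k i * weight (G t) $ i $ j)\<^sup>2)"
      unfolding linear_received_noise by (rule noise_le[OF t])
    finally show "(\<integral>\<omega>. (received_noise t \<omega> $ k)\<^sup>2 \<partial>M) \<le> \<dots>" .
  qed
  also have "\<dots> = vhi * (\<Sum>(j, i)\<in>edges (G t). \<Sum>k\<in>UNIV. (?d k i * weight (G t) $ i $ j)\<^sup>2)"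
    by (subst sum_distrib_left[symmetric], subst sum.swap) (simp add: case_prod_unfold)
  also have "\<dots> = vhi * (\<Sum>(j, i)\<in>edges (G t). (weight (G t) $ i $ j)\<^sup>2)"
    by (simp add: power_mult_distrib of_bool_def if_distrib[of "\<lambda>x. x\<^sup>2"] if_distrib[of "\<lambda>x. x * _"]
        cong: if_cong)
  also have "\<dots> \<le> vhi * (\<Sum>(j, i)\<in>edges (G t). amax\<^sup>2)"
    using weights[OF t] vhi by (intro mult_left_mono sum_mono) (auto simp: weights_in_def intro!: power_mono)
  also have "\<dots> \<le> vhi * (\<Sum>(j, i)\<in>(UNIV :: ('n \<times> 'n) set). amax\<^sup>2)"
    using vhi by (intro mult_left_mono sum_mono2) auto
  also have "\<dots> = noise_power CARD('n) amax vhi"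
    by (simp add: noise_power_def power2_eq_square card_cartesian_product flip: UNIV_Times_UNIV)
  finally show ?thesis .
qed

lemma expectation_V_noise_le:
  assumes t: "1 \<le> t"
  shows "(\<integral>\<omega>. V (received_noise t \<omega>) \<partial>M) \<le> noise_power CARD('n) amax vhi"
proof -
  have "(\<integral>\<omega>. V (received_noise t \<omega>) \<partial>M) \<le> (\<integral>\<omega>. (norm (received_noise t \<omega>))\<^sup>2 \<partial>M)"
    by (intro integral_mono integrable_V integrable_norm_power2 square_integrable_received_noise t V_le_norm)
  with expectation_norm_noise_le[OF t] show ?thesis by linarith
qed

text \<open>It is enough to look at one agent \<open>k\<close> that receives something: its deviation from
  the average gives that edge a coefficient of at least \<open>1 - 1/n \<ge> 1/2\<close>, and the lower
  variance bound applies to the whole linear form.\<close>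

lemma expectation_V_noise_ge:
  assumes t: "1 \<le> t" and n: "2 \<le> CARD('n)" and e: "edges (G t) \<noteq> {}"
  shows "vlo / 4 \<le> (\<integral>\<omega>. V (received_noise t \<omega>) \<partial>M)"
proof -
  obtain j k where jk: "(j, k) \<in> edges (G t)" using e by auto
  let ?d = "\<lambda>i. of_bool (i = k) - 1 / real CARD('n)"
  have w: "1 \<le> weight (G t) $ k $ j" using weights[OF t] jk by (auto simp: weights_in_def)
  have half: "1 / 2 \<le> 1 - 1 / real CARD('n)" using n by (simp add: field_simps)
  have "1 / 2 * 1 \<le> (1 - 1 / real CARD('n)) * weight (G t) $ k $ j"
    using w half by (intro mult_mono) auto
  then have "(1 / 2)\<^sup>2 \<le> (?d k * weight (G t) $ k $ j)\<^sup>2"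
    by (intro power_mono) auto
  also have "\<dots> \<le> (\<Sum>(j, i)\<in>edges (G t). (?d i * weight (G t) $ i $ j)\<^sup>2)"
    using jk by (intro order_trans[OF _ member_le_sum[of "(j, k)"]]) auto
  finally have "vlo * (1 / 2)\<^sup>2 \<le> vlo * (\<Sum>(j, i)\<in>edges (G t). (?d i * weight (G t) $ i $ j)\<^sup>2)"
    using vlo by (intro mult_left_mono) auto
  also have "\<dots> \<le> (\<integral>\<omega>. (\<Sum>i\<in>UNIV. ?d i * received_noise t \<omega> $ i)\<^sup>2 \<partial>M)"
    unfolding linear_received_noise by (rule noise_ge[OF t])
  also have "\<dots> = (\<integral>\<omega>. (received_noise t \<omega> $ k - ave (received_noise t \<omega>))\<^sup>2 \<partial>M)"
    by (simp add: left_diff_distrib sum_subtractf ave_def sum_divide_distrib of_bool_def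
        if_distrib[of "\<lambda>x. x * _"] cong: if_cong)
  also have "\<dots> \<le> (\<integral>\<omega>. V (received_noise t \<omega>) \<partial>M)"
  proof (intro integral_mono integrable_V square_integrable_received_noise t)
    have "square_integrable M (\<lambda>\<omega>. received_noise t \<omega> $ k - ave (received_noise t \<omega>))"
      by (intro square_integrable_diff square_integrable_ave square_integrable_received_noise t)
    then show "integrable M (\<lambda>\<omega>. (received_noise t \<omega> $ k - ave (received_noise t \<omega>))\<^sup>2)"
      by (simp add: square_integrable_def)
    show "(received_noise t \<omega> $ k - ave (received_noise t \<omega>))\<^sup>2 \<le> V (received_noise t \<omega>)" for \<omega>
      unfolding V_def by (rule member_le_sum) auto
  qed
  finally show ?thesis by (simp add: power2_eq_square)
qed

lemma mean_disagreement_nonneg: "0 \<le> mean_disagreement t"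
  by (simp add: mean_disagreement_def V_nonneg)

lemma mean_disagreement_1: "mean_disagreement 1 = V x1"
  using prob_space by (simp add: mean_disagreement_def)

lemma EV_eq: "1 \<le> t \<Longrightarrow> EV M X t = ennreal (mean_disagreement t)"
  unfolding EV_def mean_disagreement_def
  by (intro nn_integral_eq_integral integrable_V square_integrable_state) (auto simp: V_nonneg)

lemma prior_step:
  "1 \<le> t \<Longrightarrow> prior t (\<lambda>\<omega>. (X t \<omega> + b *\<^sub>R drift (G t) (X t \<omega>)) $ i)"
  unfolding vector_add_component vector_scaleR_component real_scaleR_def
  by (intro prior_add prior_cmult prior_drift prior_state)

lemma mean_disagreement_Suc:
  assumes "1 \<le> t"
  shows "mean_disagreement (Suc t) = (\<integral>\<omega>. V (X t \<omega> + a t *\<^sub>R drift (G t) (X t \<omega>)) \<partial>M)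
      + (a t)\<^sup>2 * (\<integral>\<omega>. V (received_noise t \<omega>) \<partial>M)"
  unfolding mean_disagreement_def state_Suc[OF assms]
  by (rule expectation_V_add_noise[OF prior_step]) (use assms in auto)

lemma integrable_dissipation:
  assumes "1 \<le> t"
  shows "integrable M (\<lambda>\<omega>. dissipation g (X t \<omega>))"
proof -
  have "square_integrable M (\<lambda>\<omega>. X t \<omega> $ j - X t \<omega> $ i)" for i j
    by (intro square_integrable_diff square_integrable_state assms)
  then show ?thesis
    unfolding dissipation_def case_prod_unfold square_integrable_def by auto
qed

lemma mean_dissipation_nonneg: "1 \<le> t \<Longrightarrow> 0 \<le> mean_dissipation t"
  unfolding mean_dissipation_def by (intro integral_nonneg_AE AE_I2 dissipation_nonneg[OF weights])

lemma mean_dissipation_le: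
  assumes "1 \<le> t"
  shows "mean_dissipation t \<le> 2 * real CARD('n) * amax * mean_disagreement t"
proof -
  have "mean_dissipation t \<le> (\<integral>\<omega>. 2 * real CARD('n) * amax * V (X t \<omega>) \<partial>M)"
    unfolding mean_dissipation_def using assms amax
    by (intro integral_mono integrable_dissipation integrable_mult_right integrable_V
        square_integrable_state dissipation_le weights) auto
  then show ?thesis by (simp add: mean_disagreement_def)
qed

lemma mean_disagreement_Suc_le:
  assumes t: "1 \<le> t" and b: "balanced (G t)"
  shows "mean_disagreement (Suc t) \<le> mean_disagreement t
      - a t * (1 - a t * real CARD('n) * amax) * mean_dissipation t + (a t)\<^sup>2 * noise_power CARD('n) amax vhi"
proof -
  have "(\<integral>\<omega>. V (X t \<omega> + a t *\<^sub>R drift (G t) (X t \<omega>)) \<partial>M)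
      \<le> (\<integral>\<omega>. V (X t \<omega>) - a t * (1 - a t * real CARD('n) * amax) * dissipation (G t) (X t \<omega>) \<partial>M)"
    using amax weights[OF t]
    by (intro integral_mono Bochner_Integration.integrable_diff integrable_mult_right integrable_V
        integrable_dissipation V_consensus_step b prior_square_integrable[OF prior_step]
        square_integrable_state t) auto
  also have "\<dots> = mean_disagreement t - a t * (1 - a t * real CARD('n) * amax) * mean_dissipation t"
    using integrable_dissipation[OF t, of "G t"] integrable_V[OF square_integrable_state[OF t]]
    by (simp add: mean_disagreement_def mean_dissipation_def)
  also have "(a t)\<^sup>2 * (\<integral>\<omega>. V (received_noise t \<omega>) \<partial>M) \<le> (a t)\<^sup>2 * noise_power CARD('n) amax vhi"
    by (intro mult_left_mono expectation_V_noise_le t) auto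
  ultimately show ?thesis unfolding mean_disagreement_Suc[OF t] by linarith
qed

end

section \<open>Contraction over one block of connected topology\<close>

text \<open>The mean square length of a step is at most \<open>a(t)\<^sup>2\<close> times this, times \<open>v(t) + 1\<close>.\<close>

definition step_variance :: "nat \<Rightarrow> real \<Rightarrow> real \<Rightarrow> real" where
  "step_variance n amax vhi = 4 * (real n)\<^sup>2 * amax\<^sup>2 + 2 * noise_power n amax vhi"

lemma step_variance_nonneg: "0 \<le> vhi \<Longrightarrow> 0 \<le> step_variance n amax vhi"
  by (simp add: step_variance_def noise_power_def)

context noisy_network
begin

lemma square_integrable_increment:
  assumes "1 \<le> s" "1 \<le> t"
  shows "square_integrable M (\<lambda>\<omega>. (X s \<omega> - X t \<omega>) $ i)"
  unfolding vector_minus_component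
  by (intro square_integrable_diff square_integrable_state assms)

lemma expectation_step_le:
  assumes t: "1 \<le> t"
  shows "(\<integral>\<omega>. (norm (X (Suc t) \<omega> - X t \<omega>))\<^sup>2 \<partial>M)
      \<le> (a t)\<^sup>2 * step_variance CARD('n) amax vhi * (mean_disagreement t + 1)"
proof -
  let ?n = "real CARD('n)" and ?P = "noise_power CARD('n) amax vhi"
  have "(norm (X (Suc t) \<omega> - X t \<omega>))\<^sup>2 \<le> (a t)\<^sup>2 * (2 * (?n * amax * dissipation (G t) (X t \<omega>)
      + (norm (received_noise t \<omega>))\<^sup>2))" for \<omega>
  proof -
    let ?D = "drift (G t) (X t \<omega>)" and ?W = "received_noise t \<omega>"
    have "X (Suc t) \<omega> - X t \<omega> = a t *\<^sub>R (?D + ?W)"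
      by (simp add: state_Suc[OF t] scaleR_add_right)
    then have "(norm (X (Suc t) \<omega> - X t \<omega>))\<^sup>2 = (a t)\<^sup>2 * (norm (?D + ?W))\<^sup>2"
      by (simp add: power_mult_distrib)
    also have "(norm (?D + ?W))\<^sup>2 \<le> (norm ?D + norm ?W)\<^sup>2"
      by (intro power_mono norm_triangle_ineq) auto
    also have "\<dots> \<le> 2 * ((norm ?D)\<^sup>2 + (norm ?W)\<^sup>2)"
      using sum_squares_bound[of "norm ?D" "norm ?W"] by (simp add: power2_sum)
    also have "(norm ?D)\<^sup>2 \<le> ?n * amax * dissipation (G t) (X t \<omega>)"
      using amax by (intro norm_drift_le weights t) auto
    finally show ?thesis by (simp add: mult_left_mono)
  qed
  then have "(\<integral>\<omega>. (norm (X (Suc t) \<omega> - X t \<omega>))\<^sup>2 \<partial>M)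
      \<le> (\<integral>\<omega>. (a t)\<^sup>2 * (2 * (?n * amax * dissipation (G t) (X t \<omega>)
        + (norm (received_noise t \<omega>))\<^sup>2)) \<partial>M)"
    using t by (intro integral_mono integrable_norm_power2 square_integrable_increment
        integrable_mult_right Bochner_Integration.integrable_add integrable_dissipation
        square_integrable_received_noise) auto
  also have "\<dots> = (a t)\<^sup>2 * (2 * (?n * amax * mean_dissipation t
      + (\<integral>\<omega>. (norm (received_noise t \<omega>))\<^sup>2 \<partial>M)))"
    using integrable_dissipation[OF t, of "G t"]
      integrable_norm_power2[OF square_integrable_received_noise[OF t]]
    by (simp add: mean_dissipation_def)
  also have "\<dots> \<le> (a t)\<^sup>2 * (2 * (?n * amax * (2 * ?n * amax * mean_disagreement t) + ?P))"
    using amax by (intro mult_left_mono add_mono mean_dissipation_le expectation_norm_noise_le t) auto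
  also have "\<dots> \<le> (a t)\<^sup>2 * (step_variance CARD('n) amax vhi * (mean_disagreement t + 1))"
    using mult_nonneg_nonneg[OF noise_power_nonneg mean_disagreement_nonneg[of t]] amax
    by (intro mult_left_mono) (auto simp: step_variance_def power2_eq_square algebra_simps
        intro!: add_nonneg_nonneg)
  finally show ?thesis by (simp add: mult.assoc)
qed

text \<open>Cauchy-Schwarz in time.  It ignores the orthogonality of the noise, which is harmless since the
  factor \<open>(L A)\<^sup>2\<close> tends to \<open>0\<close> on late blocks.\<close>

lemma expectation_displacement_le:
  assumes T: "1 \<le> T" "T \<le> s"
    and A: "\<And>u. T \<le> u \<Longrightarrow> u < s \<Longrightarrow> 0 \<le> a u \<and> a u \<le> A"
    and B: "\<And>u. T \<le> u \<Longrightarrow> u < s \<Longrightarrow> mean_disagreement u \<le> B"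
  shows "(\<integral>\<omega>. (norm (X s \<omega> - X T \<omega>))\<^sup>2 \<partial>M)
      \<le> (real (s - T) * A)\<^sup>2 * step_variance CARD('n) amax vhi * (B + 1)"
proof -
  let ?S = "step_variance CARD('n) amax vhi"
  let ?d = "\<lambda>u \<omega>. norm (X (Suc u) \<omega> - X u \<omega>)"
  have int: "integrable M (\<lambda>\<omega>. (?d u \<omega>)\<^sup>2)" if "u \<in> {T..<s}" for u
    using that T by (intro integrable_norm_power2 square_integrable_increment) auto
  have "(norm (X s \<omega> - X T \<omega>))\<^sup>2 \<le> real (s - T) * (\<Sum>u\<in>{T..<s}. (?d u \<omega>)\<^sup>2)" for \<omega>
  proof -
    have "X s \<omega> - X T \<omega> = (\<Sum>u\<in>{T..<s}. X (Suc u) \<omega> - X u \<omega>)"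
      using sum_Suc_diff'[OF T(2), of "\<lambda>u. X u \<omega>"] by simp
    then have "(norm (X s \<omega> - X T \<omega>))\<^sup>2 \<le> (\<Sum>u\<in>{T..<s}. ?d u \<omega>)\<^sup>2"
      by (intro power_mono) (auto intro: norm_sum)
    also have "\<dots> \<le> real (s - T) * (\<Sum>u\<in>{T..<s}. (?d u \<omega>)\<^sup>2)"
      using power2_sum_le_card[of "\<lambda>u. ?d u \<omega>" "{T..<s}"] by simp
    finally show ?thesis .
  qed
  then have "(\<integral>\<omega>. (norm (X s \<omega> - X T \<omega>))\<^sup>2 \<partial>M)
      \<le> (\<integral>\<omega>. real (s - T) * (\<Sum>u\<in>{T..<s}. (?d u \<omega>)\<^sup>2) \<partial>M)"
    using T int by (intro integral_mono integrable_norm_power2 square_integrable_increment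
        integrable_mult_right Bochner_Integration.integrable_sum) auto
  also have "\<dots> = real (s - T) * (\<Sum>u\<in>{T..<s}. \<integral>\<omega>. (?d u \<omega>)\<^sup>2 \<partial>M)"
    using Bochner_Integration.integral_sum[of "{T..<s}" M "\<lambda>u \<omega>. (?d u \<omega>)\<^sup>2"] int by simp
  also have "\<dots> \<le> real (s - T) * (\<Sum>u\<in>{T..<s}. A\<^sup>2 * ?S * (B + 1))"
  proof (intro mult_left_mono sum_mono)
    fix u assume u: "u \<in> {T..<s}"
    have "(\<integral>\<omega>. (?d u \<omega>)\<^sup>2 \<partial>M) \<le> (a u)\<^sup>2 * ?S * (mean_disagreement u + 1)"
      using u T by (intro expectation_step_le) auto
    also have "\<dots> \<le> A\<^sup>2 * ?S * (B + 1)"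
      using A[of u] B[of u] u mean_disagreement_nonneg[of u] step_variance_nonneg[of vhi] vhi
      by (intro mult_mono power_mono) auto
    finally show "(\<integral>\<omega>. (?d u \<omega>)\<^sup>2 \<partial>M) \<le> A\<^sup>2 * ?S * (B + 1)" .
  qed simp
  also have "\<dots> = (real (s - T) * A)\<^sup>2 * ?S * (B + 1)"
    by (simp add: power2_eq_square)
  finally show ?thesis .
qed

lemma mean_disagreement_block_le:
  assumes T: "1 \<le> T" "T \<le> s"
    and A: "\<And>u. T \<le> u \<Longrightarrow> u < s \<Longrightarrow> 0 \<le> a u \<and> a u \<le> A" "A * real CARD('n) * amax \<le> 1 / 2"
    and bal: "\<And>u. T \<le> u \<Longrightarrow> balanced (G u)"
  shows "mean_disagreement s \<le> mean_disagreement T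
      - (\<Sum>u\<in>{T..<s}. a u / 2 * mean_dissipation u) + real (s - T) * A\<^sup>2 * noise_power CARD('n) amax vhi"
  using T(2) A(1)
proof (induction s rule: dec_induct)
  case (step s)
  let ?P = "noise_power CARD('n) amax vhi"
  have as: "0 \<le> a s" "a s \<le> A" using step.prems[of s] step.hyps by auto
  have "a s * real CARD('n) * amax \<le> A * real CARD('n) * amax"
    using as amax by (intro mult_right_mono) auto
  then have "1 / 2 \<le> 1 - a s * real CARD('n) * amax" using A(2) by linarith
  then have "a s * (1 / 2) \<le> a s * (1 - a s * real CARD('n) * amax)"
    using as by (intro mult_left_mono) auto
  then have "a s / 2 * mean_dissipation s \<le> a s * (1 - a s * real CARD('n) * amax) * mean_dissipation s"
    using T step.hyps by (intro mult_right_mono mean_dissipation_nonneg) auto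
  moreover have "(a s)\<^sup>2 * ?P \<le> A\<^sup>2 * ?P"
    using as by (intro mult_right_mono power_mono noise_power_nonneg) auto
  moreover have "mean_disagreement (Suc s) \<le> mean_disagreement s
      - a s * (1 - a s * real CARD('n) * amax) * mean_dissipation s + (a s)\<^sup>2 * ?P"
    using T step.hyps by (intro mean_disagreement_Suc_le bal) auto
  moreover have "mean_disagreement s \<le> mean_disagreement T
      - (\<Sum>u\<in>{T..<s}. a u / 2 * mean_dissipation u) + real (s - T) * A\<^sup>2 * ?P"
    using step.prems by (intro step.IH) auto
  ultimately show ?case
    using step.hyps by (simp add: Suc_diff_le distrib_right)
qed simp

text \<open>Every edge of the union graph is charged to a single time at which it is present.  Charging
  it once rather than at all times of the block keeps the error at a constant number of
  displacements, however long the block is.\<close>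

lemma sum_mean_dissipation_ge:
  assumes T: "1 \<le> T"
    and conn: "strongly_connected (with_proj (union_graph G {T..<T'}))"
    and Z: "\<And>s. T \<le> s \<Longrightarrow> s < T' \<Longrightarrow> (\<integral>\<omega>. (norm (X s \<omega> - X T \<omega>))\<^sup>2 \<partial>M) \<le> Z"
    and Z0: "0 \<le> Z"
  shows "mean_disagreement T / (2 * (real CARD('n))\<^sup>2) - 2 * (real CARD('n))\<^sup>2 * Z
      \<le> (\<Sum>u\<in>{T..<T'}. mean_dissipation u)"
proof -
  let ?E = "\<Union>t\<in>{T..<T'}. edges (G t)" and ?n = "real CARD('n)"
  define D where "D s e = (\<integral>\<omega>. (X s \<omega> $ fst e - X s \<omega> $ snd e)\<^sup>2 \<partial>M)" for s and e :: "'n \<times> 'n"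
  have D0: "0 \<le> D s e" for s e by (simp add: D_def)
  have int: "integrable M (\<lambda>\<omega>. (X s \<omega> $ i - X s \<omega> $ j)\<^sup>2)" if "1 \<le> s" for s i j
    using square_integrable_diff[OF square_integrable_state square_integrable_state] that
    by (simp add: square_integrable_def)
  have "\<forall>e\<in>?E. \<exists>s. s \<in> {T..<T'} \<and> e \<in> edges (G s)" by auto
  then obtain f where f: "\<And>e. e \<in> ?E \<Longrightarrow> f e \<in> {T..<T'} \<and> e \<in> edges (G (f e))"
    by (metis (no_types, lifting))
  have near: "D T e / 2 - 2 * Z \<le> D s e" if s: "s \<in> {T..<T'}" for s e
  proof -
    obtain j i where e: "e = (j, i)" by (cases e)
    have "(X T \<omega> $ j - X T \<omega> $ i)\<^sup>2 / 2 - 2 * (norm (X s \<omega> - X T \<omega>))\<^sup>2 \<le> (X s \<omega> $ j - X s \<omega> $ i)\<^sup>2" for \<omega>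
    proof (cases "j = i")
      case False
      let ?z = "X s \<omega> - X T \<omega>"
      have "(?z $ j)\<^sup>2 + (?z $ i)\<^sup>2 = (\<Sum>k\<in>{j, i}. (?z $ k)\<^sup>2)" using False by simp
      also have "\<dots> \<le> (norm ?z)\<^sup>2"
        unfolding norm_vec_def L2_set_def
        by (subst real_sqrt_pow2) (auto intro!: sum_nonneg sum_mono2 simp del: vector_minus_component)
      finally have z: "(?z $ j)\<^sup>2 + (?z $ i)\<^sup>2 \<le> (norm ?z)\<^sup>2" .
      have "p\<^sup>2 / 2 - 2 * (x\<^sup>2 + y\<^sup>2) \<le> (p + x - y)\<^sup>2" for p x y :: real
      proof -
        have "0 \<le> (p + 2 * (x - y))\<^sup>2 / 2 + (x + y)\<^sup>2" by simp
        also have "\<dots> = (p + x - y)\<^sup>2 - p\<^sup>2 / 2 + 2 * (x\<^sup>2 + y\<^sup>2)"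
          by (simp add: power2_eq_square field_simps)
        finally show ?thesis by simp
      qed
      from this[of "X T \<omega> $ j - X T \<omega> $ i" "?z $ j" "?z $ i"] z show ?thesis by simp
    qed simp
    then have "(\<integral>\<omega>. (X T \<omega> $ j - X T \<omega> $ i)\<^sup>2 / 2 - 2 * (norm (X s \<omega> - X T \<omega>))\<^sup>2 \<partial>M) \<le> D s e"
      unfolding D_def e fst_conv snd_conv using s T
      by (intro integral_mono Bochner_Integration.integrable_diff integrable_divide integrable_mult_right
          int integrable_norm_power2 square_integrable_increment) auto
    also have "(\<integral>\<omega>. (X T \<omega> $ j - X T \<omega> $ i)\<^sup>2 / 2 - 2 * (norm (X s \<omega> - X T \<omega>))\<^sup>2 \<partial>M)
        = D T e / 2 - 2 * (\<integral>\<omega>. (norm (X s \<omega> - X T \<omega>))\<^sup>2 \<partial>M)"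
      using s T int[of T j i] integrable_norm_power2[of M "\<lambda>\<omega>. X s \<omega> - X T \<omega>"]
        square_integrable_increment[of s T]
      by (simp add: D_def e)
    finally show ?thesis using Z[of s] s by auto
  qed
  have "mean_disagreement T \<le> (\<integral>\<omega>. ?n\<^sup>2 * (\<Sum>(j, i)\<in>?E. (X T \<omega> $ j - X T \<omega> $ i)\<^sup>2) \<partial>M)"
    unfolding mean_disagreement_def case_prod_unfold using T int
    by (intro integral_mono integrable_V square_integrable_state integrable_mult_right
        Bochner_Integration.integrable_sum V_le_connected[unfolded case_prod_unfold]
        union_graph_rtrancl[OF conn]) auto
  also have "\<dots> = ?n\<^sup>2 * (\<Sum>e\<in>?E. D T e)"
    using int[OF T] by (simp add: D_def case_prod_unfold)
  finally have DT: "mean_disagreement T / ?n\<^sup>2 \<le> (\<Sum>e\<in>?E. D T e)"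
    by (simp add: field_simps)
  have "real (card ?E) \<le> real (card (UNIV :: ('n \<times> 'n) set))"
    by (intro of_nat_mono card_mono) auto
  then have card: "real (card ?E) \<le> ?n\<^sup>2"
    by (simp add: power2_eq_square card_cartesian_product flip: UNIV_Times_UNIV)
  have "mean_disagreement T / (2 * ?n\<^sup>2) - 2 * ?n\<^sup>2 * Z \<le> (\<Sum>e\<in>?E. D T e) / 2 - real (card ?E) * (2 * Z)"
  proof -
    have "mean_disagreement T / (2 * ?n\<^sup>2) = mean_disagreement T / ?n\<^sup>2 / 2" by simp
    then show ?thesis using DT mult_right_mono[OF card, of "2 * Z"] Z0 by linarith
  qed
  also have "\<dots> = (\<Sum>e\<in>?E. D T e / 2 - 2 * Z)"
    by (simp add: sum_subtractf sum_divide_distrib)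
  also have "\<dots> \<le> (\<Sum>e\<in>?E. D (f e) e)"
    using f by (intro sum_mono near) auto
  also have "\<dots> \<le> (\<Sum>e\<in>?E. \<Sum>u | u \<in> {T..<T'} \<and> e \<in> edges (G u). D u e)"
    using f D0 by (intro sum_mono member_le_sum) auto
  also have "\<dots> = (\<Sum>u\<in>{T..<T'}. \<Sum>e | e \<in> ?E \<and> e \<in> edges (G u). D u e)"
    by (rule sum.swap_restrict) auto
  also have "\<dots> \<le> (\<Sum>u\<in>{T..<T'}. mean_dissipation u)"
  proof (rule sum_mono)
    fix u assume u: "u \<in> {T..<T'}"
    then have u1: "1 \<le> u" using T by simp
    have "(\<Sum>e | e \<in> ?E \<and> e \<in> edges (G u). D u e) = (\<Sum>e\<in>edges (G u). D u e)"
      using u by (intro sum.cong) auto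
    also have "\<dots> = (\<integral>\<omega>. (\<Sum>(j, i)\<in>edges (G u). (X u \<omega> $ j - X u \<omega> $ i)\<^sup>2) \<partial>M)"
      using int[OF u1] by (simp add: D_def case_prod_unfold)
    also have "\<dots> \<le> mean_dissipation u"
      unfolding mean_dissipation_def
    proof (intro integral_mono integrable_dissipation u1)
      show "integrable M (\<lambda>\<omega>. \<Sum>(j, i)\<in>edges (G u). (X u \<omega> $ j - X u \<omega> $ i)\<^sup>2)"
        using int[OF u1] by (simp add: case_prod_unfold)
      show "(\<Sum>(j, i)\<in>edges (G u). (X u \<omega> $ j - X u \<omega> $ i)\<^sup>2) \<le> dissipation (G u) (X u \<omega>)" for \<omega>
        unfolding dissipation_def
      proof (rule sum_mono, clarify)
        fix j i assume "(j, i) \<in> edges (G u)"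
        then have "1 * (X u \<omega> $ j - X u \<omega> $ i)\<^sup>2 \<le> weight (G u) $ i $ j * (X u \<omega> $ j - X u \<omega> $ i)\<^sup>2"
          using weights[OF u1] by (intro mult_right_mono) (auto simp: weights_in_def)
        then show "(X u \<omega> $ j - X u \<omega> $ i)\<^sup>2 \<le> weight (G u) $ i $ j * (X u \<omega> $ j - X u \<omega> $ i)\<^sup>2"
          by simp
      qed
    qed
    finally show "(\<Sum>e | e \<in> ?E \<and> e \<in> edges (G u). D u e) \<le> mean_dissipation u" .
  qed
  finally show ?thesis .
qed

end

text \<open>The coefficient of \<open>L A\<^sup>2\<close> in the effect of one block: the noise that enters directly, and the part
  of the displacement error that is not proportional to the disagreement.\<close>

definition block_noise :: "nat \<Rightarrow> real \<Rightarrow> real \<Rightarrow> real" where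
  "block_noise n amax vhi = (real n)\<^sup>2 * step_variance n amax vhi * (noise_power n amax vhi + 1)
     + noise_power n amax vhi"

context noisy_network
begin

text \<open>The factors \<open>1/2\<close> from \<open>1 - A n amax \<ge> 1/2\<close>, \<open>3/4\<close> from the gain, and \<open>1/2\<close> from passing to the state
  at the start of the block leave \<open>3/16 \<cdot> A / n\<^sup>2\<close> of the contraction by the union graph.  A third of
  this pays for the displacement error.\<close>

lemma block_contraction:
  assumes T: "1 \<le> T" "T < T'"
    and conn: "strongly_connected (with_proj (union_graph G {T..<T'}))"
    and bal: "\<And>u. T \<le> u \<Longrightarrow> balanced (G u)"
    and A: "\<And>u. T \<le> u \<Longrightarrow> u < T' \<Longrightarrow> 3 / 4 * A \<le> a u \<and> a u \<le> A"
    and A_small: "0 \<le> A" "A * real CARD('n) * amax \<le> 1 / 2"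
    and L_small: "real (T' - T) * A \<le> 1"
      "16 * real CARD('n) ^ 4 * step_variance CARD('n) amax vhi * (real (T' - T) * A)\<^sup>2 \<le> 1"
  shows "mean_disagreement T' \<le> (1 - A / (8 * (real CARD('n))\<^sup>2)) * mean_disagreement T
      + real (T' - T) * A\<^sup>2 * block_noise CARD('n) amax vhi"
proof -
  let ?n = "real CARD('n)" and ?P = "noise_power CARD('n) amax vhi" and ?L = "real (T' - T)"
    and ?S = "step_variance CARD('n) amax vhi" and ?v = "mean_disagreement T"
  define \<epsilon> where "\<epsilon> = ?L * A"
  have n1: "1 \<le> ?n"
    using zero_less_card_finite[where 'a='n] by linarith
  have P0: "0 \<le> ?P" by (rule noise_power_nonneg)
  have S0: "0 \<le> ?S" using vhi by (intro step_variance_nonneg) auto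
  have v0: "0 \<le> ?v" by (rule mean_disagreement_nonneg)
  have \<epsilon>: "0 \<le> \<epsilon>" "\<epsilon> \<le> 1" "16 * ?n ^ 4 * ?S * \<epsilon>\<^sup>2 \<le> 1" using A_small L_small by (auto simp: \<epsilon>_def)
  have a0: "0 \<le> a u \<and> a u \<le> A" if "T \<le> u" "u < T'" for u
    using A[OF that] A_small by auto
  have "A \<le> \<epsilon>" using T A_small mult_right_mono[of 1 ?L A] by (simp add: \<epsilon>_def)
  then have A1: "A \<le> 1" using \<epsilon> by simp
  have B: "mean_disagreement s \<le> ?v + ?P" if s: "T \<le> s" "s < T'" for s
  proof -
    have "mean_disagreement s \<le> ?v
      - (\<Sum>u\<in>{T..<s}. a u / 2 * mean_dissipation u) + real (s - T) * A\<^sup>2 * ?P"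
      using s T A_small bal a0 by (intro mean_disagreement_block_le) auto
    moreover have "0 \<le> (\<Sum>u\<in>{T..<s}. a u / 2 * mean_dissipation u)"
      using s T a0 by (intro sum_nonneg mult_nonneg_nonneg mean_dissipation_nonneg) auto
    moreover have "real (s - T) * A\<^sup>2 * ?P \<le> 1 * ?P"
    proof (intro mult_right_mono P0)
      have "real (s - T) * A\<^sup>2 \<le> ?L * A\<^sup>2" using s by (intro mult_right_mono) auto
      also have "\<dots> = \<epsilon> * A" by (simp add: \<epsilon>_def power2_eq_square)
      also have "\<dots> \<le> 1 * 1" using \<epsilon> A1 A_small by (intro mult_mono) auto
      finally show "real (s - T) * A\<^sup>2 \<le> 1" by simp
    qed
    ultimately show ?thesis by simp
  qed
  define Z where "Z = \<epsilon>\<^sup>2 * ?S * (?v + ?P + 1)"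
  have Z0: "0 \<le> Z" using \<epsilon> S0 v0 P0 by (simp add: Z_def)
  have Z: "(\<integral>\<omega>. (norm (X s \<omega> - X T \<omega>))\<^sup>2 \<partial>M) \<le> Z" if s: "T \<le> s" "s < T'" for s
  proof -
    have "(\<integral>\<omega>. (norm (X s \<omega> - X T \<omega>))\<^sup>2 \<partial>M) \<le> (real (s - T) * A)\<^sup>2 * ?S * (?v + ?P + 1)"
      using s T a0 B by (intro expectation_displacement_le) auto
    also have "\<dots> \<le> Z"
      unfolding Z_def \<epsilon>_def using s A_small S0 v0 P0
      by (intro mult_right_mono power_mono) auto
    finally show ?thesis .
  qed
  define q where "q = ?v / (2 * ?n\<^sup>2) - 2 * ?n\<^sup>2 * Z"
  have "3 / 8 * A * q \<le> 3 / 8 * A * (\<Sum>u\<in>{T..<T'}. mean_dissipation u)"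
    unfolding q_def using A_small
    by (intro mult_left_mono sum_mean_dissipation_ge T conn Z Z0) auto
  also have "\<dots> \<le> (\<Sum>u\<in>{T..<T'}. a u / 2 * mean_dissipation u)"
    unfolding sum_distrib_left using A T
    by (intro sum_mono mult_right_mono mean_dissipation_nonneg) (auto simp: field_simps)
  finally have "mean_disagreement T' \<le> ?v - 3 / 8 * A * q + ?L * A\<^sup>2 * ?P"
    using mean_disagreement_block_le[of T T' A] T A_small bal a0 by fastforce
  also have "3 / 8 * A * q = A / (8 * ?n\<^sup>2) * ?v + (A / (16 * ?n\<^sup>2) * ?v - 3 / 4 * A * ?n\<^sup>2 * Z)"
    using n1 by (simp add: q_def field_simps)
  also have "3 / 4 * A * ?n\<^sup>2 * Z \<le> A / (16 * ?n\<^sup>2) * ?v + ?L * A\<^sup>2 * (?n\<^sup>2 * ?S * (?P + 1))"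
  proof -
    have eq: "16 * ?n ^ 4 * ?S * \<epsilon>\<^sup>2 = (?n\<^sup>2 * ?S * \<epsilon>\<^sup>2) * (16 * ?n\<^sup>2)"
      by (simp add: power2_eq_square power4_eq_xxxx)
    have "?n\<^sup>2 * ?S * \<epsilon>\<^sup>2 \<le> 1 / (16 * ?n\<^sup>2)"
      using \<epsilon>(3)[unfolded eq] n1 by (subst pos_le_divide_eq) auto
    then have 1: "A * ?v * (?n\<^sup>2 * ?S * \<epsilon>\<^sup>2) \<le> A * ?v * (1 / (16 * ?n\<^sup>2))"
      using A_small v0 by (intro mult_left_mono) auto
    have "\<epsilon>\<^sup>2 \<le> \<epsilon>" using \<epsilon> by (simp add: power2_eq_square mult_left_le)
    then have 2: "A * (?n\<^sup>2 * ?S * (?P + 1)) * \<epsilon>\<^sup>2 \<le> A * (?n\<^sup>2 * ?S * (?P + 1)) * \<epsilon>"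
      using A_small S0 P0 by (intro mult_left_mono) auto
    have "3 / 4 * A * ?n\<^sup>2 * Z \<le> 1 * (A * ?n\<^sup>2 * Z)"
      using A_small Z0 unfolding mult.assoc by (intro mult_right_mono) auto
    also have "\<dots> = A * ?v * (?n\<^sup>2 * ?S * \<epsilon>\<^sup>2) + A * (?n\<^sup>2 * ?S * (?P + 1)) * \<epsilon>\<^sup>2"
      by (simp add: Z_def algebra_simps)
    also have "\<dots> \<le> A * ?v * (1 / (16 * ?n\<^sup>2)) + A * (?n\<^sup>2 * ?S * (?P + 1)) * \<epsilon>"
      using 1 2 by linarith
    also have "\<dots> = A / (16 * ?n\<^sup>2) * ?v + ?L * A\<^sup>2 * (?n\<^sup>2 * ?S * (?P + 1))"
      by (simp add: \<epsilon>_def power2_eq_square)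
    finally show ?thesis .
  qed
  finally show ?thesis
    by (simp add: block_noise_def algebra_simps)
qed

text \<open>While the gain is large a step may expand the disagreement.  This crude bound, independent of the
  topology, covers these early times.\<close>

lemma mean_disagreement_growth:
  assumes a: "\<And>t. 1 \<le> t \<Longrightarrow> 0 \<le> a t \<and> a t \<le> A"
    and bal: "\<And>t. 1 \<le> t \<Longrightarrow> balanced (G t)" and t: "1 \<le> t"
  shows "mean_disagreement t \<le> (1 + A\<^sup>2 * step_variance CARD('n) amax vhi) ^ t * (V x1 + 1)"
proof -
  let ?n = "real CARD('n)" and ?P = "noise_power CARD('n) amax vhi"
    and ?S = "step_variance CARD('n) amax vhi"
  let ?R = "1 + A\<^sup>2 * ?S"
  have S0: "0 \<le> ?S" using vhi by (intro step_variance_nonneg) auto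
  have P0: "0 \<le> ?P" by (rule noise_power_nonneg)
  have "mean_disagreement t + 1 \<le> ?R ^ t * (V x1 + 1)"
    using t
  proof (induction t rule: dec_induct)
    case base
    have "1 * (V x1 + 1) \<le> ?R * (V x1 + 1)"
      using S0 V_nonneg[of x1] by (intro mult_right_mono) auto
    then show ?case using mean_disagreement_1 by simp
  next
    case (step t)
    let ?v = "mean_disagreement t"
    have v0: "0 \<le> ?v" by (rule mean_disagreement_nonneg)
    have at: "0 \<le> a t" "a t \<le> A" using a step.hyps by auto
    have d0: "0 \<le> mean_dissipation t" by (intro mean_dissipation_nonneg step.hyps)
    have "mean_disagreement (Suc t) \<le> ?v - a t * (1 - a t * ?n * amax) * mean_dissipation t + (a t)\<^sup>2 * ?P"
      by (intro mean_disagreement_Suc_le bal step.hyps)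
    also have "\<dots> \<le> ?v + (a t)\<^sup>2 * (?n * amax * mean_dissipation t + ?P)"
      using mult_nonneg_nonneg[OF at(1) d0] by (simp add: power2_eq_square algebra_simps)
    also have "?n * amax * mean_dissipation t + ?P \<le> ?S * (?v + 1)"
    proof -
      have "?n * amax * mean_dissipation t \<le> ?n * amax * (2 * ?n * amax * ?v)"
        using amax by (intro mult_left_mono mean_dissipation_le step.hyps) auto
      also have "\<dots> + ?P \<le> ?S * (?v + 1)"
        using v0 P0 amax by (simp add: step_variance_def power2_eq_square algebra_simps)
      finally show ?thesis by simp
    qed
    also have "(a t)\<^sup>2 * (?S * (?v + 1)) \<le> A\<^sup>2 * (?S * (?v + 1))"
      using at S0 v0 by (intro mult_right_mono power_mono) auto
    finally have "mean_disagreement (Suc t) \<le> ?v + A\<^sup>2 * (?S * (?v + 1))"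
      by (simp add: mult_left_mono)
    then have "mean_disagreement (Suc t) + 1 \<le> ?R * (?v + 1)"
      by (simp add: algebra_simps)
    also have "\<dots> \<le> ?R * (?R ^ t * (V x1 + 1))"
      using S0 by (intro mult_left_mono step.IH) auto
    finally show ?case by simp
  qed
  then show ?thesis by simp
qed

end

section \<open>The decay rate under the polynomial gain\<close>

lemma powr_split:
  fixes T \<delta> :: real
  assumes "1 \<le> T"
  shows "T powr \<delta> = T * T powr (\<delta> - 1)"
  using assms powr_add[of T 1 "\<delta> - 1"] by simp

lemma gain_nonneg_le:
  fixes \<alpha> tstar \<delta> :: real
  assumes "0 \<le> \<alpha>" "0 \<le> tstar" "1 \<le> t" "\<delta> < 1 / 2"
  shows "0 \<le> \<alpha> / (real t powr (1 - \<delta>) + tstar) \<and> \<alpha> / (real t powr (1 - \<delta>) + tstar) \<le> \<alpha>"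
proof -
  have "1 \<le> real t powr (1 - \<delta>)" using assms by (intro ge_one_powr_ge_zero) auto
  then show ?thesis
    using assms mult_left_mono[of 1 "real t powr (1 - \<delta>) + tstar" \<alpha>] by (simp add: divide_le_eq)
qed

lemma gain_le:
  fixes \<alpha> tstar \<delta> :: real
  assumes "0 \<le> \<alpha>" "0 \<le> tstar" "1 \<le> T" "T \<le> t" "\<delta> < 1 / 2"
  shows "\<alpha> / (real t powr (1 - \<delta>) + tstar) \<le> \<alpha> * real T powr (\<delta> - 1)"
proof -
  have "real T powr (1 - \<delta>) \<le> real t powr (1 - \<delta>) + tstar"
    using assms powr_mono2[of "1 - \<delta>" "real T" "real t"] by simp
  then have "\<alpha> / (real t powr (1 - \<delta>) + tstar) \<le> \<alpha> / real T powr (1 - \<delta>)"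
    using assms by (intro divide_left_mono mult_pos_pos) (auto intro: add_pos_nonneg)
  also have "\<dots> = \<alpha> * real T powr (\<delta> - 1)"
    using powr_minus_divide[of "real T" "1 - \<delta>"] by simp
  finally show ?thesis .
qed

text \<open>The times of a block that starts at \<open>T\<close> are at most \<open>T (1 + c T\<^sup>\<delta>\<^sup>-\<^sup>1)\<close>.  As the relative length
  tends to \<open>0\<close>, the gain is almost constant on late blocks.\<close>

lemma gain_ge:
  fixes \<alpha> tstar \<delta> c :: real
  assumes "0 \<le> \<alpha>" "0 \<le> tstar" "0 \<le> c" "1 \<le> T" "0 \<le> \<delta>" "\<delta> < 1 / 2"
    and t: "1 \<le> t" "real t \<le> real T + c * real T powr \<delta>"
    and late: "(c + tstar) * real T powr (\<delta> - 1) \<le> 1 / 3"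
  shows "3 / 4 * (\<alpha> * real T powr (\<delta> - 1)) \<le> \<alpha> / (real t powr (1 - \<delta>) + tstar)"
proof -
  define h where "h = real T powr (\<delta> - 1)"
  define H where "H = real T powr (1 - \<delta>)"
  have hH: "h * H = 1" using assms powr_add[of "real T" "\<delta> - 1" "1 - \<delta>"] by (simp add: h_def H_def)
  have h0: "0 < h" and H0: "0 < H" using assms by (auto simp: h_def H_def)
  have "real t \<le> real T * (1 + c * h)"
    using t powr_split[of "real T" \<delta>] assms by (simp add: h_def algebra_simps)
  then have "real t powr (1 - \<delta>) \<le> (real T * (1 + c * h)) powr (1 - \<delta>)"
    using assms by (intro powr_mono2) auto
  also have "\<dots> = H * (1 + c * h) powr (1 - \<delta>)"
    using assms h0 by (simp add: powr_mult H_def)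
  also have "\<dots> \<le> H * (1 + c * h) powr 1"
    using assms h0 H0 by (intro mult_left_mono powr_mono) auto
  also have "\<dots> = H + c" using h0 assms hH by (simp add: algebra_simps)
  finally have "real t powr (1 - \<delta>) + tstar \<le> H + (c + tstar) * (h * H)" unfolding hH by simp
  also have "\<dots> \<le> H + 1 / 3 * H"
    using late H0 unfolding h_def[symmetric] mult.assoc[symmetric]
    by (intro add_left_mono mult_right_mono) auto
  finally have "real t powr (1 - \<delta>) + tstar \<le> 4 / 3 * H" by simp
  moreover have pos: "0 < real t powr (1 - \<delta>) + tstar" using t assms by (intro add_pos_nonneg) auto
  ultimately have "(3 / 4 * (\<alpha> * h)) * (real t powr (1 - \<delta>) + tstar) \<le> (3 / 4 * (\<alpha> * h)) * (4 / 3 * H)"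
    using assms h0 by (intro mult_left_mono) auto
  also have "\<dots> = \<alpha> * (h * H)" by simp
  also have "\<dots> = \<alpha>" unfolding hH by simp
  finally show ?thesis using pos unfolding h_def by (simp add: pos_le_divide_eq)
qed

lemma powr_block_end_ge:
  fixes T T' c p \<delta> :: real
  assumes "1 \<le> T" "0 \<le> c" "0 < T'" "T' \<le> T + c * T powr \<delta>" "0 \<le> p" "p \<le> 1"
  shows "T powr (- p) * (1 - c * T powr (\<delta> - 1)) \<le> T' powr (- p)"
proof -
  define y where "y = c * T powr (\<delta> - 1)"
  have y: "0 \<le> y" using assms by (simp add: y_def)
  have "(1 - y) * (1 + y) \<le> 1" by (simp add: algebra_simps)
  then have "1 - y \<le> (1 + y) powr (- 1)" using y by (simp add: powr_minus_divide pos_le_divide_eq)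
  also have "\<dots> \<le> (1 + y) powr (- p)" using y assms by (intro powr_mono) auto
  finally have "T powr (- p) * (1 - y) \<le> T powr (- p) * (1 + y) powr (- p)"
    by (intro mult_left_mono) auto
  also have "\<dots> = (T * (1 + y)) powr (- p)"
    using assms y by (simp add: powr_mult)
  also have "\<dots> \<le> T' powr (- p)"
    using assms y powr_split[of T \<delta>] by (intro powr_mono2') (auto simp: y_def algebra_simps)
  finally show ?thesis by (simp add: y_def)
qed

lemma block_containing:
  fixes \<tau> :: "nat \<Rightarrow> nat"
  assumes "\<tau> 1 = 1" "strict_mono_on {1..} \<tau>" "1 \<le> t"
  shows "\<exists>k\<ge>1. \<tau> k \<le> t \<and> t < \<tau> (Suc k)"
  using assms(3)
proof (induction t rule: dec_induct)
  case base
  show ?case using assms(1) strict_mono_onD[OF assms(2), of 1 "Suc 1"] by (intro exI[of _ 1]) auto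
next
  case (step t)
  then obtain k where k: "k \<ge> 1" "\<tau> k \<le> t" "t < \<tau> (Suc k)" by blast
  show ?case
  proof (cases "Suc t < \<tau> (Suc k)")
    case True
    then show ?thesis using k by (intro exI[of _ k]) auto
  next
    case False
    then show ?thesis using k strict_mono_onD[OF assms(2), of "Suc k" "Suc (Suc k)"]
      by (intro exI[of _ "Suc k"]) auto
  qed
qed

context noisy_network
begin

text \<open>Per block, the bound \<open>K T\<^sup>-\<^sup>p\<close> shrinks by at most the relative amount
  \<open>c T\<^sup>\<delta>\<^sup>-\<^sup>1\<close> and the condition on \<open>\<alpha>\<close> makes the contraction twice as large.  The noise of the block
  has the order of the surplus, \<open>T\<^sup>\<delta> \<cdot> (T\<^sup>\<delta>\<^sup>-\<^sup>1)\<^sup>2 = T\<^sup>-\<^sup>p \<cdot> T\<^sup>\<delta>\<^sup>-\<^sup>1\<close>.\<close>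

lemma rate_step:
  fixes \<alpha> tstar \<delta> c K :: real and T T' :: nat
  defines "h \<equiv> real T powr (\<delta> - 1)" and "p \<equiv> 1 - 2 * \<delta>"
  assumes a: "a = (\<lambda>t. \<alpha> / (real t powr (1 - \<delta>) + tstar))"
    and \<delta>: "0 \<le> \<delta>" "\<delta> < 1 / 2" and c: "1 \<le> c" and tstar: "0 \<le> tstar"
    and \<alpha>: "16 * (real CARD('n))\<^sup>2 * c \<le> \<alpha>"
    and T: "1 \<le> T" "T < T'" "real T' \<le> real T + c * real T powr \<delta>"
    and conn: "strongly_connected (with_proj (union_graph G {T..<T'}))"
    and bal: "\<And>t. 1 \<le> t \<Longrightarrow> balanced (G t)"
    and late: "(c + tstar) * h \<le> 1 / 3" "\<alpha> * h * real CARD('n) * amax \<le> 1 / 2"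
      "c * \<alpha> * real T powr (- p) \<le> 1"
      "16 * real CARD('n) ^ 4 * step_variance CARD('n) amax vhi * (c * \<alpha> * real T powr (- p))\<^sup>2 \<le> 1"
    and K: "\<alpha>\<^sup>2 * block_noise CARD('n) amax vhi \<le> K"
    and v: "mean_disagreement T \<le> K * real T powr (- p)"
  shows "mean_disagreement T' \<le> K * real T' powr (- p)"
    and "T \<le> t \<Longrightarrow> t < T' \<Longrightarrow> mean_disagreement t \<le> (K + c * K) * real T powr (- p)"
proof -
  let ?n = "real CARD('n)" and ?P = "noise_power CARD('n) amax vhi" and ?L = "real (T' - T)"
    and ?S = "step_variance CARD('n) amax vhi" and ?v = "mean_disagreement T"
    and ?C = "block_noise CARD('n) amax vhi" and ?Tp = "real T powr (- p)"
  define A where "A = \<alpha> * h"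
  have n1: "1 \<le> ?n"
    using zero_less_card_finite[where 'a='n] by linarith
  have h: "0 < h" "h \<le> 1" using T \<delta> powr_mono[of "\<delta> - 1" 0 "real T"] by (auto simp: h_def)
  have \<alpha>0: "0 < \<alpha>"
    using \<alpha> c n1 by (smt (verit) mult_pos_pos zero_less_power)
  have A0: "0 \<le> A" using \<alpha>0 h by (simp add: A_def)
  have P0: "0 \<le> ?P" by (rule noise_power_nonneg)
  have S0: "0 \<le> ?S" using vhi by (intro step_variance_nonneg) auto
  have PC: "?P \<le> ?C" using S0 P0 by (simp add: block_noise_def)
  have C0: "0 \<le> ?C" using P0 PC by linarith
  have K0: "0 \<le> K" using K C0 by (smt (verit) mult_nonneg_nonneg zero_le_power2)
  have Th: "real T powr \<delta> * h = ?Tp"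
    by (simp add: h_def p_def flip: powr_add)
  have L: "?L \<le> c * real T powr \<delta>" using T by (simp add: of_nat_diff)
  have LA: "?L * A \<le> c * \<alpha> * ?Tp"
  proof -
    have "?L * A \<le> c * real T powr \<delta> * A" using L A0 by (rule mult_right_mono)
    also have "\<dots> = c * \<alpha> * (real T powr \<delta> * h)" by (simp add: A_def)
    finally show ?thesis by (simp add: Th)
  qed
  have LA2: "?L * A\<^sup>2 \<le> c * \<alpha>\<^sup>2 * (?Tp * h)"
    using mult_right_mono[OF LA A0] by (simp add: A_def power2_eq_square mult_ac)
  have Arange: "3 / 4 * A \<le> a u \<and> a u \<le> A" if "T \<le> u" "u < T'" for u
  proof
    have "real u \<le> real T + c * real T powr \<delta>" using that T(3) by linarith
    then show "3 / 4 * A \<le> a u"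
      unfolding a A_def h_def using \<alpha>0 tstar T that \<delta> c late(1) by (intro gain_ge) (auto simp: h_def)
    show "a u \<le> A"
      unfolding a A_def h_def using \<alpha>0 tstar T that \<delta> by (intro gain_le) auto
  qed
  have A_small: "A * ?n * amax \<le> 1 / 2" using late(2) by (simp add: A_def)
  have "16 * ?n ^ 4 * ?S * (?L * A)\<^sup>2 \<le> 16 * ?n ^ 4 * ?S * (c * \<alpha> * ?Tp)\<^sup>2"
    using S0 A0 LA by (intro mult_left_mono power_mono) auto
  then have L_small: "16 * ?n ^ 4 * ?S * (?L * A)\<^sup>2 \<le> 1" using late(4) by linarith
  have "16 * ?n\<^sup>2 * c * h \<le> \<alpha> * h" using \<alpha> h by (intro mult_right_mono) auto
  then have contr: "2 * c * h \<le> A / (8 * ?n\<^sup>2)"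
    using n1 by (simp add: A_def field_simps)
  have "c * h \<le> (c + tstar) * h" using tstar h by (intro mult_right_mono) auto
  then have ch: "2 * c * h \<le> 1" using late(1) by linarith
  have "mean_disagreement T' \<le> (1 - A / (8 * ?n\<^sup>2)) * ?v + ?L * A\<^sup>2 * ?C"
    using T conn bal Arange A0 A_small L_small LA late(3) by (intro block_contraction) auto
  also have "(1 - A / (8 * ?n\<^sup>2)) * ?v \<le> (1 - 2 * c * h) * ?v"
    using contr mean_disagreement_nonneg by (intro mult_right_mono) auto
  also have "\<dots> \<le> (1 - 2 * c * h) * (K * ?Tp)"
    using ch v by (intro mult_left_mono) auto
  also have "?L * A\<^sup>2 * ?C \<le> c * \<alpha>\<^sup>2 * (?Tp * h) * ?C"
    using LA2 C0 by (intro mult_right_mono) auto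
  also have "c * \<alpha>\<^sup>2 * (?Tp * h) * ?C = c * (?Tp * h) * (\<alpha>\<^sup>2 * ?C)" by simp
  also have "\<dots> \<le> c * (?Tp * h) * K"
    using c h K by (intro mult_left_mono) auto
  finally have "mean_disagreement T' \<le> K * (?Tp * (1 - c * h))"
    by (simp add: algebra_simps)
  also have "\<dots> \<le> K * real T' powr (- p)"
    unfolding h_def using T c \<delta> K0 by (intro mult_left_mono powr_block_end_ge) (auto simp: p_def)
  finally show "mean_disagreement T' \<le> K * real T' powr (- p)" .
  show "mean_disagreement t \<le> (K + c * K) * ?Tp" if t: "T \<le> t" "t < T'"
  proof -
    have range0: "0 \<le> a u \<and> a u \<le> A" if "T \<le> u" "u < t" for u
      using Arange[of u] that t A0 by auto
    have "mean_disagreement t \<le> ?v - (\<Sum>u\<in>{T..<t}. a u / 2 * mean_dissipation u)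
        + real (t - T) * A\<^sup>2 * ?P"
      using t T bal range0 A_small by (intro mean_disagreement_block_le) auto
    moreover have "0 \<le> (\<Sum>u\<in>{T..<t}. a u / 2 * mean_dissipation u)"
      using T range0 by (intro sum_nonneg mult_nonneg_nonneg mean_dissipation_nonneg) auto
    moreover have "real (t - T) * A\<^sup>2 * ?P \<le> c * K * ?Tp"
    proof -
      have "real (t - T) * A\<^sup>2 * ?P \<le> ?L * A\<^sup>2 * ?C"
        using t P0 PC by (intro mult_mono) auto
      also have "\<dots> \<le> c * \<alpha>\<^sup>2 * (?Tp * h) * ?C"
        using LA2 C0 by (intro mult_right_mono) auto
      also have "\<dots> = c * (?Tp * h) * (\<alpha>\<^sup>2 * ?C)" by simp
      also have "\<dots> \<le> c * (?Tp * 1) * K"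
        using c h K C0 by (intro mult_mono) auto
      finally show ?thesis by (simp add: mult_ac)
    qed
    ultimately show ?thesis using v by (simp add: distrib_right)
  qed
qed

end

text \<open>The constant must not depend on the topology, as the optimal rate takes a supremum over topologies.
  Blocks that start before the fixed time \<open>T0\<close> end before a fixed time \<open>T1\<close>, where the crude growth bound
  is available.\<close>

theorem disagreement_rate:
  fixes M :: "'w measure" and w :: "(('n::finite), 'w) noise" and x1 :: "real ^ 'n"
    and \<delta> c \<alpha> tstar amax vlo vhi :: real
  defines "gain \<equiv> \<lambda>t. \<alpha> / (real t powr (1 - \<delta>) + tstar)"
  assumes \<delta>: "0 \<le> \<delta>" "\<delta> < 1 / 2" and c: "1 \<le> c" and tstar: "0 \<le> tstar"
    and \<alpha>: "16 * (real CARD('n))\<^sup>2 * c \<le> \<alpha>" and vhi: "0 < vhi"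
  shows "\<exists>K>0. \<forall>G t. noisy_network M w G amax vlo vhi \<longrightarrow> (\<forall>t\<ge>1. balanced (G t)) \<longrightarrow>
    ext_joint_connected \<delta> c G \<longrightarrow> 1 \<le> t \<longrightarrow>
    noisy_network.mean_disagreement M w G gain x1 t \<le> K * real t powr (- (1 - 2 * \<delta>))"
proof -
  let ?n = "real CARD('n)" and ?S = "step_variance CARD('n) amax vhi"
    and ?C = "block_noise CARD('n) amax vhi"
  let ?p = "1 - 2 * \<delta>"
  have p: "0 < ?p" "?p \<le> 1" using \<delta> by auto
  have n1: "1 \<le> ?n"
    using zero_less_card_finite[where 'a='n] by linarith
  have \<alpha>0: "0 < \<alpha>"
    using \<alpha> c n1 by (smt (verit) mult_pos_pos zero_less_power)
  have lim1: "((\<lambda>T. real T powr (\<delta> - 1)) \<longlongrightarrow> 0) sequentially"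
    using \<delta> by (intro tendsto_neg_powr filterlim_real_sequentially) auto
  have lim2: "((\<lambda>T. real T powr (- ?p)) \<longlongrightarrow> 0) sequentially"
    using p by (intro tendsto_neg_powr filterlim_real_sequentially) auto
  have "eventually (\<lambda>T. (c + tstar) * real T powr (\<delta> - 1) < 1 / 3) sequentially"
    using tendsto_mult_left[OF lim1, of "c + tstar"] by (intro order_tendstoD(2)[where y = 0]) auto
  moreover have "eventually (\<lambda>T. \<alpha> * real T powr (\<delta> - 1) * ?n * amax < 1 / 2) sequentially"
    using tendsto_mult_right[OF tendsto_mult_left[OF lim1, of \<alpha>], of "?n * amax"]
    by (intro order_tendstoD(2)[where y = 0]) (auto simp: mult.assoc)
  moreover have "eventually (\<lambda>T. c * \<alpha> * real T powr (- ?p) < 1) sequentially"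
    using tendsto_mult_left[OF lim2, of "c * \<alpha>"] by (intro order_tendstoD(2)[where y = 0]) auto
  moreover have "eventually (\<lambda>T. 16 * ?n ^ 4 * ?S * (c * \<alpha> * real T powr (- ?p))\<^sup>2 < 1) sequentially"
    using tendsto_mult_left[OF tendsto_power[OF tendsto_mult_left[OF lim2, of "c * \<alpha>"], of 2], of "16 * ?n ^ 4 * ?S"]
    by (intro order_tendstoD(2)[where y = 0]) auto
  ultimately have "eventually (\<lambda>T. (c + tstar) * real T powr (\<delta> - 1) \<le> 1 / 3 \<and>
      \<alpha> * real T powr (\<delta> - 1) * ?n * amax \<le> 1 / 2 \<and> c * \<alpha> * real T powr (- ?p) \<le> 1 \<and>
      16 * ?n ^ 4 * ?S * (c * \<alpha> * real T powr (- ?p))\<^sup>2 \<le> 1) sequentially"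
    by eventually_elim simp
  then obtain T0 where late': "\<forall>T\<ge>T0. (c + tstar) * real T powr (\<delta> - 1) \<le> 1 / 3 \<and>
      \<alpha> * real T powr (\<delta> - 1) * ?n * amax \<le> 1 / 2 \<and> c * \<alpha> * real T powr (- ?p) \<le> 1 \<and>
      16 * ?n ^ 4 * ?S * (c * \<alpha> * real T powr (- ?p))\<^sup>2 \<le> 1"
    unfolding eventually_sequentially by blast
  have late: "(c + tstar) * real T powr (\<delta> - 1) \<le> 1 / 3"
      "\<alpha> * real T powr (\<delta> - 1) * ?n * amax \<le> 1 / 2" "c * \<alpha> * real T powr (- ?p) \<le> 1"
      "16 * ?n ^ 4 * ?S * (c * \<alpha> * real T powr (- ?p))\<^sup>2 \<le> 1" if "\<not> T < T0" for T
    using late' that by auto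
  \<comment> \<open>the successor makes \<open>1 \<le> T1\<close>, so that the first block is covered even if \<open>T0 = 0\<close>\<close>
  define T1 where "T1 = Suc (nat \<lceil>real T0 + c * real T0 powr \<delta>\<rceil>)"
  define R where "R = 1 + \<alpha>\<^sup>2 * ?S"
  define B where "B = R ^ T1 * (V x1 + 1)"
  define K where "K = max (\<alpha>\<^sup>2 * ?C) (B * real T1) + 1"
  have S0: "0 \<le> ?S" using vhi by (intro step_variance_nonneg) auto
  have R1: "1 \<le> R" using S0 by (simp add: R_def)
  have B0: "0 \<le> B" using R1 V_nonneg[of x1] by (simp add: B_def)
  have K: "\<alpha>\<^sup>2 * ?C \<le> K" "B * real T1 \<le> K" by (auto simp: K_def)
  have K0: "0 < K" using B0 by (simp add: K_def max_def) (smt (verit) mult_nonneg_nonneg of_nat_0_le_iff)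
  show ?thesis
  proof (intro exI[of _ "(K + c * K) * (1 + c)"] conjI allI impI)
    show "0 < (K + c * K) * (1 + c)" using K0 c by (intro mult_pos_pos add_pos_pos) auto
    fix G :: "'n topology" and t :: nat
    assume net: "noisy_network M w G amax vlo vhi" and bal': "\<forall>t\<ge>1. balanced (G t)"
      and ext: "ext_joint_connected \<delta> c G" and t: "1 \<le> t"
    interpret noisy_network M w G gain x1 amax vlo vhi by (rule net)
    have a_eq: "gain = (\<lambda>t. \<alpha> / (real t powr (1 - \<delta>) + tstar))" by (simp add: gain_def)
    have bal: "balanced (G t)" if "1 \<le> t" for t using bal' that by simp
    obtain \<tau> :: "nat \<Rightarrow> nat" where \<tau>: "\<tau> 1 = 1" "strict_mono_on {1..} \<tau>"
      "\<And>k. 1 < k \<Longrightarrow> real (\<tau> k) \<le> real (\<tau> (k - 1)) + c * real (\<tau> (k - 1)) powr \<delta> \<and>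
         strongly_connected (with_proj (union_graph G {\<tau> (k - 1)..<\<tau> k}))"
      using ext unfolding ext_joint_connected_def by blast
    have \<tau>_Suc: "real (\<tau> (Suc k)) \<le> real (\<tau> k) + c * real (\<tau> k) powr \<delta>"
      "strongly_connected (with_proj (union_graph G {\<tau> k..<\<tau> (Suc k)}))"
      "\<tau> k < \<tau> (Suc k)" if "1 \<le> k" for k
      using \<tau>(3)[of "Suc k"] strict_mono_onD[OF \<tau>(2), of k "Suc k"] that by auto
    have \<tau>1: "1 \<le> \<tau> k" if "1 \<le> k" for k
      using that
    proof (induction k rule: dec_induct)
      case (step k)
      then show ?case using \<tau>_Suc(3)[of k] by simp
    qed (use \<tau> in simp)
    have early: "mean_disagreement s \<le> K * real s powr (- ?p)" if s: "1 \<le> s" "s \<le> T1" for s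
    proof -
      have "mean_disagreement s \<le> R ^ s * (V x1 + 1)"
        unfolding R_def using \<alpha>0 tstar \<delta> gain_nonneg_le bal s
        by (intro mean_disagreement_growth) (auto simp: gain_def)
      also have "\<dots> \<le> B"
        unfolding B_def using R1 s V_nonneg[of x1] by (intro mult_right_mono power_increasing) auto
      also have "\<dots> = B * (real s powr ?p * real s powr (- ?p))"
        using s by (simp flip: powr_add)
      also have "\<dots> \<le> B * (real T1 * real s powr (- ?p))"
      proof (intro mult_left_mono mult_right_mono B0)
        have "real s powr ?p \<le> real s powr 1" using s p by (intro powr_mono) auto
        then show "real s powr ?p \<le> real T1" using s by simp
      qed auto
      also have "\<dots> \<le> K * real s powr (- ?p)"
        using mult_right_mono[OF K(2), of "real s powr (- ?p)"] by (simp add: mult.assoc)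
      finally show ?thesis .
    qed
    have first: "\<tau> (Suc k) \<le> T1" if k: "1 \<le> k" "\<tau> k < T0" for k
    proof -
      have "real (\<tau> (Suc k)) \<le> real T0 + c * real T0 powr \<delta>"
      proof -
        have "c * real (\<tau> k) powr \<delta> \<le> c * real T0 powr \<delta>"
          using k c \<delta> by (intro mult_left_mono powr_mono2) auto
        then show ?thesis using \<tau>_Suc(1)[OF k(1)] k(2) by linarith
      qed
      then show ?thesis unfolding T1_def by linarith
    qed
    have block: "mean_disagreement (\<tau> k) \<le> K * real (\<tau> k) powr (- ?p)" if "1 \<le> k" for k
      using that
    proof (induction k rule: dec_induct)
      case base
      show ?case using early[of 1] \<tau>(1) by (simp add: T1_def)
    next
      case (step k)
      show ?case
      proof (cases "\<tau> k < T0")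
        case True
        then show ?thesis using first[of k] early[of "\<tau> (Suc k)"] \<tau>1[of "Suc k"] step.hyps by auto
      next
        case False
        note k = step.hyps(1)
        show ?thesis
          by (rule rate_step(1)[OF a_eq \<delta> c tstar \<alpha> \<tau>1[OF k] \<tau>_Suc(3,1,2)[OF k] bal late[OF False]
                K(1) step.IH])
      qed
    qed
    obtain k where k: "1 \<le> k" "\<tau> k \<le> t" "t < \<tau> (Suc k)"
      using block_containing[OF \<tau>(1,2) t] by blast
    show "mean_disagreement t \<le> (K + c * K) * (1 + c) * real t powr (- (1 - 2 * \<delta>))"
    proof (cases "\<tau> k < T0")
      case True
      then have "mean_disagreement t \<le> K * real t powr (- ?p)"
        using first[of k] k t by (intro early) auto
      also have "\<dots> \<le> (K + c * K) * (1 + c) * real t powr (- ?p)"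
        using K0 c mult_mono[of K "K + c * K" 1 "1 + c"] by (intro mult_right_mono) auto
      finally show ?thesis by simp
    next
      case False
      have "mean_disagreement t \<le> (K + c * K) * real (\<tau> k) powr (- ?p)"
        by (rule rate_step(2)[OF a_eq \<delta> c tstar \<alpha> \<tau>1[OF k(1)] \<tau>_Suc(3,1,2)[OF k(1)] bal late[OF False]
              K(1) block[OF k(1)] k(2,3)])
      also have "\<dots> \<le> (K + c * K) * ((1 + c) * real t powr (- ?p))"
      proof (rule mult_left_mono)
        have \<tau>k: "1 \<le> real (\<tau> k)" using \<tau>1[OF k(1)] by simp
        have "real t \<le> real (\<tau> k) + c * real (\<tau> k) powr \<delta>" using \<tau>_Suc(1)[OF k(1)] k(3) by linarith
        also have "\<dots> \<le> real (\<tau> k) + c * real (\<tau> k) powr 1"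
          using \<tau>k c \<delta> by (intro add_left_mono mult_left_mono powr_mono) auto
        finally have tk: "real t \<le> (1 + c) * real (\<tau> k)" using \<tau>k by (simp add: algebra_simps)
        have "(1 + c) powr ?p * ((1 + c) * real (\<tau> k)) powr (- ?p)
            = ((1 + c) powr ?p * (1 + c) powr (- ?p)) * real (\<tau> k) powr (- ?p)"
          using \<tau>k c by (subst powr_mult) auto
        also have "(1 + c) powr ?p * (1 + c) powr (- ?p) = 1"
          using c by (simp flip: powr_add)
        finally have "real (\<tau> k) powr (- ?p) = (1 + c) powr ?p * ((1 + c) * real (\<tau> k)) powr (- ?p)"
          by simp
        also have "\<dots> \<le> (1 + c) powr 1 * real t powr (- ?p)"
          using tk p c t by (intro mult_mono powr_mono powr_mono2') auto
        finally show "real (\<tau> k) powr (- ?p) \<le> (1 + c) * real t powr (- ?p)" using c by simp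
      qed (use K0 c in auto)
      finally show ?thesis by (simp add: mult.assoc)
    qed
  qed
qed

section \<open>Convergence of the average\<close>

lemma (in prob_space) square_integrable_integrable:
  "square_integrable M f \<Longrightarrow> integrable M f"
  using square_integrable_mult[of M f "\<lambda>_. 1"] square_integrable_const[of 1] by simp

lemma (in prob_space) expectation_abs_le:
  assumes f: "square_integrable M f" and e: "0 < e"
  shows "(\<integral>\<omega>. \<bar>f \<omega>\<bar> \<partial>M) \<le> (e + (\<integral>\<omega>. (f \<omega>)\<^sup>2 \<partial>M) / e) / 2"
proof -
  have "\<bar>f \<omega>\<bar> \<le> (e + (f \<omega>)\<^sup>2 / e) / 2" for \<omega>
    using e sum_squares_bound[of e "\<bar>f \<omega>\<bar>"] by (simp add: field_simps power2_eq_square)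
  then have "(\<integral>\<omega>. \<bar>f \<omega>\<bar> \<partial>M) \<le> (\<integral>\<omega>. (e + (f \<omega>)\<^sup>2 / e) / 2 \<partial>M)"
    using f square_integrable_integrable[OF f] by (intro integral_mono) (auto simp: square_integrable_def)
  also have "\<dots> = (e + (\<integral>\<omega>. (f \<omega>)\<^sup>2 \<partial>M) / e) / 2"
    using f prob_space by (simp add: square_integrable_def)
  finally show ?thesis .
qed

text \<open>Over a probability space an \<open>L\<^sup>2\<close> Cauchy sequence is \<open>L\<^sup>1\<close> Cauchy, so a subsequence converges almost
  surely; Fatou's lemma shows that its limit is the limit in \<open>L\<^sup>2\<close>.\<close>

lemma (in prob_space) L2_Cauchy_limit:
  fixes A :: "nat \<Rightarrow> 'a \<Rightarrow> real"
  assumes A: "\<And>n. square_integrable M (A n)"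
    and Cauchy: "\<And>e. 0 < e \<Longrightarrow> \<exists>N. \<forall>m\<ge>N. \<forall>n\<ge>N. (\<integral>\<omega>. (A m \<omega> - A n \<omega>)\<^sup>2 \<partial>M) < e"
  obtains L where "square_integrable M L" "(\<lambda>n. \<integral>\<omega>. (A n \<omega> - L \<omega>)\<^sup>2 \<partial>M) \<longlonglongrightarrow> 0"
proof -
  have AA: "square_integrable M (\<lambda>\<omega>. A m \<omega> - A n \<omega>)" for m n
    by (intro square_integrable_diff A)
  have "\<exists>N. \<forall>m\<ge>N. \<forall>n\<ge>N. (\<integral>\<omega>. norm (A m \<omega> - A n \<omega>) \<partial>M) < e" if e: "0 < e" for e :: real
  proof -
    obtain N where N: "\<And>m n. N \<le> m \<Longrightarrow> N \<le> n \<Longrightarrow> (\<integral>\<omega>. (A m \<omega> - A n \<omega>)\<^sup>2 \<partial>M) < e * e"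
      using Cauchy[of "e * e"] e by (auto simp del: integral_mult_left_zero)
    have "(\<integral>\<omega>. norm (A m \<omega> - A n \<omega>) \<partial>M) < e" if "N \<le> m" "N \<le> n" for m n
    proof -
      have "(\<integral>\<omega>. (A m \<omega> - A n \<omega>)\<^sup>2 \<partial>M) / e < e"
        using N[OF that] e by (simp add: divide_less_eq)
      then show ?thesis using expectation_abs_le[OF AA e, of m n] by simp
    qed
    then show ?thesis by blast
  qed
  with square_integrable_integrable[OF A] obtain r where r: "strict_mono r" "AE \<omega> in M. Cauchy (\<lambda>i. A (r i) \<omega>)"
    using cauchy_L1_AE_cauchy_subseq[of M A] by blast
  define L where "L \<omega> = lim (\<lambda>i. A (r i) \<omega>)" for \<omega>
  have [measurable]: "A n \<in> borel_measurable M" for n using A by (simp add: square_integrable_def)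
  have [measurable]: "L \<in> borel_measurable M"
    unfolding L_def by (rule borel_measurable_lim_metric) simp
  have conv: "AE \<omega> in M. (\<lambda>i. A (r i) \<omega>) \<longlonglongrightarrow> L \<omega>"
    using r(2) unfolding L_def by (rule AE_mp) (auto simp: Cauchy_convergent_iff convergent_LIMSEQ_iff)
  \<comment> \<open>Fatou's lemma along the almost surely convergent subsequence\<close>
  have fatou: "\<exists>N. \<forall>n\<ge>N. (\<integral>\<^sup>+\<omega>. ennreal ((A n \<omega> - L \<omega>)\<^sup>2) \<partial>M) \<le> ennreal e" if e: "0 < e" for e
  proof -
    obtain N where N: "\<And>m n. N \<le> m \<Longrightarrow> N \<le> n \<Longrightarrow> (\<integral>\<omega>. (A m \<omega> - A n \<omega>)\<^sup>2 \<partial>M) < e"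
      using Cauchy[OF e] by blast
    have "(\<integral>\<^sup>+\<omega>. ennreal ((A n \<omega> - L \<omega>)\<^sup>2) \<partial>M) \<le> ennreal e" if n: "N \<le> n" for n
    proof -
      have "(\<integral>\<^sup>+\<omega>. ennreal ((A n \<omega> - L \<omega>)\<^sup>2) \<partial>M)
          = (\<integral>\<^sup>+\<omega>. liminf (\<lambda>i. ennreal ((A n \<omega> - A (r i) \<omega>)\<^sup>2)) \<partial>M)"
      proof (rule nn_integral_cong_AE, rule AE_mp[OF conv], rule AE_I2, rule impI)
        fix \<omega> assume "(\<lambda>i. A (r i) \<omega>) \<longlonglongrightarrow> L \<omega>"
        then have "(\<lambda>i. ennreal ((A n \<omega> - A (r i) \<omega>)\<^sup>2)) \<longlonglongrightarrow> ennreal ((A n \<omega> - L \<omega>)\<^sup>2)"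
          by (intro tendsto_intros)
        then show "ennreal ((A n \<omega> - L \<omega>)\<^sup>2) = liminf (\<lambda>i. ennreal ((A n \<omega> - A (r i) \<omega>)\<^sup>2))"
          by (intro lim_imp_Liminf[symmetric] trivial_limit_sequentially)
      qed
      also have "\<dots> \<le> liminf (\<lambda>i. \<integral>\<^sup>+\<omega>. ennreal ((A n \<omega> - A (r i) \<omega>)\<^sup>2) \<partial>M)"
        by (rule nn_integral_liminf) simp
      also have "\<dots> \<le> limsup (\<lambda>i. \<integral>\<^sup>+\<omega>. ennreal ((A n \<omega> - A (r i) \<omega>)\<^sup>2) \<partial>M)"
        by (rule Liminf_le_Limsup) simp
      also have "\<dots> \<le> ennreal e"
      proof (rule Limsup_bounded)
        show "\<forall>\<^sub>F i in sequentially. (\<integral>\<^sup>+\<omega>. ennreal ((A n \<omega> - A (r i) \<omega>)\<^sup>2) \<partial>M) \<le> ennreal e"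
          using eventually_ge_at_top[of N]
        proof eventually_elim
          case (elim i)
          then have "N \<le> r i" using seq_suble[OF r(1), of i] by simp
          have "(\<integral>\<^sup>+\<omega>. ennreal ((A n \<omega> - A (r i) \<omega>)\<^sup>2) \<partial>M) = ennreal (\<integral>\<omega>. (A n \<omega> - A (r i) \<omega>)\<^sup>2 \<partial>M)"
            using AA by (intro nn_integral_eq_integral) (auto simp: square_integrable_def)
          also have "\<dots> \<le> ennreal e"
            using N[OF n \<open>N \<le> r i\<close>] by (intro ennreal_leI) simp
          finally show ?case .
        qed
      qed
      finally show ?thesis .
    qed
    then show ?thesis by blast
  qed
  have L: "square_integrable M L"
  proof -
    obtain n where "(\<integral>\<^sup>+\<omega>. ennreal ((A n \<omega> - L \<omega>)\<^sup>2) \<partial>M) \<le> ennreal 1"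
      using fatou[of 1] by auto
    then have "integrable M (\<lambda>\<omega>. (A n \<omega> - L \<omega>)\<^sup>2)"
      by (intro integrableI_bounded) (auto intro: le_less_trans)
    then have "square_integrable M (\<lambda>\<omega>. A n \<omega> - L \<omega>)" by (simp add: square_integrable_def)
    from square_integrable_diff[OF A[of n] this] show ?thesis by simp
  qed
  moreover have "(\<lambda>n. \<integral>\<omega>. (A n \<omega> - L \<omega>)\<^sup>2 \<partial>M) \<longlonglongrightarrow> 0"
  proof (rule LIMSEQ_I)
    fix e :: real assume e: "0 < e"
    obtain N where N: "\<And>n. N \<le> n \<Longrightarrow> (\<integral>\<^sup>+\<omega>. ennreal ((A n \<omega> - L \<omega>)\<^sup>2) \<partial>M) \<le> ennreal (e / 2)"
      using fatou[of "e / 2"] e by auto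
    have le: "(\<integral>\<omega>. (A n \<omega> - L \<omega>)\<^sup>2 \<partial>M) \<le> e / 2" if "N \<le> n" for n
    proof -
      have "integrable M (\<lambda>\<omega>. (A n \<omega> - L \<omega>)\<^sup>2)"
        using square_integrable_diff[OF A L] by (simp add: square_integrable_def)
      then have "(\<integral>\<^sup>+\<omega>. ennreal ((A n \<omega> - L \<omega>)\<^sup>2) \<partial>M) = ennreal (\<integral>\<omega>. (A n \<omega> - L \<omega>)\<^sup>2 \<partial>M)"
        by (intro nn_integral_eq_integral) auto
      then show ?thesis using N[OF that] e by (simp add: ennreal_le_iff)
    qed
    have "norm ((\<integral>\<omega>. (A n \<omega> - L \<omega>)\<^sup>2 \<partial>M) - 0) < e" if "N \<le> n" for n
    proof -
      have "0 \<le> (\<integral>\<omega>. (A n \<omega> - L \<omega>)\<^sup>2 \<partial>M)" by (intro integral_nonneg_AE AE_I2) simp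
      moreover have "(\<integral>\<omega>. (A n \<omega> - L \<omega>)\<^sup>2 \<partial>M) \<le> e / 2" using that le by blast
      ultimately show ?thesis using e by simp
    qed
    then show "\<exists>N. \<forall>n\<ge>N. norm ((\<integral>\<omega>. (A n \<omega> - L \<omega>)\<^sup>2 \<partial>M) - 0) < e" by blast
  qed
  ultimately show ?thesis by (rule that)
qed

lemma ave_power2_le: "(ave x)\<^sup>2 \<le> (norm x)\<^sup>2"
  for x :: "real ^ ('n::finite)"
proof -
  let ?n = "real CARD('n)" and ?S = "\<Sum>i\<in>UNIV. (x $ i)\<^sup>2"
  have n1: "1 \<le> ?n"
    using zero_less_card_finite[where 'a='n] by linarith
  have S0: "0 \<le> ?S" by (intro sum_nonneg) auto
  have "(ave x)\<^sup>2 = (\<Sum>i\<in>UNIV. x $ i)\<^sup>2 / ?n\<^sup>2" by (simp add: ave_def power_divide)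
  also have "\<dots> \<le> (?n * ?S) / ?n\<^sup>2"
    using power2_sum_le_card[of "\<lambda>i. x $ i" UNIV] by (intro divide_right_mono) auto
  also have "\<dots> = ?S / ?n" using n1 by (simp add: power2_eq_square)
  also have "\<dots> \<le> ?S" using n1 S0 mult_left_mono[OF n1 S0] by (simp add: divide_le_eq)
  also have "\<dots> = (norm x)\<^sup>2" by (simp add: norm_vec_def L2_set_def S0)
  finally show ?thesis .
qed

lemma norm_diff_constant:
  fixes x :: "real ^ ('n::finite)"
  shows "(norm (x - b *\<^sub>R 1))\<^sup>2 \<le> 2 * V x + 2 * real CARD('n) * (ave x - b)\<^sup>2"
proof -
  have "(norm (x - b *\<^sub>R 1))\<^sup>2 = (\<Sum>i\<in>UNIV. ((x $ i - ave x) + (ave x - b))\<^sup>2)"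
    by (simp add: norm_vec_def L2_set_def sum_nonneg)
  also have "\<dots> \<le> (\<Sum>i\<in>(UNIV :: 'n set). 2 * (x $ i - ave x)\<^sup>2 + 2 * (ave x - b)\<^sup>2)"
  proof (rule sum_mono)
    fix i
    show "((x $ i - ave x) + (ave x - b))\<^sup>2 \<le> 2 * (x $ i - ave x)\<^sup>2 + 2 * (ave x - b)\<^sup>2"
      using sum_squares_bound[of "x $ i - ave x" "ave x - b"] unfolding power2_sum by linarith
  qed
  finally show ?thesis by (simp add: V_def sum.distrib sum_distrib_left)
qed

context noisy_network
begin

lemma square_integrable_ave_state: "1 \<le> t \<Longrightarrow> square_integrable M (\<lambda>\<omega>. ave (X t \<omega>))"
  by (intro square_integrable_ave square_integrable_state)

lemma ave_state_Suc:
  assumes "1 \<le> t" "balanced (G t)"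
  shows "ave (X (Suc t) \<omega>) = ave (X t \<omega>) + a t * ave (received_noise t \<omega>)"
  unfolding state_Suc[OF assms(1)] ave_add ave_scaleR ave_drift[OF assms(2)] by simp

lemma prior_orthogonal_ave:
  assumes "prior t f" "1 \<le> t"
  shows "integrable M (\<lambda>\<omega>. f \<omega> * ave (received_noise t \<omega>))"
    and "(\<integral>\<omega>. f \<omega> * ave (received_noise t \<omega>) \<partial>M) = 0"
  using prior_orthogonal[OF assms] by (simp_all add: ave_def sum_distrib_left)

lemma expectation_ave:
  assumes bal: "\<And>t. 1 \<le> t \<Longrightarrow> balanced (G t)" and t: "1 \<le> t"
  shows "(\<integral>\<omega>. ave (X t \<omega>) \<partial>M) = ave x1"
  using t
proof (induction t rule: dec_induct)
  case base
  show ?case using prob_space by simp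
next
  case (step t)
  have "integrable M (\<lambda>\<omega>. ave (X t \<omega>))"
    by (intro square_integrable_integrable square_integrable_ave_state step.hyps)
  then show ?case
    using step prior_orthogonal_ave[OF prior_const[of t 1]] by (simp add: ave_state_Suc bal)
qed

text \<open>Balance makes the average a martingale-like sum of the noise, with orthogonal increments.\<close>

lemma expectation_ave_diff_le:
  assumes bal: "\<And>t. 1 \<le> t \<Longrightarrow> balanced (G t)" and s: "1 \<le> s" "s \<le> t"
  shows "(\<integral>\<omega>. (ave (X t \<omega>) - ave (X s \<omega>))\<^sup>2 \<partial>M) \<le> noise_power CARD('n) amax vhi * (\<Sum>u\<in>{s..<t}. (a u)\<^sup>2)"
  using s(2)
proof (induction t rule: dec_induct)
  case (step t)
  have t: "1 \<le> t" using s step.hyps by simp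
  let ?f = "\<lambda>\<omega>. ave (X t \<omega>) - ave (X s \<omega>)" and ?m = "\<lambda>\<omega>. ave (received_noise t \<omega>)"
    and ?P = "noise_power CARD('n) amax vhi"
  have f: "prior t ?f"
    using prior_mono[OF prior_state[OF s(1)] step.hyps(1)] t by (intro prior_diff prior_ave prior_state) auto
  have m: "square_integrable M ?m"
    by (intro square_integrable_ave square_integrable_received_noise t)
  have "(\<integral>\<omega>. (?m \<omega>)\<^sup>2 \<partial>M) \<le> (\<integral>\<omega>. (norm (received_noise t \<omega>))\<^sup>2 \<partial>M)"
    using m by (intro integral_mono integrable_norm_power2 square_integrable_received_noise t ave_power2_le)
      (auto simp: square_integrable_def)
  then have m_le: "(\<integral>\<omega>. (?m \<omega>)\<^sup>2 \<partial>M) \<le> ?P"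
    using expectation_norm_noise_le[OF t] by linarith
  have "(\<integral>\<omega>. (ave (X (Suc t) \<omega>) - ave (X s \<omega>))\<^sup>2 \<partial>M)
      = (\<integral>\<omega>. (?f \<omega>)\<^sup>2 + 2 * a t * (?f \<omega> * ?m \<omega>) + (a t)\<^sup>2 * (?m \<omega>)\<^sup>2 \<partial>M)"
    unfolding ave_state_Suc[OF t bal[OF t]]
    by (intro Bochner_Integration.integral_cong refl) (simp add: power2_eq_square algebra_simps)
  also have "\<dots> = (\<integral>\<omega>. (?f \<omega>)\<^sup>2 \<partial>M) + (a t)\<^sup>2 * (\<integral>\<omega>. (?m \<omega>)\<^sup>2 \<partial>M)"
  proof -
    have i: "integrable M (\<lambda>\<omega>. (?f \<omega>)\<^sup>2)" "integrable M (\<lambda>\<omega>. (?m \<omega>)\<^sup>2)"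
      using prior_square_integrable[OF f] m by (auto simp: square_integrable_def)
    note o = prior_orthogonal_ave[OF f t]
    have "(\<integral>\<omega>. (?f \<omega>)\<^sup>2 + 2 * a t * (?f \<omega> * ?m \<omega>) + (a t)\<^sup>2 * (?m \<omega>)\<^sup>2 \<partial>M)
        = (\<integral>\<omega>. (?f \<omega>)\<^sup>2 \<partial>M) + (\<integral>\<omega>. 2 * a t * (?f \<omega> * ?m \<omega>) \<partial>M) + (\<integral>\<omega>. (a t)\<^sup>2 * (?m \<omega>)\<^sup>2 \<partial>M)"
      by (subst Bochner_Integration.integral_add, intro Bochner_Integration.integrable_add integrable_mult_right i o(1),
          intro integrable_mult_right i, subst Bochner_Integration.integral_add,
          intro i, intro integrable_mult_right o(1), rule refl)
    then show ?thesis using o(2) by simp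
  qed
  also have "\<dots> \<le> ?P * (\<Sum>u\<in>{s..<t}. (a u)\<^sup>2) + (a t)\<^sup>2 * ?P"
    using m_le by (intro add_mono step.IH mult_left_mono) auto
  finally show ?case using step.hyps by (simp add: algebra_simps)
qed simp

theorem unbiased_consensus:
  assumes bal: "\<And>t. 1 \<le> t \<Longrightarrow> balanced (G t)"
    and sum: "summable (\<lambda>t. (a t)\<^sup>2)"
    and lim: "mean_disagreement \<longlonglongrightarrow> 0"
  shows "unbiased_ms_average_consensus M X x1"
proof -
  let ?P = "noise_power CARD('n) amax vhi"
  define A where "A t \<omega> = ave (X (Suc t) \<omega>)" for t \<omega>
  have A: "square_integrable M (A t)" for t
    unfolding A_def by (intro square_integrable_ave_state) simp
  have "\<exists>N. \<forall>m\<ge>N. \<forall>n\<ge>N. (\<integral>\<omega>. (A m \<omega> - A n \<omega>)\<^sup>2 \<partial>M) < e" if e: "0 < e" for e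
  proof -
    have P: "0 \<le> ?P" by (rule noise_power_nonneg)
    obtain N where N: "\<And>m n. N \<le> m \<Longrightarrow> norm (\<Sum>u\<in>{m..<n}. (a u)\<^sup>2) < e / (?P + 1)"
      using sum[unfolded summable_Cauchy] e P by (meson divide_pos_pos add_nonneg_pos zero_less_one)
    have le: "(\<integral>\<omega>. (A n \<omega> - A m \<omega>)\<^sup>2 \<partial>M) < e" if "N \<le> m" "m \<le> n" for m n
    proof -
      have "(\<integral>\<omega>. (A n \<omega> - A m \<omega>)\<^sup>2 \<partial>M) \<le> ?P * (\<Sum>u\<in>{Suc m..<Suc n}. (a u)\<^sup>2)"
        unfolding A_def using that bal by (intro expectation_ave_diff_le) auto
      also have "\<dots> \<le> ?P * (e / (?P + 1))"
        using N[of "Suc m" "Suc n"] that P by (intro mult_left_mono) (auto simp: abs_less_iff)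
      also have "\<dots> < e" using P e by (simp add: field_simps)
      finally show ?thesis .
    qed
    have "(\<integral>\<omega>. (A m \<omega> - A n \<omega>)\<^sup>2 \<partial>M) < e" if "N \<le> m" "N \<le> n" for m n
      using le[of m n] le[of n m] that by (cases "m \<le> n") (auto simp: power2_commute)
    then show ?thesis by blast
  qed
  with A obtain L where L: "square_integrable M L"
    and conv: "(\<lambda>n. \<integral>\<omega>. (A n \<omega> - L \<omega>)\<^sup>2 \<partial>M) \<longlonglongrightarrow> 0"
    using L2_Cauchy_limit[of A] by blast
  have AL: "square_integrable M (\<lambda>\<omega>. A n \<omega> - L \<omega>)" for n by (intro square_integrable_diff A L)
  have mean: "(\<integral>\<omega>. L \<omega> \<partial>M) = ave x1"
  proof (rule ccontr)
    assume "(\<integral>\<omega>. L \<omega> \<partial>M) \<noteq> ave x1"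
    define e where "e = \<bar>ave x1 - (\<integral>\<omega>. L \<omega> \<partial>M)\<bar>"
    have e: "0 < e" using \<open>(\<integral>\<omega>. L \<omega> \<partial>M) \<noteq> ave x1\<close> by (simp add: e_def)
    have "eventually (\<lambda>n. (\<integral>\<omega>. (A n \<omega> - L \<omega>)\<^sup>2 \<partial>M) < e * e) sequentially"
      using e by (intro order_tendstoD(2)[OF conv]) (rule mult_pos_pos)
    then obtain n where n: "(\<integral>\<omega>. (A n \<omega> - L \<omega>)\<^sup>2 \<partial>M) < e * e"
      unfolding eventually_sequentially by blast
    have "ave x1 - (\<integral>\<omega>. L \<omega> \<partial>M) = (\<integral>\<omega>. A n \<omega> - L \<omega> \<partial>M)"
      using Bochner_Integration.integral_diff[OF square_integrable_integrable[OF A[of n]]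
          square_integrable_integrable[OF L]] expectation_ave[OF bal, of "Suc n"]
      unfolding A_def by simp
    then have "e = \<bar>\<integral>\<omega>. A n \<omega> - L \<omega> \<partial>M\<bar>" unfolding e_def by (rule arg_cong)
    also have "\<dots> \<le> (\<integral>\<omega>. \<bar>A n \<omega> - L \<omega>\<bar> \<partial>M)" by (rule integral_abs_bound)
    also have "\<dots> \<le> (e + (\<integral>\<omega>. (A n \<omega> - L \<omega>)\<^sup>2 \<partial>M) / e) / 2"
      by (rule expectation_abs_le[OF AL e])
    also have "\<dots> < e"
    proof -
      have "(\<integral>\<omega>. (A n \<omega> - L \<omega>)\<^sup>2 \<partial>M) / e < e"
        using n e by (subst pos_divide_less_eq)
      then have "e + (\<integral>\<omega>. (A n \<omega> - L \<omega>)\<^sup>2 \<partial>M) / e < e + e" by (rule add_strict_left_mono)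
      then show ?thesis by simp
    qed
    finally show False by simp
  qed
  have bound: "(\<integral>\<^sup>+\<omega>. ennreal ((norm (X (Suc t) \<omega> - L \<omega> *\<^sub>R 1))\<^sup>2) \<partial>M)
      \<le> ennreal (2 * mean_disagreement (Suc t) + 2 * real CARD('n) * (\<integral>\<omega>. (A t \<omega> - L \<omega>)\<^sup>2 \<partial>M))" for t
  proof -
    have i: "integrable M (\<lambda>\<omega>. V (X (Suc t) \<omega>))" "integrable M (\<lambda>\<omega>. (A t \<omega> - L \<omega>)\<^sup>2)"
      using AL by (auto simp: square_integrable_def intro!: integrable_V square_integrable_state)
    have "(\<integral>\<^sup>+\<omega>. ennreal ((norm (X (Suc t) \<omega> - L \<omega> *\<^sub>R 1))\<^sup>2) \<partial>M)
        \<le> (\<integral>\<^sup>+\<omega>. ennreal (2 * V (X (Suc t) \<omega>) + 2 * real CARD('n) * (A t \<omega> - L \<omega>)\<^sup>2) \<partial>M)"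
      unfolding A_def by (intro nn_integral_mono ennreal_leI norm_diff_constant)
    also have "\<dots> = ennreal (\<integral>\<omega>. 2 * V (X (Suc t) \<omega>) + 2 * real CARD('n) * (A t \<omega> - L \<omega>)\<^sup>2 \<partial>M)"
      using i by (intro nn_integral_eq_integral) (auto simp: V_nonneg)
    also have "(\<integral>\<omega>. 2 * V (X (Suc t) \<omega>) + 2 * real CARD('n) * (A t \<omega> - L \<omega>)\<^sup>2 \<partial>M)
        = 2 * mean_disagreement (Suc t) + 2 * real CARD('n) * (\<integral>\<omega>. (A t \<omega> - L \<omega>)\<^sup>2 \<partial>M)"
      using i by (simp add: mean_disagreement_def)
    finally show ?thesis .
  qed
  have "(\<lambda>t. 2 * mean_disagreement (Suc t) + 2 * real CARD('n) * (\<integral>\<omega>. (A t \<omega> - L \<omega>)\<^sup>2 \<partial>M)) \<longlonglongrightarrow> 2 * 0 + 2 * real CARD('n) * 0"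
    by (intro tendsto_intros conv LIMSEQ_Suc lim)
  then have lim0: "(\<lambda>t. ennreal (2 * mean_disagreement (Suc t) + 2 * real CARD('n) * (\<integral>\<omega>. (A t \<omega> - L \<omega>)\<^sup>2 \<partial>M))) \<longlonglongrightarrow> 0"
    using tendsto_ennrealI[of _ 0 sequentially] by simp
  have "(\<lambda>t. \<integral>\<^sup>+\<omega>. ennreal ((norm (X (Suc t) \<omega> - L \<omega> *\<^sub>R 1))\<^sup>2) \<partial>M) \<longlonglongrightarrow> 0"
    by (rule tendsto_sandwich[OF always_eventually always_eventually tendsto_const lim0])
      (intro allI bound zero_le)+
  then have "(\<lambda>t. \<integral>\<^sup>+\<omega>. ennreal ((norm (X t \<omega> - L \<omega> *\<^sub>R 1))\<^sup>2) \<partial>M) \<longlonglongrightarrow> 0"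
    by (rule LIMSEQ_imp_Suc)
  then have "ms_consensus_to M X L"
    using L square_integrable_integrable[OF L] by (simp add: ms_consensus_to_def square_integrable_def)
  with mean show ?thesis unfolding unbiased_ms_average_consensus_def by blast
qed

end

section \<open>The adversarial topologies\<close>

definition complete_graph :: "('n::finite) wdigraph" where
  "complete_graph = \<lparr>edges = UNIV, weight = (\<chi> i j. 1)\<rparr>"

definition loop_graph :: "('n::finite) wdigraph" where
  "loop_graph = \<lparr>edges = Id, weight = (\<chi> i j. 1)\<rparr>"

text \<open>Self-loops carry noise into the network but no information between agents.  A topology that
  shows the loops almost always and a complete graph once per block therefore collects the noise of
  the whole block for a single contraction.\<close>

definition flash_topology :: "nat set \<Rightarrow> ('n::finite) topology" where
  "flash_topology F t = (if t \<in> F then complete_graph else loop_graph)"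

lemma V_add_constant: "V (x + b *\<^sub>R 1) = V x"
proof -
  have "ave (b *\<^sub>R 1 :: real ^ 'a) = b" by (simp add: ave_def)
  then show ?thesis by (simp add: V_def ave_add)
qed

lemma V_complete_step:
  fixes x :: "real ^ ('n::finite)"
  shows "V (x + a *\<^sub>R drift complete_graph x) = (1 - real CARD('n) * a)\<^sup>2 * V x"
proof -
  let ?n = "real CARD('n)"
  have "x + a *\<^sub>R drift complete_graph x
      = (1 - ?n * a) *\<^sub>R x + (a * (\<Sum>j\<in>UNIV. x $ j)) *\<^sub>R 1"
    by (simp add: vec_eq_iff drift_def complete_graph_def nbrs_def sum_subtractf algebra_simps)
  then show ?thesis by (simp add: V_add_constant V_scaleR)
qed

lemma drift_loop_graph: "drift loop_graph x = 0"
  by (simp add: vec_eq_iff drift_def loop_graph_def nbrs_def)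

lemma flash_topology_in_class:
  fixes c \<delta> amax :: real and \<tau> :: "nat \<Rightarrow> nat"
  assumes "1 \<le> amax"
    and \<tau>: "\<tau> 1 = 1" "strict_mono_on {1..} \<tau>"
      "\<And>k. 1 < k \<Longrightarrow> real (\<tau> k) \<le> real (\<tau> (k - 1)) + c * real (\<tau> (k - 1)) powr \<delta>"
    and F: "\<And>k. 1 < k \<Longrightarrow> \<exists>s\<in>F. \<tau> (k - 1) \<le> s \<and> s < \<tau> k"
  shows "flash_topology F \<in> (topology_class amax \<delta> c :: ('n::finite) topology set)"
proof -
  have "strongly_connected (with_proj (union_graph (flash_topology F :: 'n topology) {\<tau> (k - 1)..<\<tau> k}))"
    if k: "1 < k" for k
  proof -
    obtain s where s: "s \<in> F" "s \<in> {\<tau> (k - 1)..<\<tau> k}" using F[OF k] by auto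
    have "(\<Union>t\<in>{\<tau> (k - 1)..<\<tau> k}. edges (flash_topology F t :: 'n wdigraph)) = UNIV"
    proof -
      have "edges (flash_topology F s :: 'n wdigraph) = UNIV"
        using s by (simp add: flash_topology_def complete_graph_def)
      then show ?thesis using s by blast
    qed
    moreover have "(u, v) \<in> rtrancl_on UNIV (UNIV :: ('n \<times> 'n) set)" for u v
      by (rule rtrancl_consistent_rtrancl_on) auto
    ultimately show ?thesis
      by (auto simp: strongly_connected_def reachable_def union_graph_def arcs_ends_def
          arc_to_ends_def)
  qed
  then have "ext_joint_connected \<delta> c (flash_topology F :: 'n topology)"
    unfolding ext_joint_connected_def using \<tau> by blast
  moreover have "weights_bounded amax (flash_topology F :: 'n topology)"
    using assms(1) by (auto simp: weights_bounded_def flash_topology_def complete_graph_def loop_graph_def)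
  moreover have "balanced (flash_topology F t :: 'n wdigraph)" for t
    by (auto simp: balanced_def flash_topology_def complete_graph_def loop_graph_def nbrs_def)
  ultimately show ?thesis by (simp add: topology_class_def)
qed

text \<open>The longest admissible blocks.\<close>

primrec block_start :: "real \<Rightarrow> real \<Rightarrow> nat \<Rightarrow> nat" where
  "block_start c \<delta> 0 = 1"
| "block_start c \<delta> (Suc k)
    = block_start c \<delta> k + nat \<lfloor>c * real (block_start c \<delta> k) powr \<delta>\<rfloor>"

lemma block_start_Suc:
  fixes c \<delta> :: real
  assumes "1 \<le> c" "0 \<le> \<delta>"
  defines "T \<equiv> block_start c \<delta>"
  shows "1 \<le> T k" and "T k < T (Suc k)"
    and "real (T (Suc k) - T k) \<le> c * real (T k) powr \<delta>"
    and "c * real (T k) powr \<delta> \<le> 2 * real (T (Suc k) - T k)"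
proof -
  show T1: "1 \<le> T k" unfolding T_def by (induction k) auto
  have "1 * 1 \<le> c * real (T k) powr \<delta>"
    using T1 assms by (intro mult_mono ge_one_powr_ge_zero) auto
  moreover define L where "L = nat \<lfloor>c * real (T k) powr \<delta>\<rfloor>"
  ultimately have L: "1 \<le> L" "real L \<le> c * real (T k) powr \<delta>" "c * real (T k) powr \<delta> < real L + 1"
    by linarith+
  have "T (Suc k) = T k + L" by (simp add: T_def L_def)
  then show "T k < T (Suc k)" "real (T (Suc k) - T k) \<le> c * real (T k) powr \<delta>"
    "c * real (T k) powr \<delta> \<le> 2 * real (T (Suc k) - T k)"
    using L by auto
qed

section \<open>The lower bound on the rate\<close>

text \<open>The single contraction keeps at least a quarter of the noise that entered before it, unless its gain
  is so large that the noise of the contraction step alone leaves a constant disagreement.\<close>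

lemma one_contraction_per_block:
  fixes v a :: "nat \<Rightarrow> real" and q n :: real
  assumes m: "T \<le> m" "m < T'"
    and a: "0 \<le> a m" "\<And>s. T \<le> s \<Longrightarrow> s < T' \<Longrightarrow> a m \<le> a s"
    and q: "0 \<le> q" and n: "0 < n" and v: "0 \<le> v T"
    and loops: "\<And>s. T \<le> s \<Longrightarrow> s < T' \<Longrightarrow> s \<noteq> m \<Longrightarrow> v s + (a s)\<^sup>2 * q \<le> v (Suc s)"
    and flash: "(1 - n * a m)\<^sup>2 * v m + (a m)\<^sup>2 * q \<le> v (Suc m)"
  shows "n * a m \<le> 1 / 2 \<and> (1 - 2 * (n * a m)) * v T + real (T' - T) * (a m)\<^sup>2 * q / 4 \<le> v T'
    \<or> q / (4 * n\<^sup>2) \<le> v T'"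
proof -
  let ?b = "a m"
  let ?e = "?b\<^sup>2 * q"
  have e0: "0 \<le> ?e" using q by simp
  have inc: "v s + ?e \<le> v (Suc s)" if "T \<le> s" "s < T'" "s \<noteq> m" for s
  proof -
    have "?e \<le> (a s)\<^sup>2 * q" using a(1) a(2)[of s] that q by (intro mult_right_mono power_mono) auto
    then show ?thesis using loops[OF that] by linarith
  qed
  have before: "s \<le> m \<Longrightarrow> v T + real (s - T) * ?e \<le> v s" if "T \<le> s" for s
    using that
  proof (induction s rule: dec_induct)
    case (step s)
    then have "v s + ?e \<le> v (Suc s)" using m by (intro inc) auto
    moreover have eq: "real (Suc s - T) = real (s - T) + 1" using step.hyps by linarith
    moreover have "v T + real (s - T) * ?e \<le> v s" using step by simp
    ultimately show ?case unfolding eq distrib_right by linarith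
  qed simp
  have after: "s \<le> T' \<Longrightarrow> v (Suc m) + real (s - Suc m) * ?e \<le> v s" if "Suc m \<le> s" for s
    using that
  proof (induction s rule: dec_induct)
    case (step s)
    then have "v s + ?e \<le> v (Suc s)" using m by (intro inc) auto
    moreover have eq: "real (Suc s - Suc m) = real (s - Suc m) + 1" using step.hyps by linarith
    moreover have "v (Suc m) + real (s - Suc m) * ?e \<le> v s" using step by simp
    ultimately show ?case unfolding eq distrib_right by linarith
  qed simp
  have vm: "v T + real (m - T) * ?e \<le> v m" using before[of m] m by simp
  have vT': "(1 - n * ?b)\<^sup>2 * v m + ?e + real (T' - Suc m) * ?e \<le> v T'"
    using after[of T'] m flash by simp
  have vm0: "0 \<le> v m" using vm v e0 by (smt (verit) mult_nonneg_nonneg of_nat_0_le_iff)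
  show ?thesis
  proof (cases "n * ?b \<le> 1 / 2")
    case True
    have nb: "0 \<le> n * ?b" using n a by simp
    have sq: "1 / 4 \<le> (1 - n * ?b)\<^sup>2" using power_mono[of "1 / 2" "1 - n * ?b" 2] True by (simp add: power2_eq_square)
    have sq': "1 - 2 * (n * ?b) \<le> (1 - n * ?b)\<^sup>2"
      using zero_le_power2[of "n * ?b"] by (simp add: power2_eq_square algebra_simps)
    have "(1 - n * ?b)\<^sup>2 * (v T + real (m - T) * ?e) \<le> (1 - n * ?b)\<^sup>2 * v m"
      using vm by (intro mult_left_mono) auto
    moreover have "(1 - 2 * (n * ?b)) * v T \<le> (1 - n * ?b)\<^sup>2 * v T"
      using sq' v by (intro mult_right_mono) auto
    moreover have "1 / 4 * (real (m - T) * ?e) \<le> (1 - n * ?b)\<^sup>2 * (real (m - T) * ?e)"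
      using sq e0 by (intro mult_right_mono) auto
    moreover have "real (T' - T) * ?e = real (m - T) * ?e + ?e + real (T' - Suc m) * ?e"
    proof -
      have "real (T' - T) = real (m - T) + 1 + real (T' - Suc m)" using m by (simp add: of_nat_diff)
      then show ?thesis by (simp only: distrib_right mult_1)
    qed
    moreover have "0 \<le> real (T' - Suc m) * ?e" using e0 by simp
    ultimately have "(1 - 2 * (n * ?b)) * v T + real (T' - T) * ?e / 4 \<le> v T'"
      using vT' e0 unfolding distrib_left by linarith
    then show ?thesis using True by simp
  next
    case False
    then have "(1 / 2)\<^sup>2 \<le> (n * ?b)\<^sup>2" by (intro power_mono) auto
    then have "1 / 4 \<le> n\<^sup>2 * ?b\<^sup>2" by (simp add: power2_eq_square mult_ac)
    then have "q * (1 / 4) \<le> q * (n\<^sup>2 * ?b\<^sup>2)" using q by (rule mult_left_mono)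
    then have "q / (4 * n\<^sup>2) \<le> ?e" using n by (simp add: field_simps)
    also have "\<dots> \<le> v T'" using vT' vm0 e0 by (smt (verit) mult_nonneg_nonneg of_nat_0_le_iff zero_le_power2)
    finally show ?thesis by simp
  qed
qed

text \<open>Whatever the gain \<open>b\<close>, completing the square in \<open>b\<close> bounds the relative loss in a block by a
  multiple of \<open>g / L\<close>, which for \<open>g = C T\<^sup>-\<^sup>p\<close> is at most the loss \<open>p L / T'\<close> of the claimed bound.\<close>

lemma lower_rate_step:
  fixes T T' L c \<delta> q n C b v v' :: real
  defines "p \<equiv> 1 - 2 * \<delta>"
  assumes \<delta>: "0 \<le> \<delta>" "\<delta> < 1 / 2" and c: "1 \<le> c" and q: "0 < q" and n: "0 < n"
    and T: "1 \<le> T" "T' = T + L" and L: "0 < L" "L \<le> c * T powr \<delta>" "c * T powr \<delta> \<le> 2 * L"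
    and C: "0 < C" "C \<le> p * q * c\<^sup>2 / (16 * n\<^sup>2 * (1 + c))"
    and b: "n * b \<le> 1 / 2" and v: "C * T powr (- p) \<le> v"
    and v': "(1 - 2 * (n * b)) * v + L * b\<^sup>2 * q / 4 \<le> v'"
  shows "C * T' powr (- p) \<le> v'"
proof -
  define g where "g = C * T powr (- p)"
  have p: "0 < p" "p \<le> 1" using \<delta> by (auto simp: p_def)
  have g0: "0 < g" using C T by (simp add: g_def)
  have T'0: "0 < T'" using T L by simp
  have "T powr \<delta> \<le> T powr 1" using T \<delta> by (intro powr_mono) auto
  then have "L \<le> c * T" using L c T by (smt (verit) mult_left_mono powr_one)
  then have T'_le: "T' \<le> (1 + c) * T" using T by (simp add: algebra_simps)
  have "4 * n\<^sup>2 * g * T' \<le> 4 * n\<^sup>2 * g * ((1 + c) * T)"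
    using T'_le g0 by (intro mult_left_mono) auto
  also have "\<dots> = 4 * n\<^sup>2 * (1 + c) * C * (T powr (- p) * T powr 1)"
    using T by (simp add: g_def)
  also have "T powr (- p) * T powr 1 = T powr (2 * \<delta>)"
    unfolding p_def powr_add[symmetric] by (rule arg_cong[of _ _ "\<lambda>e. T powr e"]) simp
  also have "4 * n\<^sup>2 * (1 + c) * C * T powr (2 * \<delta>) \<le> (p * q * c\<^sup>2 / 4) * T powr (2 * \<delta>)"
  proof (rule mult_right_mono)
    have "C * (16 * n\<^sup>2 * (1 + c)) \<le> p * q * c\<^sup>2"
      using C n c by (subst (asm) pos_le_divide_eq) (auto intro!: mult_pos_pos)
    then show "4 * n\<^sup>2 * (1 + c) * C \<le> p * q * c\<^sup>2 / 4" by (simp add: algebra_simps)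
  qed simp
  also have "\<dots> = p * q * (c * T powr \<delta> / 2)\<^sup>2"
  proof -
    have "T powr (2 * \<delta>) = (T powr \<delta>)\<^sup>2"
      by (simp add: power2_eq_square flip: powr_add)
    then show ?thesis by (simp add: power2_eq_square)
  qed
  also have "\<dots> \<le> p * q * L\<^sup>2"
    using p q L c T by (intro mult_left_mono power_mono) auto
  finally have "4 * n\<^sup>2 * g / (L * q) \<le> p * L / T'"
    using L q T'0 by (simp add: field_simps power2_eq_square)
  then have gain_loss: "g * (4 * n\<^sup>2 * g / (L * q)) \<le> g * (p * L / T')"
    using g0 by (intro mult_left_mono) auto
  have bern: "(T / T') powr p \<le> 1 - p * L / T'"
  proof -
    have "(T / T') powr p * 1 powr (1 - p) \<le> p * (T / T') + (1 - p) * 1"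
      using p T T'0 by (intro Youngs_inequality_0) auto
    also have "\<dots> = 1 - p * L / T'" using T T'0 by (simp add: field_simps)
    finally show ?thesis by simp
  qed
  have "C * T' powr (- p) = g * (T / T') powr p"
    using T T'0 by (simp add: g_def powr_divide powr_minus field_simps)
  also have "\<dots> \<le> g * (1 - p * L / T')"
    using bern g0 by (intro mult_left_mono) auto
  also have "\<dots> \<le> g - g * (4 * n\<^sup>2 * g / (L * q))"
    using gain_loss by (simp add: algebra_simps)
  also have "\<dots> \<le> (1 - 2 * (n * b)) * g + L * b\<^sup>2 * q / 4"
  proof -
    have "0 \<le> L * q / 4 * (b - 4 * n * g / (L * q))\<^sup>2" using L q by simp
    also have "\<dots> = L * b\<^sup>2 * q / 4 - 2 * (n * b) * g + g * (4 * n\<^sup>2 * g / (L * q))"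
      using L q by (simp add: power2_eq_square field_simps)
    finally show ?thesis by (simp add: algebra_simps)
  qed
  also have "\<dots> \<le> (1 - 2 * (n * b)) * v + L * b\<^sup>2 * q / 4"
    using b v unfolding g_def by (intro add_right_mono mult_left_mono) auto
  finally show ?thesis using v' by linarith
qed

context noisy_network
begin

lemma mean_disagreement_Suc_ge:
  assumes t: "1 \<le> t" and n: "2 \<le> CARD('n)"
  shows "G t = loop_graph \<Longrightarrow> mean_disagreement t + (a t)\<^sup>2 * (vlo / 4) \<le> mean_disagreement (Suc t)"
    and "G t = complete_graph \<Longrightarrow>
      (1 - real CARD('n) * a t)\<^sup>2 * mean_disagreement t + (a t)\<^sup>2 * (vlo / 4) \<le> mean_disagreement (Suc t)"
proof -
  have noise: "(a t)\<^sup>2 * (vlo / 4) \<le> (a t)\<^sup>2 * (\<integral>\<omega>. V (received_noise t \<omega>) \<partial>M)" if "edges (G t) \<noteq> {}"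
    using expectation_V_noise_ge[OF t n that] by (intro mult_left_mono) auto
  show "mean_disagreement t + (a t)\<^sup>2 * (vlo / 4) \<le> mean_disagreement (Suc t)" if G: "G t = loop_graph"
  proof -
    have "(undefined, undefined) \<in> edges (G t)" unfolding G by (simp add: loop_graph_def)
    then have "edges (G t) \<noteq> {}" by blast
    from noise[OF this] show ?thesis
      unfolding mean_disagreement_Suc[OF t] unfolding G drift_loop_graph
      by (simp add: mean_disagreement_def)
  qed
  show "(1 - real CARD('n) * a t)\<^sup>2 * mean_disagreement t + (a t)\<^sup>2 * (vlo / 4) \<le> mean_disagreement (Suc t)"
    if G: "G t = complete_graph"
    unfolding mean_disagreement_Suc[OF t] unfolding G V_complete_step
    using noise by (simp add: G complete_graph_def mean_disagreement_def)
qed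

end

text \<open>The constant \<open>C\<close> is small enough for the start of the induction over blocks, for blocks with a
  large minimal gain and for the step \<open>lower_rate_step\<close>.\<close>

theorem disagreement_lower_bound:
  fixes M :: "'w measure" and w :: "(('n::finite), 'w) noise" and x1 :: "real ^ 'n"
    and \<delta> c amax vlo vhi :: real
  assumes \<delta>: "0 \<le> \<delta>" "\<delta> < 1 / 2" and c: "1 \<le> c" and amax: "1 \<le> amax" and vlo: "0 < vlo"
    and n: "2 \<le> CARD('n)" and x1: "0 < V x1"
    and net: "\<And>G. weights_bounded amax G \<Longrightarrow> noisy_network M w G amax vlo vhi"
  shows "\<exists>C>0. \<forall>t\<ge>1. \<forall>a. (\<forall>s\<in>{1..<t}. 0 \<le> a s) \<longrightarrow>
    (\<exists>G\<in>topology_class amax \<delta> c.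
      C * real t powr (- (1 - 2 * \<delta>)) \<le> noisy_network.mean_disagreement M w G a x1 t)"
proof -
  let ?n = "real CARD('n)" and ?q = "vlo / 4" and ?p = "1 - 2 * \<delta>"
  define C where "C = min (V x1) (min (?q / (4 * ?n\<^sup>2)) (?p * ?q * c\<^sup>2 / (16 * ?n\<^sup>2 * (1 + c))))"
  have n0: "0 < ?n" using n by simp
  have C0: "0 < C" using x1 vlo n0 c \<delta> by (auto simp: C_def intro!: mult_pos_pos divide_pos_pos)
  have C: "C \<le> V x1" "C \<le> ?q / (4 * ?n\<^sup>2)" "C \<le> ?p * ?q * c\<^sup>2 / (16 * ?n\<^sup>2 * (1 + c))"
    by (auto simp: C_def)
  let ?T = "block_start c \<delta>"
  note T = block_start_Suc[OF c \<delta>(1)]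
  have mono: "?T j \<le> ?T k" if "j \<le> k" for j k
    using that by (rule lift_Suc_mono_le[of ?T, OF less_imp_le[OF T(2)]])
  have same: "j = k" if "?T j \<le> s" "s < ?T (Suc j)" "?T k \<le> s" "s < ?T (Suc k)" for j k s
    using that mono[of "Suc j" k] mono[of "Suc k" j] by (metis Suc_leI le_trans linorder_neqE_nat not_less)
  have smono: "strict_mono_on {1..} (\<lambda>k. ?T (k - 1))"
  proof (rule strict_mono_onI)
    fix j k :: nat assume "j \<in> {1..}" "j < k"
    then have "Suc (j - 1) \<le> k - 1" by auto
    moreover have "?T (j - 1) < ?T (Suc (j - 1))" by (rule T(2))
    ultimately show "?T (j - 1) < ?T (k - 1)" using mono[of "Suc (j - 1)" "k - 1"] by linarith
  qed
  show ?thesis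
  proof (intro exI[of _ C] conjI C0 allI impI)
    fix t :: nat and a :: "nat \<Rightarrow> real"
    assume t: "1 \<le> t" and a: "\<forall>s\<in>{1..<t}. 0 \<le> a s"
    have "\<exists>m. ?T k \<le> m \<and> m < ?T (Suc k) \<and> (\<forall>s. ?T k \<le> s \<longrightarrow> s < ?T (Suc k) \<longrightarrow> a m \<le> a s)" for k
    proof -
      have "{?T k..<?T (Suc k)} \<noteq> {}" using T(2)[of k] by auto
      then have "\<exists>m. is_arg_min a (\<lambda>m. m \<in> {?T k..<?T (Suc k)}) m"
        by (intro ex_is_arg_min_if_finite) auto
      then show ?thesis by (auto simp: is_arg_min_linorder)
    qed
    then obtain m where m: "\<And>k. ?T k \<le> m k" "\<And>k. m k < ?T (Suc k)"
      "\<And>k s. ?T k \<le> s \<Longrightarrow> s < ?T (Suc k) \<Longrightarrow> a (m k) \<le> a s"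
      by metis
    \<comment> \<open>In the block that contains \<open>t\<close> the contraction is put off to time \<open>t\<close> or later.\<close>
    define F where "F = {s. t \<le> s \<or> (\<exists>k. ?T (Suc k) \<le> t \<and> s = m k)}"
    define G where "G = (flash_topology F :: 'n topology)"
    have G: "G \<in> topology_class amax \<delta> c"
      unfolding G_def
    proof (rule flash_topology_in_class[where \<tau> = "\<lambda>k. ?T (k - 1)"])
      show "strict_mono_on {1..} (\<lambda>k. ?T (k - 1))" by (rule smono)
      fix k :: nat assume k: "1 < k"
      then obtain l where l: "k = Suc (Suc l)" by (metis Suc_diff_Suc One_nat_def diff_Suc_1 less_imp_Suc_add add_Suc plus_1_eq_Suc)
      show "real (?T (k - 1)) \<le> real (?T (k - 1 - 1)) + c * real (?T (k - 1 - 1)) powr \<delta>"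
        using T(2,3)[of l] by (simp add: l of_nat_diff del: block_start.simps)
      show "\<exists>s\<in>F. ?T (k - 1 - 1) \<le> s \<and> s < ?T (k - 1)"
      proof (cases "?T (Suc l) \<le> t")
        case True
        then show ?thesis using m[of l] by (intro bexI[of _ "m l"]) (auto simp: l F_def simp del: block_start.simps)
      next
        case False
        then show ?thesis using T(2)[of l]
          by (intro bexI[of _ "?T (Suc l) - 1"]) (auto simp: l F_def simp del: block_start.simps)
      qed
    qed (use amax in auto)
    then have wG: "weights_bounded amax G" by (simp add: topology_class_def)
    interpret noisy_network M w G a x1 amax vlo vhi by (rule net[OF wG])
    have loop: "mean_disagreement s + (a s)\<^sup>2 * ?q \<le> mean_disagreement (Suc s)" if "1 \<le> s" "s \<notin> F" for s
      using that n by (intro mean_disagreement_Suc_ge) (auto simp: G_def flash_topology_def)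
    have flash: "(1 - ?n * a s)\<^sup>2 * mean_disagreement s + (a s)\<^sup>2 * ?q \<le> mean_disagreement (Suc s)"
      if "1 \<le> s" "s \<in> F" for s
      using that n by (intro mean_disagreement_Suc_ge) (auto simp: G_def flash_topology_def)
    have F_block: "s = m k" if s: "?T k \<le> s" "s < ?T (Suc k)" "s < t" "s \<in> F" for s k
    proof -
      obtain j where j: "s = m j" using s by (auto simp: F_def)
      then have "j = k" using m(1,2)[of j] s by (intro same[of j s k]) auto
      then show ?thesis using j by simp
    qed
    have block: "?T k \<le> t \<Longrightarrow> C * real (?T k) powr (- ?p) \<le> mean_disagreement (?T k)" for k
    proof (induction k)
      case 0
      then show ?case using C mean_disagreement_1 by simp
    next
      case (Suc k)
      let ?L = "real (?T (Suc k) - ?T k)"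
      have Tk: "?T k \<le> t" using Suc.prems T(2)[of k] by simp
      note Tm = m(1,2)[of k]
      have before_t: "s < t" if "s < ?T (Suc k)" for s using that Suc.prems by simp
      have pos: "1 \<le> s" if "?T k \<le> s" for s using that T(1)[of k] by simp
      have mF: "m k \<in> F" using Suc.prems by (auto simp: F_def)
      have "?n * a (m k) \<le> 1 / 2 \<and> (1 - 2 * (?n * a (m k))) * mean_disagreement (?T k)
            + ?L * (a (m k))\<^sup>2 * ?q / 4 \<le> mean_disagreement (?T (Suc k))
          \<or> ?q / (4 * ?n\<^sup>2) \<le> mean_disagreement (?T (Suc k))"
      proof (rule one_contraction_per_block[OF Tm])
        show "0 \<le> a (m k)" using a before_t[OF Tm(2)] pos[OF Tm(1)] by auto
        show "a (m k) \<le> a s" if "?T k \<le> s" "s < ?T (Suc k)" for s by (rule m(3)[OF that])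
        show "mean_disagreement s + (a s)\<^sup>2 * ?q \<le> mean_disagreement (Suc s)"
          if "?T k \<le> s" "s < ?T (Suc k)" "s \<noteq> m k" for s
          using F_block[OF that(1,2) before_t[OF that(2)]] that(3) pos[OF that(1)] by (intro loop) auto
        show "(1 - ?n * a (m k))\<^sup>2 * mean_disagreement (m k) + (a (m k))\<^sup>2 * ?q \<le> mean_disagreement (Suc (m k))"
          by (rule flash[OF pos[OF Tm(1)] mF])
      qed (use vlo n0 mean_disagreement_nonneg in auto)
      then show ?case
      proof (elim disjE conjE)
        assume s: "?n * a (m k) \<le> 1 / 2" "(1 - 2 * (?n * a (m k))) * mean_disagreement (?T k)
            + ?L * (a (m k))\<^sup>2 * ?q / 4 \<le> mean_disagreement (?T (Suc k))"
        show ?case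
        proof (rule lower_rate_step[OF \<delta> c _ n0 _ _ _ T(3,4) C0 C(3) s(1) Suc.IH[OF Tk] s(2)])
          show "real (?T (Suc k)) = real (?T k) + ?L" using T(2)[of k] by simp
        qed (use vlo T(1)[of k] T(2)[of k] in auto)
      next
        assume s: "?q / (4 * ?n\<^sup>2) \<le> mean_disagreement (?T (Suc k))"
        have "C * real (?T (Suc k)) powr (- ?p) \<le> C * 1"
          using C0 T(1)[of "Suc k"] \<delta> powr_mono[of "- ?p" 0 "real (?T (Suc k))"]
          by (intro mult_left_mono) (auto simp del: block_start.simps)
        then show ?case using s C(2) by linarith
      qed
    qed
    obtain k where k: "?T k \<le> t" "t < ?T (Suc k)"
      using block_containing[of "\<lambda>k. ?T (k - 1)" t] smono t by (auto simp del: block_start.simps(2))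
    have "s \<le> t \<Longrightarrow> mean_disagreement (?T k) \<le> mean_disagreement s" if "?T k \<le> s" for s
      using that
    proof (induction s rule: dec_induct)
      case (step s)
      have "s \<notin> F"
      proof
        assume "s \<in> F"
        then obtain j where j: "?T (Suc j) \<le> t" "s = m j" using step.prems by (auto simp: F_def)
        then have "j = k" using m(1,2)[of j] step.hyps step.prems k by (intro same[of j s k]) auto
        then show False using j k by simp
      qed
      then have "mean_disagreement s + (a s)\<^sup>2 * ?q \<le> mean_disagreement (Suc s)"
        using step.hyps T(1)[of k] by (intro loop) auto
      moreover have "0 \<le> (a s)\<^sup>2 * ?q" using vlo by simp
      ultimately show ?case using step by simp
    qed simp
    from this[of t] have "mean_disagreement (?T k) \<le> mean_disagreement t" using k by simp
    moreover have "C * real t powr (- ?p) \<le> C * real (?T k) powr (- ?p)"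
      using C0 k T(1)[of k] \<delta> by (intro mult_left_mono powr_mono2') auto
    ultimately show "\<exists>G\<in>topology_class amax \<delta> c.
        C * real t powr (- ?p) \<le> noisy_network.mean_disagreement M w G a x1 t"
      using block[OF k(1)] G by (intro bexI[of _ G]) auto
  qed
qed

section \<open>Order of the optimal rate and convergence under the polynomial gain\<close>

lemma admissible_noise_network:
  assumes "prob_space M" "admissible_noise M amax w" "1 \<le> amax"
  obtains vlo vhi where "0 < vlo" "0 < vhi"
    "\<And>G. weights_bounded amax G \<Longrightarrow> noisy_network M w G amax vlo vhi"
proof -
  obtain vlo vhi where v: "0 < vlo" "vlo \<le> vhi"
    and w: "\<And>G. weights_bounded amax G \<Longrightarrow>
         (\<forall>t\<ge>1. \<forall>(j, i)\<in>edges (G t).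
            integrable M (w G t j i) \<and> (\<integral>\<omega>. w G t j i \<omega> \<partial>M) = 0 \<and>
            integrable M (\<lambda>\<omega>. (w G t j i \<omega>)\<^sup>2)) \<and>
         (\<forall>s\<ge>1. \<forall>t\<ge>1. s \<noteq> t \<longrightarrow>
            (\<forall>(j1, i1)\<in>edges (G s). \<forall>(j2, i2)\<in>edges (G t).
               (\<integral>\<omega>. w G s j1 i1 \<omega> * w G t j2 i2 \<omega> \<partial>M) = 0)) \<and>
         (\<forall>t\<ge>1. edges (G t) \<noteq> {} \<longrightarrow>
            (\<forall>d.
               vlo * (\<Sum>(j, i)\<in>edges (G t). (d j i)\<^sup>2)
                 \<le> (\<integral>\<omega>. (\<Sum>(j, i)\<in>edges (G t). d j i * w G t j i \<omega>)\<^sup>2 \<partial>M) \<and>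
               (\<integral>\<omega>. (\<Sum>(j, i)\<in>edges (G t). d j i * w G t j i \<omega>)\<^sup>2 \<partial>M)
                 \<le> vhi * (\<Sum>(j, i)\<in>edges (G t). (d j i)\<^sup>2)))"
    using assms(2) unfolding admissible_noise_def by blast
  have "noisy_network M w G amax vlo vhi" if "weights_bounded amax G" for G
  proof (intro noisy_network.intro noisy_network_axioms.intro)
    note wG = w[OF that]
    show "weights_in amax (G t)" if "1 \<le> t" for t
      using \<open>weights_bounded amax G\<close> that by (simp add: weights_bounded_iff)
    show "integrable M (w G t j i)" "(\<integral>\<omega>. w G t j i \<omega> \<partial>M) = 0" "integrable M (\<lambda>\<omega>. (w G t j i \<omega>)\<^sup>2)"
      if "1 \<le> t" "(j, i) \<in> edges (G t)" for t j i
      using conjunct1[OF wG] that by blast+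
    show "(\<integral>\<omega>. w G s j i \<omega> * w G t k l \<omega> \<partial>M) = 0"
      if "1 \<le> s" "1 \<le> t" "s \<noteq> t" "(j, i) \<in> edges (G s)" "(k, l) \<in> edges (G t)" for s t j i k l
      using conjunct1[OF conjunct2[OF wG]] that by blast
    show "vlo * (\<Sum>(j, i)\<in>edges (G t). (d j i)\<^sup>2)
        \<le> (\<integral>\<omega>. (\<Sum>(j, i)\<in>edges (G t). d j i * w G t j i \<omega>)\<^sup>2 \<partial>M)" if "1 \<le> t" for t d
      using conjunct2[OF conjunct2[OF wG]] that by (cases "edges (G t) = {}") auto
    show "(\<integral>\<omega>. (\<Sum>(j, i)\<in>edges (G t). d j i * w G t j i \<omega>)\<^sup>2 \<partial>M)
        \<le> vhi * (\<Sum>(j, i)\<in>edges (G t). (d j i)\<^sup>2)" if "1 \<le> t" for t d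
      using conjunct2[OF conjunct2[OF wG]] that by (cases "edges (G t) = {}") auto
  qed (use assms v in auto)
  then show ?thesis using v by (intro that[of vlo vhi]) auto
qed

text \<open>Two agents can only be connected through some edge, whose weight lies between the two bounds.\<close>

lemma topology_class_amax_ge_1:
  fixes G :: "('n::finite) topology" and i j :: 'n
  assumes G: "G \<in> topology_class amax \<delta> c" and ij: "i \<noteq> j"
  shows "1 \<le> amax"
proof -
  obtain \<tau> :: "nat \<Rightarrow> nat" where \<tau>: "\<tau> 1 = 1"
    "\<And>k. 1 < k \<Longrightarrow> strongly_connected (with_proj (union_graph G {\<tau> (k - 1)..<\<tau> k}))"
    using G unfolding topology_class_def ext_joint_connected_def by blast
  have "strongly_connected (with_proj (union_graph G {1..<\<tau> 2}))" using \<tau>(2)[of 2] \<tau>(1) by simp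
  then have path: "(i, j) \<in> (\<Union>t\<in>{1..<\<tau> 2}. edges (G t))\<^sup>*" by (rule union_graph_rtrancl)
  have "(\<Union>t\<in>{1..<\<tau> 2}. edges (G t)) \<noteq> {}"
  proof
    assume "(\<Union>t\<in>{1..<\<tau> 2}. edges (G t)) = {}"
    with path ij show False by (simp only: rtrancl_empty) simp
  qed
  then obtain t l k where "1 \<le> t" "(l, k) \<in> edges (G t)" by auto
  then have "1 \<le> weight (G t) $ k $ l \<and> weight (G t) $ k $ l \<le> amax"
    using G by (auto simp: topology_class_def weights_bounded_iff weights_in_def)
  then show ?thesis by linarith
qed

lemma V_pos:
  assumes "x $ i \<noteq> x $ j"
  shows "0 < V x"
proof (rule ccontr)
  assume "\<not> 0 < V x"
  then have "V x = 0" using V_nonneg[of x] by simp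
  then have "\<forall>k. x $ k = ave x" by (simp add: V_def sum_nonneg_eq_0_iff)
  with assms show False by metis
qed

text \<open>For \<open>n = 2\<close> both constants are \<open>64 c\<close>; for larger \<open>n\<close> the difference becomes a polynomial in
  \<open>n - 3\<close> with positive coefficients.\<close>

lemma gain_constant_sufficient:
  fixes c \<alpha> :: real and n :: nat
  assumes n: "2 \<le> n" and c: "1 \<le> c"
    and \<alpha>: "\<alpha> \<ge> 32 * real n * (real n - 1) ^ 4 * c / (2 * real n - 3)\<^sup>2"
  shows "16 * (real n)\<^sup>2 * c \<le> \<alpha>"
proof -
  have key: "real n * (2 * real n - 3)\<^sup>2 \<le> 2 * (real n - 1) ^ 4"
  proof (cases "n = 2")
    case False
    define k where "k = real n - 3"
    have k: "0 \<le> k" "real n = k + 3" using n False by (auto simp: k_def)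
    have "2 * (real n - 1) ^ 4 = real n * (2 * real n - 3)\<^sup>2 + (2 * k ^ 4 + 12 * k ^ 3 + 24 * k\<^sup>2 + 19 * k + 5)"
      unfolding k(2) by (simp add: power2_eq_square power3_eq_cube power4_eq_xxxx algebra_simps)
    moreover have "0 \<le> 2 * k ^ 4 + 12 * k ^ 3 + 24 * k\<^sup>2 + 19 * k + 5" using k by simp
    ultimately show ?thesis by linarith
  qed simp
  have pos: "0 < (2 * real n - 3)\<^sup>2" using n by simp
  have "16 * (real n)\<^sup>2 * c * (2 * real n - 3)\<^sup>2 = 16 * real n * c * (real n * (2 * real n - 3)\<^sup>2)"
    by (simp add: power2_eq_square)
  also have "\<dots> \<le> 16 * real n * c * (2 * (real n - 1) ^ 4)"
    using key c by (intro mult_left_mono) auto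
  finally have "16 * (real n)\<^sup>2 * c \<le> 32 * real n * (real n - 1) ^ 4 * c / (2 * real n - 3)\<^sup>2"
    using pos by (simp add: pos_le_divide_eq mult_ac)
  with \<alpha> show ?thesis by linarith
qed

lemma summable_gain_power2:
  fixes \<alpha> tstar \<delta> :: real
  assumes "0 \<le> \<alpha>" "0 \<le> tstar" "\<delta> < 1 / 2"
  shows "summable (\<lambda>t. (\<alpha> / (real t powr (1 - \<delta>) + tstar))\<^sup>2)"
proof (rule summable_comparison_test)
  show "summable (\<lambda>t. \<alpha>\<^sup>2 * real t powr (2 * \<delta> - 2))"
    using assms by (intro summable_mult) (simp add: summable_real_powr_iff)
  have "norm ((\<alpha> / (real t powr (1 - \<delta>) + tstar))\<^sup>2) \<le> \<alpha>\<^sup>2 * real t powr (2 * \<delta> - 2)" if t: "1 \<le> t" for t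
  proof -
    have "(\<alpha> / (real t powr (1 - \<delta>) + tstar))\<^sup>2 \<le> (\<alpha> * real t powr (\<delta> - 1))\<^sup>2"
      using assms t gain_nonneg_le[of \<alpha> tstar t \<delta>] by (intro power_mono gain_le) auto
    also have "\<dots> = \<alpha>\<^sup>2 * real t powr ((\<delta> - 1) + (\<delta> - 1))"
      unfolding powr_add by (simp add: power2_eq_square)
    also have "(\<delta> - 1) + (\<delta> - 1) = 2 * \<delta> - 2" by simp
    finally show ?thesis by simp
  qed
  then show "\<exists>N. \<forall>t\<ge>N. norm ((\<alpha> / (real t powr (1 - \<delta>) + tstar))\<^sup>2) \<le> \<alpha>\<^sup>2 * real t powr (2 * \<delta> - 2)"
    by blast
qed

theorem theorem4p4:
  fixes M :: "'w measure"
    and G :: "('n::finite) topology"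
    and w :: "('n, 'w) noise"
    and x1 :: "real ^ 'n"
    and \<delta> c amax :: real
  assumes "prob_space M"
    and "0 \<le> \<delta>" and "\<delta> < 1 / 2" and "1 \<le> c"
    and "G \<in> topology_class amax \<delta> c"
    and "admissible_noise M amax w"
    and "\<exists>i j. x1 $ i \<noteq> x1 $ j"
  shows "finite_bigtheta (rho2 M amax \<delta> c w x1) (\<lambda>t. 1 / real t powr (1 - 2 * \<delta>)) \<and>
    (\<forall>\<alpha> tstar :: real.
       \<alpha> \<ge> 32 * real CARD('n) * (real CARD('n) - 1) ^ 4 * c / (2 * real CARD('n) - 3)\<^sup>2 \<longrightarrow>
       tstar \<ge> real_of_int \<lfloor>2 * \<alpha> * (real CARD('n) - 1) * amax\<rfloor> \<longrightarrow>
       (let x = state (\<lambda>t. \<alpha> / (real t powr (1 - \<delta>) + tstar)) w G x1 in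
          unbiased_ms_average_consensus M x x1 \<and>
          finite_bigo (EV M x) (\<lambda>t. 1 / real t powr (1 - 2 * \<delta>))))"
proof -
  let ?n = "real CARD('n)" and ?p = "1 - 2 * \<delta>"
  note \<delta> = assms(2,3) and c = assms(4)
  obtain i j where ij: "x1 $ i \<noteq> x1 $ j" using assms(7) by blast
  then have "i \<noteq> j" by auto
  then have "card {i, j} = 2" by simp
  then have n2: "2 \<le> CARD('n)" using card_mono[of UNIV "{i, j}"] by simp
  have amax: "1 \<le> amax" by (rule topology_class_amax_ge_1[OF assms(5) \<open>i \<noteq> j\<close>])
  obtain vlo vhi where v: "0 < vlo" "0 < vhi"
    and net: "\<And>G. weights_bounded amax G \<Longrightarrow> noisy_network M w G amax vlo vhi"
    using admissible_noise_network[OF assms(1,6) amax] by blast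
  have member: "noisy_network M w H amax vlo vhi" "\<forall>t\<ge>1. balanced (H t)" "ext_joint_connected \<delta> c H"
    if "H \<in> topology_class amax \<delta> c" for H :: "'n topology"
    using that net by (auto simp: topology_class_def)
  have rate: "\<exists>K>0. \<forall>H\<in>topology_class amax \<delta> c. \<forall>t\<ge>1.
      EV M (state (\<lambda>t. \<alpha> / (real t powr (1 - \<delta>) + tstar)) w H x1) t \<le> ennreal (K * real t powr (- ?p))"
    if \<alpha>: "16 * ?n\<^sup>2 * c \<le> \<alpha>" and tstar: "0 \<le> tstar" for \<alpha> tstar
  proof -
    let ?a = "\<lambda>t. \<alpha> / (real t powr (1 - \<delta>) + tstar)"
    obtain K where K: "0 < K" "\<And>H t. noisy_network M w H amax vlo vhi \<Longrightarrow> \<forall>t\<ge>1. balanced (H t) \<Longrightarrow>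
        ext_joint_connected \<delta> c H \<Longrightarrow> 1 \<le> t \<Longrightarrow>
        noisy_network.mean_disagreement M w H ?a x1 t \<le> K * real t powr (- ?p)"
      using disagreement_rate[OF \<delta> c tstar \<alpha> v(2), of M w amax vlo x1] by blast
    have "EV M (state ?a w H x1) t \<le> ennreal (K * real t powr (- ?p))"
      if H: "H \<in> topology_class amax \<delta> c" and t: "1 \<le> t" for H t
    proof -
      interpret noisy_network M w H ?a x1 amax vlo vhi by (rule member(1)[OF H])
      show ?thesis using K(2)[OF member[OF H] t] by (simp add: EV_eq[OF t] ennreal_leI)
    qed
    then show ?thesis using K(1) by blast
  qed
  have theta: "finite_bigtheta (rho2 M amax \<delta> c w x1) (\<lambda>t. 1 / real t powr ?p)"
  proof -
    let ?\<alpha> = "16 * ?n\<^sup>2 * c"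
    let ?a = "\<lambda>t. ?\<alpha> / (real t powr (1 - \<delta>) + 0)"
    obtain K where K: "0 < K" "\<And>H t. H \<in> topology_class amax \<delta> c \<Longrightarrow> 1 \<le> t \<Longrightarrow>
        EV M (state ?a w H x1) t \<le> ennreal (K * real t powr (- ?p))"
      using rate[of ?\<alpha> 0] by auto
    have upper: "rho2 M amax \<delta> c w x1 t \<le> ennreal (K * real t powr (- ?p))" if t: "1 \<le> t" for t
      unfolding rho2_def
    proof (rule INF_lower2)
      show "?a \<in> {a. \<forall>s\<in>{1..<t}. 0 \<le> a s}" using c by simp
      show "(SUP H\<in>topology_class amax \<delta> c. EV M (state ?a w H x1) t) \<le> ennreal (K * real t powr (- ?p))"
        by (intro SUP_least K(2) t)
    qed
    obtain C where C: "0 < C" "\<And>t a. 1 \<le> t \<Longrightarrow> \<forall>s\<in>{1..<t}. 0 \<le> a s \<Longrightarrow>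
        \<exists>H\<in>topology_class amax \<delta> c. C * real t powr (- ?p) \<le> noisy_network.mean_disagreement M w H a x1 t"
      using disagreement_lower_bound[OF \<delta> c amax v(1) n2 V_pos[OF ij] net] by blast
    have lower: "ennreal (C * real t powr (- ?p)) \<le> rho2 M amax \<delta> c w x1 t" if t: "1 \<le> t" for t
      unfolding rho2_def
    proof (rule INF_greatest)
      fix a :: "nat \<Rightarrow> real" assume "a \<in> {a. \<forall>s\<in>{1..<t}. 0 \<le> a s}"
      then obtain H where H: "H \<in> topology_class amax \<delta> c"
        "C * real t powr (- ?p) \<le> noisy_network.mean_disagreement M w H a x1 t"
        using C(2)[OF t] by blast
      interpret noisy_network M w H a x1 amax vlo vhi by (rule member(1)[OF H(1)])
      have "ennreal (C * real t powr (- ?p)) \<le> EV M (state a w H x1) t"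
        using H(2) by (simp add: EV_eq[OF t] ennreal_leI)
      then show "ennreal (C * real t powr (- ?p)) \<le> (SUP H\<in>topology_class amax \<delta> c. EV M (state a w H x1) t)"
        by (rule SUP_upper2[OF H(1)])
    qed
    have fin: "rho2 M amax \<delta> c w x1 t < \<infinity>" if "1 \<le> t" for t
      using upper[OF that] by (rule le_less_trans) simp
    have bounds: "C * norm (1 / real t powr ?p) \<le> norm (enn2real (rho2 M amax \<delta> c w x1 t))"
      "norm (enn2real (rho2 M amax \<delta> c w x1 t)) \<le> K * norm (1 / real t powr ?p)" if t: "1 \<le> t" for t
    proof -
      have eq: "norm (1 / real t powr ?p) = real t powr (- ?p)" by (simp only: powr_minus_divide) simp
      show "C * norm (1 / real t powr ?p) \<le> norm (enn2real (rho2 M amax \<delta> c w x1 t))"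
        using enn2real_mono[OF lower[OF t]] fin[OF t] C(1) unfolding eq by simp
      show "norm (enn2real (rho2 M amax \<delta> c w x1 t)) \<le> K * norm (1 / real t powr ?p)"
        using enn2real_mono[OF upper[OF t]] K(1) unfolding eq by simp
    qed
    have "(\<lambda>t. enn2real (rho2 M amax \<delta> c w x1 t)) \<in> O(\<lambda>t. 1 / real t powr ?p)"
      by (rule bigoI[of _ K], rule eventually_mono[OF eventually_ge_at_top[of 1]]) (rule bounds)
    moreover have "(\<lambda>t. enn2real (rho2 M amax \<delta> c w x1 t)) \<in> \<Omega>(\<lambda>t. 1 / real t powr ?p)"
      by (rule landau_omega.bigI[of C], rule C(1), rule eventually_mono[OF eventually_ge_at_top[of 1]]) (rule bounds)
    ultimately show ?thesis unfolding finite_bigtheta_def using fin by (blast intro: bigthetaI)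
  qed
  have consensus: "unbiased_ms_average_consensus M (state (\<lambda>t. \<alpha> / (real t powr (1 - \<delta>) + tstar)) w G x1) x1 \<and>
      finite_bigo (EV M (state (\<lambda>t. \<alpha> / (real t powr (1 - \<delta>) + tstar)) w G x1)) (\<lambda>t. 1 / real t powr ?p)"
    if \<alpha>': "\<alpha> \<ge> 32 * ?n * (?n - 1) ^ 4 * c / (2 * ?n - 3)\<^sup>2"
      and tstar': "tstar \<ge> real_of_int \<lfloor>2 * \<alpha> * (?n - 1) * amax\<rfloor>" for \<alpha> tstar
  proof -
    let ?a = "\<lambda>t. \<alpha> / (real t powr (1 - \<delta>) + tstar)"
    have \<alpha>: "16 * ?n\<^sup>2 * c \<le> \<alpha>" by (rule gain_constant_sufficient[OF n2 c \<alpha>'])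
    have "0 \<le> 16 * ?n\<^sup>2 * c" using c by simp
    then have \<alpha>0: "0 \<le> \<alpha>" using \<alpha> by linarith
    have "0 \<le> 2 * \<alpha> * (?n - 1) * amax" using \<alpha>0 n2 amax by simp
    then have "0 \<le> real_of_int \<lfloor>2 * \<alpha> * (?n - 1) * amax\<rfloor>"
      by (simp only: of_int_0_le_iff zero_le_floor)
    then have tstar: "0 \<le> tstar" using tstar' by (rule order_trans)
    obtain K where K: "0 < K" "\<And>t. 1 \<le> t \<Longrightarrow> EV M (state ?a w G x1) t \<le> ennreal (K * real t powr (- ?p))"
      using rate[OF \<alpha> tstar] assms(5) by blast
    interpret noisy_network M w G ?a x1 amax vlo vhi by (rule member(1)[OF assms(5)])
    have le: "mean_disagreement t \<le> K * real t powr (- ?p)" if "1 \<le> t" for t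
      using K(2)[OF that] K(1) by (simp add: EV_eq[OF that] ennreal_le_iff)
    have "(\<lambda>t. real t powr (- ?p)) \<longlonglongrightarrow> 0"
      using \<delta> by (intro tendsto_neg_powr filterlim_real_sequentially) auto
    from tendsto_mult_left[OF this, of K] have K_lim: "(\<lambda>t. K * real t powr (- ?p)) \<longlonglongrightarrow> 0" by simp
    have "mean_disagreement \<longlonglongrightarrow> 0"
    proof (rule tendsto_sandwich[OF _ _ tendsto_const K_lim])
      show "eventually (\<lambda>t. 0 \<le> mean_disagreement t) sequentially"
        by (intro always_eventually allI mean_disagreement_nonneg)
      show "eventually (\<lambda>t. mean_disagreement t \<le> K * real t powr (- ?p)) sequentially"
        by (rule eventually_mono[OF eventually_ge_at_top[of 1]]) (rule le)
    qed
    then have "unbiased_ms_average_consensus M X x1"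
      using member(2)[OF assms(5)] summable_gain_power2[OF \<alpha>0 tstar \<delta>(2)]
      by (intro unbiased_consensus) auto
    moreover have "finite_bigo (EV M X) (\<lambda>t. 1 / real t powr ?p)"
    proof -
      have "norm (enn2real (EV M X t)) \<le> K * norm (1 / real t powr ?p)" if t: "1 \<le> t" for t
      proof -
        have eq: "norm (1 / real t powr ?p) = real t powr (- ?p)" by (simp only: powr_minus_divide) simp
        show ?thesis unfolding eq EV_eq[OF t] using le[OF t] mean_disagreement_nonneg[of t] by simp
      qed
      then have "(\<lambda>t. enn2real (EV M X t)) \<in> O(\<lambda>t. 1 / real t powr ?p)"
        by (intro bigoI[of _ K] eventually_mono[OF eventually_ge_at_top[of 1]])
      then show ?thesis by (simp add: finite_bigo_def EV_eq)
    qed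
    ultimately show ?thesis by blast
  qed
  show ?thesis using theta consensus by (simp add: Let_def)
qed

end
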